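(* Let $\Omega$ be a bounded, convex and causally convex domain in $\mathbf{R}^{1,n}$. Then $(\Omega,\delta_\Omega)$ is Gromov hyperbolic if and only if $\partial_c^+\Omega$ and $\partial_c^-\Omega$ are stably acausal.
   Context: Minkowski space: $\mathbf{R}^{1,n}$ ($n\ge 1$) is $\mathbf{R}\times\mathbf{R}^n$ with coordinates $(t,p)$, flat metric $\mathbf{b}=-dt^2+dp_1^2+\dots+dp_n^2$ and time orientation $\partial_t$. A nonzero vector $v$ is lightlike if $\mathbf{b}(v,v)=0$, causal if $\mathbf{b}(v,v)\le 0$; a causal curve is a piecewise smooth curve with future causal (or past causal) velocity. A domain is a nonempty, connected, proper open subset of $\mathbf{R}^{1,n}$. A domain $\Omega$ is causally convex if every causal curve of $\mathbf{R}^{1,n}$ with endpoints in $\Omega$ is contained in $\Omega$. Markowitz pseudodistance: let $I=(-1,1)$ and $\rho_I(s,t)=\left|\ln\frac{(s-1)(t+1)}{(s+1)(t-1)}\right|$. For a domain $\Omega$, a projectively parametrized lightlike geodesic of $\Omega$ is a curve $\gamma:I\to\Omega$, $\gamma(s)=x+h(s)v$, with $v$ lightlike and $h$ a (nonconstant) real homography without pole in $I$. Then $\delta_\Omega(x,y)=\inf\sum_{k=1}^m\rho_I(s_k,t_k)$, the infimum being over all finite families of such geodesics $\gamma_1,\dots,\gamma_m$ and points $s_k,t_k\in I$ with $\gamma_1(s_1)=x$, $\gamma_m(t_m)=y$, $\gamma_k(t_k)=\gamma_{k+1}(s_{k+1})$. Causal boundary: a causally convex domain can be written $\Omega=\{(t,p)\in\mathbf{R}\times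 U : f_-(p)<t<f_+(p)\}$ with $U\subset\mathbf{R}^n$ open and $f_\pm:\overline U\to\overline{\mathbf{R}}$ 1-Lipschitz, $f_-<f_+$ on $U$, $f_-=f_+$ on $\partial U$. The future (resp. past) causal boundary $\partial_c^+\Omega$ (resp. $\partial_c^-\Omega$) is the graph $\{(f_\pm(p),p)\}$ of $f_+$ (resp. $f_-$), and is empty if $f_+$ (resp. $f_-$) is infinite. Stable acausality: for $\varepsilon>0$ let $\mathbf{b}_\varepsilon=-(1+\varepsilon)^2dt^2+dp_1^2+\dots+dp_n^2$. A subset of $\mathbf{R}^{1,n}$ is $\varepsilon$-stably acausal if no two distinct points of it are causally related for $\mathbf{b}_\varepsilon$; it is stably acausal if it is $\varepsilon$-stably acausal for some $\varepsilon>0$. Gromov hyperbolicity of a proper geodesic metric space means that there is a constant $r>0$ such that each side of every geodesic triangle lies in the $r$-neighborhood of the union of the other two sides. *)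

theory Defs
  imports "HOL-Analysis.Analysis"
begin

type_synonym 'n minkowski = "real \<times> (real ^ 'n)"

definition mink :: "'n::finite minkowski \<Rightarrow> 'n minkowski \<Rightarrow> real" where
  "mink v w = - (fst v * fst w) + snd v \<bullet> snd w"

definition mink_eps :: "real \<Rightarrow> 'n::finite minkowski \<Rightarrow> 'n minkowski \<Rightarrow> real" where
  "mink_eps \<epsilon> v w = - ((1 + \<epsilon>)\<^sup>2 * (fst v * fst w)) + snd v \<bullet> snd w"

definition lightlike :: "'n::finite minkowski \<Rightarrow> bool" where
  "lightlike v \<longleftrightarrow> v \<noteq> 0 \<and> mink v v = 0"

text \<open>The notions of causality are relative to a flat Lorentzian form \<open>B\<close>, which is
  \<open>mink\<close> or some \<open>mink_eps \<epsilon>\<close>. The vector \<open>(1, 0)\<close> is the coordinate field of \<open>t\<close>, which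
  is the time orientation.\<close>

definition causal_vec ::
    "('n::finite minkowski \<Rightarrow> 'n minkowski \<Rightarrow> real) \<Rightarrow> 'n minkowski \<Rightarrow> bool" where
  "causal_vec B v \<longleftrightarrow> v \<noteq> 0 \<and> B v v \<le> 0"

definition future_causal ::
    "('n::finite minkowski \<Rightarrow> 'n minkowski \<Rightarrow> real) \<Rightarrow> 'n minkowski \<Rightarrow> bool" where
  "future_causal B v \<longleftrightarrow> causal_vec B v \<and> B v (1, 0) < 0"

definition past_causal ::
    "('n::finite minkowski \<Rightarrow> 'n minkowski \<Rightarrow> real) \<Rightarrow> 'n minkowski \<Rightarrow> bool" where
  "past_causal B v \<longleftrightarrow> causal_vec B v \<and> B v (1, 0) > 0"

text \<open>Infinitely differentiable on \<open>S\<close>; \<open>D k\<close> is the \<open>k\<close>-th derivative. On a closed interval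
  the derivatives at the end points are one-sided.\<close>

definition smooth_curve_on :: "real set \<Rightarrow> (real \<Rightarrow> 'a::real_normed_vector) \<Rightarrow> bool" where
  "smooth_curve_on S g \<longleftrightarrow>
     (\<exists>D. D 0 = g \<and>
        (\<forall>k::nat. \<forall>t\<in>S. (D k has_vector_derivative D (Suc k) t) (at t within S)))"

text \<open>At a break point \<open>\<tau> i\<close> both one-sided velocities are required to be causal, and the
  time direction is the same on all pieces.\<close>

definition causal_curve ::
    "('n::finite minkowski \<Rightarrow> 'n minkowski \<Rightarrow> real) \<Rightarrow> (real \<Rightarrow> 'n minkowski)
      \<Rightarrow> real \<Rightarrow> real \<Rightarrow> bool" where
  "causal_curve B g a b \<longleftrightarrow>
     a < b \<and> continuous_on {a..b} g \<and>
     (\<exists>(N::nat) \<tau>. \<tau> 0 = a \<and> \<tau> N = b \<and>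
        (\<forall>i<N. \<tau> i < \<tau> (Suc i) \<and> smooth_curve_on {\<tau> i..\<tau> (Suc i)} g) \<and>
        ((\<forall>i<N. \<forall>t\<in>{\<tau> i..\<tau> (Suc i)}.
            future_causal B (vector_derivative g (at t within {\<tau> i..\<tau> (Suc i)}))) \<or>
         (\<forall>i<N. \<forall>t\<in>{\<tau> i..\<tau> (Suc i)}.
            past_causal B (vector_derivative g (at t within {\<tau> i..\<tau> (Suc i)})))))"

definition causally_related ::
    "('n::finite minkowski \<Rightarrow> 'n minkowski \<Rightarrow> real) \<Rightarrow> 'n minkowski \<Rightarrow> 'n minkowski \<Rightarrow> bool" where
  "causally_related B x y \<longleftrightarrow> (\<exists>g a b. causal_curve B g a b \<and> g a = x \<and> g b = y)"

definition mink_domain :: "'n::finite minkowski set \<Rightarrow> bool" where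
  "mink_domain \<Omega> \<longleftrightarrow> \<Omega> \<noteq> {} \<and> connected \<Omega> \<and> \<Omega> \<noteq> UNIV \<and> open \<Omega>"

definition causally_convex :: "'n::finite minkowski set \<Rightarrow> bool" where
  "causally_convex \<Omega> \<longleftrightarrow>
     (\<forall>g a b. causal_curve mink g a b \<and> g a \<in> \<Omega> \<and> g b \<in> \<Omega> \<longrightarrow> g ` {a..b} \<subseteq> \<Omega>)"

definition rho_I :: "real \<Rightarrow> real \<Rightarrow> real" where
  "rho_I s t = \<bar>ln (((s - 1) * (t + 1)) / ((s + 1) * (t - 1)))\<bar>"

definition homography_on :: "real set \<Rightarrow> (real \<Rightarrow> real) \<Rightarrow> bool" where
  "homography_on S h \<longleftrightarrow>
     (\<exists>a b c d. a * d - b * c \<noteq> 0 \<and>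
        (\<forall>s\<in>S. c * s + d \<noteq> 0 \<and> h s = (a * s + b) / (c * s + d)))"

definition proj_lightlike_geodesic ::
    "'n::finite minkowski set \<Rightarrow> (real \<Rightarrow> 'n minkowski) \<Rightarrow> bool" where
  "proj_lightlike_geodesic \<Omega> \<gamma> \<longleftrightarrow>
     \<gamma> ` {-1<..<1} \<subseteq> \<Omega> \<and>
     (\<exists>x v h. lightlike v \<and> homography_on {-1<..<1} h \<and>
        (\<forall>s\<in>{-1<..<1}. \<gamma> s = x + h s *\<^sub>R v))"

definition lightlike_chain ::
    "'n::finite minkowski set \<Rightarrow> 'n minkowski \<Rightarrow> 'n minkowski \<Rightarrow> nat
      \<Rightarrow> (nat \<Rightarrow> real \<Rightarrow> 'n minkowski) \<Rightarrow> (nat \<Rightarrow> real) \<Rightarrow> (nat \<Rightarrow> real) \<Rightarrow> bool" where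
  "lightlike_chain \<Omega> x y m \<gamma> s t \<longleftrightarrow>
     1 \<le> m \<and>
     (\<forall>k\<in>{1..m}. proj_lightlike_geodesic \<Omega> (\<gamma> k) \<and> s k \<in> {-1<..<1} \<and> t k \<in> {-1<..<1}) \<and>
     \<gamma> 1 (s 1) = x \<and> \<gamma> m (t m) = y \<and>
     (\<forall>k\<in>{1..<m}. \<gamma> k (t k) = \<gamma> (Suc k) (s (Suc k)))"

text \<open>In a domain any two points are joined by a chain, so the infimum is over a nonempty set
  of nonnegative reals. The value \<open>0\<close> outside \<open>\<Omega>\<close> is a dummy: the locale \<open>Metric_space\<close> asks
  for symmetry and nonnegativity on the whole type.\<close>

definition markowitz_dist ::
    "'n::finite minkowski set \<Rightarrow> 'n minkowski \<Rightarrow> 'n minkowski \<Rightarrow> real" where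
  "markowitz_dist \<Omega> x y =
     (if x \<in> \<Omega> \<and> y \<in> \<Omega>
      then Inf {(\<Sum>k=1..m. rho_I (s k) (t k)) | m \<gamma> s t. lightlike_chain \<Omega> x y m \<gamma> s t}
      else 0)"

text \<open>In \<open>ereal\<close> the inequality below says that \<open>f\<close> is either real-valued and 1-Lipschitz on
  \<open>S\<close>, or constantly \<open>\<infinity>\<close>, or constantly \<open>-\<infinity>\<close>.\<close>

definition one_lipschitz_on :: "'a::metric_space set \<Rightarrow> ('a \<Rightarrow> ereal) \<Rightarrow> bool" where
  "one_lipschitz_on S f \<longleftrightarrow> (\<forall>p\<in>S. \<forall>q\<in>S. f p \<le> f q + ereal (dist p q))"

definition causal_graph_form ::
    "'n::finite minkowski set \<Rightarrow> (real ^ 'n) set \<Rightarrow> (real ^ 'n \<Rightarrow> ereal) \<Rightarrow> (real ^ 'n \<Rightarrow> ereal)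
      \<Rightarrow> bool" where
  "causal_graph_form \<Omega> U fm fp \<longleftrightarrow>
     open U \<and> one_lipschitz_on (closure U) fm \<and> one_lipschitz_on (closure U) fp \<and>
     (\<forall>p\<in>U. fm p < fp p) \<and> (\<forall>p\<in>frontier U. fm p = fp p) \<and>
     \<Omega> = {(t, p). p \<in> U \<and> fm p < ereal t \<and> ereal t < fp p}"

text \<open>\<open>\<Omega>\<close> determines \<open>U\<close> (its projection), \<open>fm\<close> and \<open>fp\<close> on \<open>U\<close> (infimum and supremum of
  the fibres) and hence, by continuity, on \<open>closure U\<close>. So the existential quantifiers in the
  next two definitions do not involve a choice. An infinite \<open>fp\<close> or \<open>fm\<close> gives the empty set.\<close>

definition future_causal_boundary :: "'n::finite minkowski set \<Rightarrow> 'n minkowski set" where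
  "future_causal_boundary \<Omega> =
     {(t, p). \<exists>U fm fp. causal_graph_form \<Omega> U fm fp \<and> p \<in> closure U \<and> fp p = ereal t}"

definition past_causal_boundary :: "'n::finite minkowski set \<Rightarrow> 'n minkowski set" where
  "past_causal_boundary \<Omega> =
     {(t, p). \<exists>U fm fp. causal_graph_form \<Omega> U fm fp \<and> p \<in> closure U \<and> fm p = ereal t}"

definition eps_stably_acausal :: "real \<Rightarrow> 'n::finite minkowski set \<Rightarrow> bool" where
  "eps_stably_acausal \<epsilon> A \<longleftrightarrow>
     (\<forall>x\<in>A. \<forall>y\<in>A. x \<noteq> y \<longrightarrow> \<not> causally_related (mink_eps \<epsilon>) x y)"

definition stably_acausal :: "'n::finite minkowski set \<Rightarrow> bool" where
  "stably_acausal A \<longleftrightarrow> (\<exists>\<epsilon>>0. eps_stably_acausal \<epsilon> A)"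

definition geodesic_segment ::
    "'a set \<Rightarrow> ('a \<Rightarrow> 'a \<Rightarrow> real) \<Rightarrow> 'a \<Rightarrow> 'a \<Rightarrow> 'a set \<Rightarrow> bool" where
  "geodesic_segment M d x y S \<longleftrightarrow>
     S \<subseteq> M \<and>
     (\<exists>L g. 0 \<le> L \<and> g 0 = x \<and> g L = y \<and> S = g ` {0..L} \<and>
        (\<forall>s\<in>{0..L}. \<forall>t\<in>{0..L}. d (g s) (g t) = \<bar>s - t\<bar>))"

definition proper_geodesic_space :: "'a set \<Rightarrow> ('a \<Rightarrow> 'a \<Rightarrow> real) \<Rightarrow> bool" where
  "proper_geodesic_space M d \<longleftrightarrow>
     Metric_space M d \<and>
     (\<forall>x\<in>M. \<forall>r. compactin (Metric_space.mtopology M d) (Metric_space.mcball M d x r)) \<and>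
     (\<forall>x\<in>M. \<forall>y\<in>M. \<exists>S. geodesic_segment M d x y S)"

definition metric_nbhd :: "'a set \<Rightarrow> ('a \<Rightarrow> 'a \<Rightarrow> real) \<Rightarrow> real \<Rightarrow> 'a set \<Rightarrow> 'a set" where
  "metric_nbhd M d r S = {u \<in> M. \<exists>w\<in>S. d u w < r}"

definition gromov_hyperbolic :: "'a set \<Rightarrow> ('a \<Rightarrow> 'a \<Rightarrow> real) \<Rightarrow> bool" where
  "gromov_hyperbolic M d \<longleftrightarrow>
     proper_geodesic_space M d \<and>
     (\<exists>r>0. \<forall>x y z A B C.
        geodesic_segment M d x y A \<and> geodesic_segment M d y z B \<and> geodesic_segment M d z x C \<longrightarrow>
        A \<subseteq> metric_nbhd M d r (B \<union> C) \<and>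
        B \<subseteq> metric_nbhd M d r (C \<union> A) \<and>
        C \<subseteq> metric_nbhd M d r (A \<union> B))"

end

theory Submission
  imports Defs
begin

text \<open>Write \<open>\<Omega> = {lower < t < upper}\<close>; the claim is that hyperbolicity means that both functions
  have a Lipschitz constant \<open>k < 1\<close>. Two estimates govern the metric. From above, the Hilbert
  metrics of the lightlike chords bound it. From below, \<open>\<bar>ln (F y / F x)\<bar>\<close> bounds it for
  every \<open>F\<close> that is positive on \<open>\<Omega>\<close> and affine along lightlike lines, for example an affine
  function or \<open>x \<mapsto> mink (x - a) (x - a)\<close>.

  If \<open>k < 1\<close>, the distance is comparable to the quasihyperbolic one of a bounded convex domain:
  geodesics satisfy a double cone condition (Gehring and Osgood), and triangles are thin because
  two geodesics from the same point are close as long as they have the same distance to the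
  boundary.

  If the boundary has supergradients \<open>\<xi>\<close> of norm arbitrarily close to 1, follow one from its base
  point backwards to a point \<open>a\<close> of the rim \<open>upper = lower\<close>. The plane spanned by \<open>\<xi>\<close> and the time
  axis there contains large quadrilaterals with lightlike sides, on which the metric is almost an
  \<open>\<ell>\<^sup>1\<close> product. The functions \<open>mink (x - a) (x - a)\<close>, positive because \<open>a\<close> is on both
  boundaries, and the supporting affine function at the base point show that both diagonals are
  long.\<close>

subsection \<open>Null paths\<close>

text \<open>The number \<open>k\<close> enters through one inequality: a lightlike vector changes an
  affine function whose spatial gradient has norm at most \<open>k\<close> and whose time
  coefficient is -1 by at least \<open>1 - k\<close> times the size of its time component. So for
  \<open>k < 1\<close> lightlike motion is paid at the rate 1 / depth, which degenerates as
  \<open>k\<close> tends to 1. The obstacle is that the distance is an infimum over chains, neither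
  attained nor visibly separating points. For \<open>k < 1\<close> the same inequality separates
  points, balls turn out to be compact, and geodesics arise from approximate intermediate points.
  Conversely, hyperbolicity supplies the geodesics, and four points with distances known up to an
  additive constant suffice. In null coordinates \<open>z\<close>, \<open>m\<close> at the rim point
  the quadratic form is \<open>4 * z * m\<close> and the supporting function is close to
  \<open>2 * m\<close>; their logarithms measure one diagonal each. \<open>upper\<close> and
  \<open>lower\<close> live on the whole space so that supergradients exist everywhere, and facts
  about \<open>lower\<close> come from \<open>upper\<close> by reversing time.\<close>

lemma rho_I_eq:
  assumes "s \<in> {-1<..<1}" "t \<in> {-1<..<1}"
  shows "rho_I s t = \<bar>ln ((1 + t) / (1 - t)) - ln ((1 + s) / (1 - s))\<bar>"
proof -
  have "((s - 1) * (t + 1)) / ((s + 1) * (t - 1)) = ((1 + t) / (1 - t)) / ((1 + s) / (1 - s))"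
  proof -
    have "((s - 1) * (t + 1)) / ((s + 1) * (t - 1)) = (- ((1 - s) * (1 + t))) / (- ((1 + s) * (1 - t)))"
      by (rule arg_cong2[where f="(/)"]) (auto simp: algebra_simps)
    also have "\<dots> = ((1 + t) / (1 - t)) / ((1 + s) / (1 - s))"
      by (subst minus_divide_divide) (simp add: mult.commute)
    finally show ?thesis .
  qed
  moreover have "(1 + t) / (1 - t) > 0" "(1 + s) / (1 - s) > 0"
    using assms by auto
  ultimately show ?thesis
    unfolding rho_I_def by (simp only: ln_div) (use assms in auto)
qed

lemma rho_I_commute:
  assumes "s \<in> {-1<..<1}" "t \<in> {-1<..<1}"
  shows "rho_I s t = rho_I t s"
  using assms by (simp add: rho_I_eq abs_minus_commute)

lemma rho_I_nonneg: "0 \<le> rho_I s t"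
  by (simp add: rho_I_def)

lemma exp_rho_I_ge:
  assumes "s \<in> {-1<..<1}" "t \<in> {-1<..<1}"
  shows "((1 + t) * (1 - s)) / ((1 - t) * (1 + s)) \<le> exp (rho_I s t)"
    and "((1 - t) * (1 + s)) / ((1 + t) * (1 - s)) \<le> exp (rho_I s t)"
proof -
  let ?A = "\<lambda>t::real. (1 + t) / (1 - t)"
  have pos: "?A t > 0" "?A s > 0" using assms by auto
  have "exp (ln (?A t) - ln (?A s)) \<le> exp (rho_I s t)"
    "exp (ln (?A s) - ln (?A t)) \<le> exp (rho_I s t)"
    unfolding rho_I_eq[OF assms] by auto
  then show "((1 + t) * (1 - s)) / ((1 - t) * (1 + s)) \<le> exp (rho_I s t)"
    "((1 - t) * (1 + s)) / ((1 + t) * (1 - s)) \<le> exp (rho_I s t)"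
    using pos by (simp_all add: exp_diff mult.commute)
qed

text \<open>The coordinate \<open>A\<close> turns \<open>rho_I\<close> into the distance of the real
  line, where the point at distance \<open>r\<close> from \<open>A s\<close> towards
  \<open>A t\<close> is visible; \<open>(exp a - 1) / (exp a + 1)\<close> inverts \<open>A\<close>.
  This makes null paths divisible at every length.\<close>

lemma rho_I_split:
  assumes "s \<in> {-1<..<1}" "t \<in> {-1<..<1}" "0 \<le> r" "r \<le> rho_I s t"
  obtains u where "u \<in> {-1<..<1}" "rho_I s u = r" "rho_I u t = rho_I s t - r"
proof -
  define A where "A = (\<lambda>t::real. ln ((1 + t) / (1 - t)))"
  define a where "a = (if A s \<le> A t then A s + r else A s - r)"
  define u where "u = (exp a - 1) / (exp a + 1)"
  have e: "exp a + 1 > 0" by (simp add: add_pos_pos)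
  have u: "u \<in> {-1<..<1}"
    using e by (auto simp: u_def divide_simps)
  have "(1 + u) / (1 - u) = exp a"
    using e by (simp add: u_def field_simps)
  then have Au: "A u = a" by (simp add: A_def)
  have rho: "rho_I s t = \<bar>A t - A s\<bar>" "rho_I s u = \<bar>A u - A s\<bar>" "rho_I u t = \<bar>A t - A u\<bar>"
    using rho_I_eq assms(1,2) u by (auto simp: A_def)
  show ?thesis
    by (rule that[OF u]) (use assms(3,4) in \<open>auto simp: rho Au a_def\<close>)
qed

section \<open>Homographies and the logarithmic metric of the positive reals\<close>

lemma affine_nonvanishing_on_interval:
  fixes c d :: real
  assumes "\<forall>s\<in>{-1<..<1}. c * s + d \<noteq> 0"
  shows "d \<noteq> 0" "\<bar>c / d\<bar> \<le> 1"
proof -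
  show d: "d \<noteq> 0" using assms[rule_format, of 0] by auto
  have "\<bar>c\<bar> \<le> \<bar>d\<bar>"
  proof (rule ccontr)
    assume "\<not> \<bar>c\<bar> \<le> \<bar>d\<bar>"
    then have "\<bar>- d / c\<bar> < 1" "c \<noteq> 0" by (auto simp: divide_simps)
    then show False using assms[rule_format, of "- d / c"] by (auto simp: abs_if split: if_splits)
  qed
  then show "\<bar>c / d\<bar> \<le> 1" using d by (simp add: divide_simps)
qed

text \<open>The extreme slopes decide: \<open>a = 1\<close> gives equality in the first bound,
  \<open>a = -1\<close> in the second. The two right-hand sides are the factors of the cross ratio
  behind \<open>rho_I\<close>.\<close>

lemma affine_ratio_le:
  fixes a :: real
  assumes "\<bar>a\<bar> \<le> 1" "s \<in> {-1<..<1}" "t \<in> {-1<..<1}"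
  shows "0 < 1 + a * s"
    and "s \<le> t \<Longrightarrow> (1 + a * t) / (1 + a * s) \<le> (1 + t) / (1 + s)"
    and "s \<le> t \<Longrightarrow> (1 + a * s) / (1 + a * t) \<le> (1 - s) / (1 - t)"
proof -
  have pos: "0 < 1 + a * s" if "s \<in> {-1<..<1}" for s
  proof -
    have "\<bar>a * s\<bar> \<le> 1 * \<bar>s\<bar>"
      unfolding abs_mult using assms(1) by (intro mult_right_mono) auto
    moreover have "\<bar>s\<bar> < 1" using that by auto
    ultimately show ?thesis by linarith
  qed
  then show "0 < 1 + a * s" using assms by blast
  note p = pos[OF assms(2)] pos[OF assms(3)]
  show "(1 + a * t) / (1 + a * s) \<le> (1 + t) / (1 + s)" if "s \<le> t"
  proof -
    have "0 \<le> (t - s) * (1 - a)" using that assms(1) by auto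
    then show ?thesis using p assms by (simp add: divide_simps) (simp add: algebra_simps)
  qed
  show "(1 + a * s) / (1 + a * t) \<le> (1 - s) / (1 - t)" if "s \<le> t"
  proof -
    have "0 \<le> (t - s) * (1 + a)" using that assms(1) by auto
    then show ?thesis using p assms by (simp add: divide_simps) (simp add: algebra_simps)
  qed
qed

text \<open>A Schwarz lemma: a positive quotient of affine functions does not increase distances
  from \<open>rho_I\<close> to the metric \<open>\<bar>ln a - ln b\<bar>\<close>. Numerator and
  denominator have no zero in the interval, so each contributes at most one factor of the cross
  ratio.\<close>

lemma homography_ratio_le:
  assumes h: "homography_on {-1<..<1} h"
    and pos: "\<And>s. s \<in> {-1<..<1} \<Longrightarrow> 0 < \<alpha> + \<beta> * h s"
    and s: "s \<in> {-1<..<1}" and t: "t \<in> {-1<..<1}"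
  shows "\<alpha> + \<beta> * h t \<le> exp (rho_I s t) * (\<alpha> + \<beta> * h s)"
proof -
  obtain a b c d where hd: "\<And>s. s \<in> {-1<..<1} \<Longrightarrow> c * s + d \<noteq> 0 \<and> h s = (a * s + b) / (c * s + d)"
    using h unfolding homography_on_def by blast
  define A B where "A = \<alpha> * c + \<beta> * a" and "B = \<alpha> * d + \<beta> * b"
  have eq: "\<alpha> + \<beta> * h s = (A * s + B) / (c * s + d)" if "s \<in> {-1<..<1}" for s
    using hd[OF that] by (simp add: A_def B_def field_simps)
  have d: "d \<noteq> 0" "\<bar>c / d\<bar> \<le> 1"
    using affine_nonvanishing_on_interval[of c d] hd by blast+
  have "A * s + B \<noteq> 0" if "s \<in> {-1<..<1}" for s
    using eq[OF that] pos[OF that] by auto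
  then have B: "B \<noteq> 0" "\<bar>A / B\<bar> \<le> 1"
    using affine_nonvanishing_on_interval[of A B] by blast+
  define a' c' K where "a' = A / B" and "c' = c / d" and "K = B / d"
  have eq': "\<alpha> + \<beta> * h s = K * ((1 + a' * s) / (1 + c' * s))" if "s \<in> {-1<..<1}" for s
  proof -
    have "A * s + B = B * (1 + a' * s)" "c * s + d = d * (1 + c' * s)"
      using B(1) d(1) by (auto simp: a'_def c'_def field_simps)
    then show ?thesis using eq[OF that] by (simp add: K_def)
  qed
  have bd: "\<bar>a'\<bar> \<le> 1" "\<bar>c'\<bar> \<le> 1" using B d by (auto simp: a'_def c'_def)
  have K: "K > 0" using pos[of 0] eq'[of 0] by simp
  note pa = affine_ratio_le(1)[OF bd(1) s t] affine_ratio_le(1)[OF bd(1) t s]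
    and pc = affine_ratio_le(1)[OF bd(2) s t] affine_ratio_le(1)[OF bd(2) t s]
  have "((1 + a' * t) / (1 + a' * s)) * ((1 + c' * s) / (1 + c' * t)) \<le> exp (rho_I s t)"
  proof (cases "s \<le> t")
    case True
    have "((1 + a' * t) / (1 + a' * s)) * ((1 + c' * s) / (1 + c' * t))
      \<le> ((1 + t) / (1 + s)) * ((1 - s) / (1 - t))"
      using affine_ratio_le(2)[OF bd(1) s t True] affine_ratio_le(3)[OF bd(2) s t True] pa pc s t
      by (intro mult_mono) auto
    then show ?thesis using exp_rho_I_ge(1)[OF s t] by (simp add: mult.commute)
  next
    case False
    then have "t \<le> s" by simp
    have "((1 + a' * t) / (1 + a' * s)) * ((1 + c' * s) / (1 + c' * t))
      \<le> ((1 - t) / (1 - s)) * ((1 + s) / (1 + t))"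
      using affine_ratio_le(3)[OF bd(1) t s \<open>t \<le> s\<close>] affine_ratio_le(2)[OF bd(2) t s \<open>t \<le> s\<close>] pa pc s t
      by (intro mult_mono) auto
    then show ?thesis using exp_rho_I_ge(2)[OF s t] by (simp add: mult.commute)
  qed
  then have "(1 + a' * t) / (1 + c' * t) \<le> exp (rho_I s t) * ((1 + a' * s) / (1 + c' * s))"
    using pa pc by (simp add: divide_simps mult.commute mult.left_commute)
  then show ?thesis
    using K unfolding eq'[OF s] eq'[OF t] by (simp only: mult.left_commute[of _ K] mult_le_cancel_left_pos)
qed

text \<open>Chains as a relation that carries the length: the indices disappear, and statements
  about chains become rule inductions.\<close>

inductive null_path :: "'n::finite minkowski set \<Rightarrow> 'n minkowski \<Rightarrow> 'n minkowski \<Rightarrow> real \<Rightarrow> bool"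
  for \<Omega> where
  step: "proj_lightlike_geodesic \<Omega> \<gamma> \<Longrightarrow> s \<in> {-1<..<1} \<Longrightarrow> t \<in> {-1<..<1} \<Longrightarrow>
    null_path \<Omega> (\<gamma> s) (\<gamma> t) (rho_I s t)"
| cons: "proj_lightlike_geodesic \<Omega> \<gamma> \<Longrightarrow> s \<in> {-1<..<1} \<Longrightarrow> t \<in> {-1<..<1} \<Longrightarrow>
    null_path \<Omega> (\<gamma> t) y T \<Longrightarrow> null_path \<Omega> (\<gamma> s) y (rho_I s t + T)"

lemma null_path_of_chain:
  "lightlike_chain \<Omega> x y m \<gamma> s t \<Longrightarrow> null_path \<Omega> x y (\<Sum>k=1..m. rho_I (s k) (t k))"
proof (induction m arbitrary: x \<gamma> s t)
  case 0
  then show ?case by (simp add: lightlike_chain_def)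
next
  case (Suc m)
  note c = Suc.prems[unfolded lightlike_chain_def]
  have first: "proj_lightlike_geodesic \<Omega> (\<gamma> 1)" "s 1 \<in> {-1<..<1}" "t 1 \<in> {-1<..<1}" "\<gamma> 1 (s 1) = x"
    using c by auto
  show ?case
  proof (cases "m = 0")
    case True
    then have "\<gamma> 1 (t 1) = y" using c by auto
    then show ?thesis using null_path.step[OF first(1-3)] first(4) True by simp
  next
    case False
    have "lightlike_chain \<Omega> (\<gamma> 1 (t 1)) y m (\<lambda>k. \<gamma> (Suc k)) (\<lambda>k. s (Suc k)) (\<lambda>k. t (Suc k))"
      unfolding lightlike_chain_def using c False by auto
    from Suc.IH[OF this]
    have "null_path \<Omega> (\<gamma> 1 (t 1)) y (\<Sum>k=1..m. rho_I (s (Suc k)) (t (Suc k)))" .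
    from null_path.cons[OF first(1-3) this]
    have "null_path \<Omega> x y (rho_I (s 1) (t 1) + (\<Sum>k=1..m. rho_I (s (Suc k)) (t (Suc k))))"
      using first(4) by simp
    also have "(\<Sum>k=1..m. rho_I (s (Suc k)) (t (Suc k))) = (\<Sum>k=Suc 1..Suc m. rho_I (s k) (t k))"
      by (subst sum.shift_bounds_cl_Suc_ivl) simp
    also have "rho_I (s 1) (t 1) + \<dots> = (\<Sum>k=1..Suc m. rho_I (s k) (t k))"
      by (subst (2) sum.atLeast_Suc_atMost) auto
    finally show ?thesis .
  qed
qed

lemma chain_of_null_path:
  "null_path \<Omega> x y T \<Longrightarrow> \<exists>m \<gamma> s t. lightlike_chain \<Omega> x y m \<gamma> s t \<and> T = (\<Sum>k=1..m. rho_I (s k) (t k))"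
proof (induction rule: null_path.induct)
  case (step \<gamma> s t)
  show ?case
    by (rule exI[of _ 1], rule exI[of _ "\<lambda>_. \<gamma>"], rule exI[of _ "\<lambda>_. s"], rule exI[of _ "\<lambda>_. t"])
      (use step in \<open>auto simp: lightlike_chain_def\<close>)
next
  case (cons \<gamma> s t y T)
  then obtain m \<gamma>' s' t' where c: "lightlike_chain \<Omega> (\<gamma> t) y m \<gamma>' s' t'"
    and T: "T = (\<Sum>k=1..m. rho_I (s' k) (t' k))" by auto
  note c = c[unfolded lightlike_chain_def]
  let ?g = "\<lambda>k. if k = 1 then \<gamma> else \<gamma>' (k - 1)"
  let ?s = "\<lambda>k. if k = 1 then s else s' (k - 1)"
  let ?t = "\<lambda>k. if k = 1 then t else t' (k - 1)"
  have "lightlike_chain \<Omega> (\<gamma> s) y (Suc m) ?g ?s ?t"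
    unfolding lightlike_chain_def
  proof (intro conjI ballI)
    fix k assume k: "k \<in> {1..Suc m}"
    show "proj_lightlike_geodesic \<Omega> (?g k)" "?s k \<in> {-1<..<1}" "?t k \<in> {-1<..<1}"
      using c k cons.hyps by (cases "k = 1"; force)+
  next
    fix k assume k: "k \<in> {1..<Suc m}"
    show "?g k (?t k) = ?g (Suc k) (?s (Suc k))"
    proof (cases "k = 1")
      case True
      then show ?thesis using c by auto
    next
      case False
      then obtain j where j: "k = Suc j" "1 \<le> j" using k by (cases k) auto
      then show ?thesis using c k by auto
    qed
  qed (use c in auto)
  moreover have "(\<Sum>k=1..Suc m. rho_I (?s k) (?t k)) = rho_I s t + T"
  proof -
    have "(\<Sum>k=1..Suc m. rho_I (?s k) (?t k)) = rho_I s t + (\<Sum>k=Suc 1..Suc m. rho_I (?s k) (?t k))"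
      by (subst sum.atLeast_Suc_atMost) auto
    also have "(\<Sum>k=Suc 1..Suc m. rho_I (?s k) (?t k)) = (\<Sum>k=1..m. rho_I (s' k) (t' k))"
      by (subst sum.shift_bounds_cl_Suc_ivl) (rule sum.cong, auto)
    finally show ?thesis by (simp add: T)
  qed
  ultimately show ?case by (intro exI conjI) (assumption, simp only:)
qed

lemma markowitz_dist_eq:
  "markowitz_dist \<Omega> x y = (if x \<in> \<Omega> \<and> y \<in> \<Omega> then Inf {T. null_path \<Omega> x y T} else 0)"
proof -
  have "{(\<Sum>k=1..m. rho_I (s k) (t k)) | m \<gamma> s t. lightlike_chain \<Omega> x y m \<gamma> s t} = {T. null_path \<Omega> x y T}"
    using null_path_of_chain chain_of_null_path by blast
  then show ?thesis by (simp add: markowitz_dist_def)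
qed

lemma null_path_nonneg: "null_path \<Omega> x y T \<Longrightarrow> 0 \<le> T"
  by (induction rule: null_path.induct) (auto simp: rho_I_nonneg add_nonneg_nonneg)

lemma null_path_in:
  assumes "null_path \<Omega> x y T"
  shows "x \<in> \<Omega>" "y \<in> \<Omega>"
proof -
  have "x \<in> \<Omega> \<and> y \<in> \<Omega>"
    using assms
    by (induction rule: null_path.induct) (simp_all add: proj_lightlike_geodesic_def image_subset_iff)
  then show "x \<in> \<Omega>" "y \<in> \<Omega>" by auto
qed

lemma null_path_trans:
  "null_path \<Omega> x y T \<Longrightarrow> null_path \<Omega> y z T' \<Longrightarrow> null_path \<Omega> x z (T + T')"
proof (induction rule: null_path.induct)
  case (step \<gamma> s t)
  then show ?case by (simp add: null_path.cons)
next
  case (cons \<gamma> s t y T)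
  then show ?case by (simp add: null_path.cons add.assoc)
qed

lemma null_path_sym: "null_path \<Omega> x y T \<Longrightarrow> null_path \<Omega> y x T"
proof (induction rule: null_path.induct)
  case (step \<gamma> s t)
  then show ?case by (metis null_path.step rho_I_commute)
next
  case (cons \<gamma> s t y T)
  then have "null_path \<Omega> (\<gamma> t) (\<gamma> s) (rho_I s t)" by (metis null_path.step rho_I_commute)
  then show ?case using cons null_path_trans by (metis add.commute)
qed

text \<open>The cut falls inside one of the geodesics, and \<open>rho_I_split\<close> cuts that one.
  For nearly shortest paths this gives approximate intermediate points, the source of
  geodesics.\<close>

lemma null_path_split:
  "null_path \<Omega> x y T \<Longrightarrow> 0 \<le> r \<Longrightarrow> r \<le> T \<Longrightarrow>
    \<exists>z. null_path \<Omega> x z r \<and> null_path \<Omega> z y (T - r)"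
proof (induction arbitrary: r rule: null_path.induct)
  case (step \<gamma> s t)
  then obtain u where u: "u \<in> {-1<..<1}" "rho_I s u = r" "rho_I u t = rho_I s t - r"
    using rho_I_split by metis
  then show ?case using step null_path.step by metis
next
  case (cons \<gamma> s t y T)
  show ?case
  proof (cases "r \<le> rho_I s t")
    case True
    then obtain u where u: "u \<in> {-1<..<1}" "rho_I s u = r" "rho_I u t = rho_I s t - r"
      using rho_I_split cons by metis
    have "null_path \<Omega> (\<gamma> s) (\<gamma> u) r" using u cons null_path.step by metis
    moreover have "null_path \<Omega> (\<gamma> u) y (rho_I u t + T)"
      using u cons null_path.cons by metis
    ultimately show ?thesis using u(3) by (metis add_diff_eq diff_add_eq)
  next
    case False
    then obtain z where z: "null_path \<Omega> (\<gamma> t) z (r - rho_I s t)"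
      "null_path \<Omega> z y (T - (r - rho_I s t))"
      using cons.IH[of "r - rho_I s t"] cons.prems by auto
    have "null_path \<Omega> (\<gamma> s) z (rho_I s t + (r - rho_I s t))"
      by (rule null_path.cons) (use cons z in auto)
    moreover have "T - (r - rho_I s t) = rho_I s t + T - r" "rho_I s t + (r - rho_I s t) = r" by simp_all
    ultimately show ?thesis using z(2) by metis
  qed
qed

section \<open>Bounds for the distance from above and from below\<close>

lemma markowitz_dist_le:
  assumes "null_path \<Omega> x y T"
  shows "markowitz_dist \<Omega> x y \<le> T"
proof -
  have "bdd_below {T. null_path \<Omega> x y T}" by (rule bdd_belowI[of _ 0]) (auto intro: null_path_nonneg)
  then show ?thesis
    using assms null_path_in[OF assms] by (auto simp: markowitz_dist_eq intro: cInf_lower)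
qed

lemma markowitz_dist_ge:
  assumes "null_path \<Omega> x y T0" "\<And>T. null_path \<Omega> x y T \<Longrightarrow> c \<le> T"
  shows "c \<le> markowitz_dist \<Omega> x y"
  using assms null_path_in[OF assms(1)] by (auto simp: markowitz_dist_eq intro!: cInf_greatest)

lemma markowitz_dist_approx:
  assumes "null_path \<Omega> x y T0" "0 < e"
  obtains T where "null_path \<Omega> x y T" "T < markowitz_dist \<Omega> x y + e"
proof -
  have "\<exists>T. null_path \<Omega> x y T \<and> T < markowitz_dist \<Omega> x y + e"
  proof (rule ccontr)
    assume "\<not> ?thesis"
    then have "markowitz_dist \<Omega> x y + e \<le> markowitz_dist \<Omega> x y"
      by (intro markowitz_dist_ge[OF assms(1)]) auto
    then show False using assms(2) by simp
  qed
  then show ?thesis using that by blast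
qed

text \<open>The increments telescope along a path, so a test function has to be controlled on single
  geodesics only.\<close>

lemma null_path_lower_bound:
  fixes F :: "'n::finite minkowski \<Rightarrow> real"
  assumes "\<And>\<gamma> s t. proj_lightlike_geodesic \<Omega> \<gamma> \<Longrightarrow> s \<in> {-1<..<1} \<Longrightarrow> t \<in> {-1<..<1} \<Longrightarrow>
      F (\<gamma> t) - F (\<gamma> s) \<le> rho_I s t"
  shows "null_path \<Omega> x y T \<Longrightarrow> F y - F x \<le> T"
proof (induction rule: null_path.induct)
  case (step \<gamma> s t)
  then show ?case using assms by auto
next
  case (cons \<gamma> s t y T)
  then show ?case using assms[OF cons.hyps(1-3)] by auto
qed

text \<open>A function that is affine along lightlike lines becomes a ratio of affine functions of the
  projective parameter.\<close>

lemma lightlike_affine_ratio: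
  fixes F :: "'n::finite minkowski \<Rightarrow> real"
  assumes pos: "\<And>x. x \<in> \<Omega> \<Longrightarrow> 0 < F x"
    and aff: "\<And>x v. lightlike v \<Longrightarrow> \<exists>\<beta>. \<forall>r. F (x + r *\<^sub>R v) = F x + \<beta> * r"
    and \<gamma>: "proj_lightlike_geodesic \<Omega> \<gamma>" "s \<in> {-1<..<1}" "t \<in> {-1<..<1}"
  shows "F (\<gamma> t) \<le> exp (rho_I s t) * F (\<gamma> s)"
proof -
  obtain x v h where g: "lightlike v" "homography_on {-1<..<1} h"
      "\<And>s. s \<in> {-1<..<1} \<Longrightarrow> \<gamma> s = x + h s *\<^sub>R v"
    and in_dom: "\<And>s. s \<in> {-1<..<1} \<Longrightarrow> \<gamma> s \<in> \<Omega>"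
    using \<gamma>(1) unfolding proj_lightlike_geodesic_def by (auto simp: image_subset_iff)
  obtain \<beta> where \<beta>: "\<And>r. F (x + r *\<^sub>R v) = F x + \<beta> * r" using aff[OF g(1)] by blast
  have "F (\<gamma> s) = F x + \<beta> * h s" if "s \<in> {-1<..<1}" for s using \<beta> g(3)[OF that] by simp
  then show ?thesis
    using homography_ratio_le[OF g(2), of "F x" \<beta> s t] pos in_dom \<gamma>(2,3) by metis
qed

lemma markowitz_dist_ge_ln_ratio:
  fixes F :: "'n::finite minkowski \<Rightarrow> real"
  assumes pos: "\<And>x. x \<in> \<Omega> \<Longrightarrow> 0 < F x"
    and aff: "\<And>x v. lightlike v \<Longrightarrow> \<exists>\<beta>. \<forall>r. F (x + r *\<^sub>R v) = F x + \<beta> * r"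
    and path: "null_path \<Omega> x y T0"
  shows "ln (F y / F x) \<le> markowitz_dist \<Omega> x y"
proof (rule markowitz_dist_ge[OF path])
  fix T assume T: "null_path \<Omega> x y T"
  have "ln (F y) - ln (F x) \<le> T"
  proof (rule null_path_lower_bound[OF _ T])
    fix \<gamma> and s t :: real
    assume \<gamma>: "proj_lightlike_geodesic \<Omega> \<gamma>" "s \<in> {-1<..<1}" "t \<in> {-1<..<1}"
    have p: "0 < F (\<gamma> s)" "0 < F (\<gamma> t)"
      using \<gamma> pos by (auto simp: proj_lightlike_geodesic_def image_subset_iff)
    have "ln (F (\<gamma> t)) \<le> ln (exp (rho_I s t) * F (\<gamma> s))"
      using lightlike_affine_ratio[OF pos aff \<gamma>] p by (subst ln_le_cancel_iff) auto
    also have "\<dots> = rho_I s t + ln (F (\<gamma> s))" using p by (simp add: ln_mult)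
    finally show "ln (F (\<gamma> t)) - ln (F (\<gamma> s)) \<le> rho_I s t" by simp
  qed
  moreover have "0 < F x" "0 < F y" using null_path_in[OF T] pos by auto
  ultimately show "ln (F y / F x) \<le> T" by (simp add: ln_div)
qed

text \<open>An affine parametrization maps the interval onto the chord, and \<open>rho_I\<close>
  becomes the Hilbert distance of the chord. The chord may be any part of the line inside
  \<open>\<Omega>\<close>; a shorter one only gives a longer path.\<close>

lemma null_path_chord:
  fixes v :: "'n::finite minkowski"
  assumes v: "lightlike v" and dom: "\<And>r. \<alpha> < r \<Longrightarrow> r < \<beta> \<Longrightarrow> x + r *\<^sub>R v \<in> \<Omega>"
    and a: "\<alpha> < a" "a < \<beta>" and b: "\<alpha> < b" "b < \<beta>"
  shows "null_path \<Omega> (x + a *\<^sub>R v) (x + b *\<^sub>R v)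
    \<bar>ln (((b - \<alpha>) / (\<beta> - b)) / ((a - \<alpha>) / (\<beta> - a)))\<bar>"
proof -
  define h where "h = (\<lambda>s::real. (\<alpha> + \<beta>) / 2 + s * ((\<beta> - \<alpha>) / 2))"
  define k where "k = (\<lambda>r. (2 * r - \<alpha> - \<beta>) / (\<beta> - \<alpha>))"
  have ab: "\<alpha> < \<beta>" using a by simp
  have hk: "h (k r) = r" for r
  proof -
    have "k r * ((\<beta> - \<alpha>) / 2) = (2 * r - \<alpha> - \<beta>) / 2" using ab by (simp add: k_def)
    then show ?thesis by (simp add: h_def field_simps)
  qed
  have k: "k r \<in> {-1<..<1}" if "\<alpha> < r" "r < \<beta>" for r
    using that by (simp add: k_def field_simps)
  have h_in: "\<alpha> < h s" "h s < \<beta>" if "s \<in> {-1<..<1}" for s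
  proof -
    have "0 < (1 + s) * (\<beta> - \<alpha>)" "0 < (1 - s) * (\<beta> - \<alpha>)" using that ab by auto
    then show "\<alpha> < h s" "h s < \<beta>" by (simp_all add: h_def field_simps)
  qed
  have hom: "homography_on {-1<..<1} h"
    unfolding homography_on_def
    by (rule exI[of _ "(\<beta> - \<alpha>) / 2"], rule exI[of _ "(\<alpha> + \<beta>) / 2"], rule exI[of _ 0], rule exI[of _ 1])
      (use ab in \<open>auto simp: h_def\<close>)
  have g: "proj_lightlike_geodesic \<Omega> (\<lambda>s. x + h s *\<^sub>R v)"
    unfolding proj_lightlike_geodesic_def
  proof (intro conjI exI)
    show "(\<lambda>s. x + h s *\<^sub>R v) ` {-1<..<1} \<subseteq> \<Omega>"
      using dom h_in by blast
  qed (use v hom in auto)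
  have r: "(1 + k r) / (1 - k r) = (r - \<alpha>) / (\<beta> - r)" if "\<alpha> < r" "r < \<beta>" for r
  proof -
    have "1 + k r = (r - \<alpha>) * (2 / (\<beta> - \<alpha>))" "1 - k r = (\<beta> - r) * (2 / (\<beta> - \<alpha>))"
      using ab by (simp_all add: k_def field_simps)
    then have "(1 + k r) / (1 - k r) = ((r - \<alpha>) * (2 / (\<beta> - \<alpha>))) / ((\<beta> - r) * (2 / (\<beta> - \<alpha>)))" by (simp only:)
    then show ?thesis using ab by (subst (asm) mult_divide_mult_cancel_right) auto
  qed
  have "rho_I (k a) (k b) = \<bar>ln (((b - \<alpha>) / (\<beta> - b)) / ((a - \<alpha>) / (\<beta> - a)))\<bar>"
    unfolding rho_I_eq[OF k[OF a] k[OF b]] r[OF a] r[OF b]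
    using a b by (subst (3) ln_div) auto
  with null_path.step[OF g k[OF a] k[OF b]] show ?thesis by (simp add: hk)
qed

subsection \<open>Causally convex bodies\<close>

definition trev :: "'n::finite minkowski \<Rightarrow> 'n minkowski" where
  "trev x = (- fst x, snd x)"

lemma fst_trev [simp]: "fst (trev x) = - fst x" and snd_trev [simp]: "snd (trev x) = snd x"
  and trev_trev [simp]: "trev (trev x) = x"
  by (simp_all add: trev_def)

lemma mem_trev_image: "x \<in> trev ` A \<longleftrightarrow> trev x \<in> A"
  by (metis imageE imageI trev_trev)

lemma trev_image_trev_image [simp]: "trev ` trev ` A = A"
  by (auto simp: mem_trev_image)

lemma linear_trev: "linear trev"
  by (rule linearI) (auto simp: trev_def)

text \<open>The least 1-Lipschitz function whose hypograph contains \<open>\<Omega>\<close>, and the greatest one whose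
  epigraph contains \<open>\<Omega>\<close>. They are defined on the whole of space, and in the convex case they are
  concave and convex there.\<close>

definition upper :: "'n::finite minkowski set \<Rightarrow> real ^ 'n \<Rightarrow> real" where
  "upper \<Omega> p = (SUP x\<in>\<Omega>. fst x - dist p (snd x))"

definition lower :: "'n::finite minkowski set \<Rightarrow> real ^ 'n \<Rightarrow> real" where
  "lower \<Omega> p = - upper (trev ` \<Omega>) p"

text \<open>The vertical distance to the boundary, in place of the Euclidean one. It is concave,
  2-Lipschitz and positive exactly on a causally convex body, and both terms are values of
  supporting affine functions.\<close>

definition depth :: "'n::finite minkowski set \<Rightarrow> 'n minkowski \<Rightarrow> real" where
  "depth \<Omega> x = min (upper \<Omega> (snd x) - fst x) (fst x - lower \<Omega> (snd x))"

lemma lower_trev: "lower (trev ` \<Omega>) p = - upper \<Omega> p"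
  and upper_trev: "upper (trev ` \<Omega>) p = - lower \<Omega> p"
  by (simp_all add: lower_def)

text \<open>Causal convexity is used through chronological diamonds: an inequality between norms,
  free of curves and symmetric under time reversal.\<close>

locale causal_body =
  fixes \<Omega> :: "'n::finite minkowski set"
  assumes open_body: "open \<Omega>" and nonempty_body: "\<Omega> \<noteq> {}"
    and bounded_body: "bounded \<Omega>" and convex_body: "convex \<Omega>"
    and diamond: "\<And>x y z. x \<in> \<Omega> \<Longrightarrow> y \<in> \<Omega> \<Longrightarrow> dist (snd z) (snd x) < fst z - fst x \<Longrightarrow>
      dist (snd z) (snd y) < fst y - fst z \<Longrightarrow> z \<in> \<Omega>"

lemma causal_body_trev:
  assumes "causal_body \<Omega>"
  shows "causal_body (trev ` \<Omega>)"
proof -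
  interpret causal_body \<Omega> by fact
  show ?thesis
  proof
    show "open (trev ` \<Omega>)"
      using open_body linear_trev
      by (rule open_surjective_linear_image) (metis surj_def trev_trev)
    show "bounded (trev ` \<Omega>)" "convex (trev ` \<Omega>)"
      using bounded_body convex_body linear_trev
      by (auto intro: bounded_linear_image convex_linear_image simp: linear_conv_bounded_linear)
    show "z \<in> trev ` \<Omega>"
      if "x \<in> trev ` \<Omega>" "y \<in> trev ` \<Omega>" "dist (snd z) (snd x) < fst z - fst x"
        "dist (snd z) (snd y) < fst y - fst z" for x y z
      using diamond[of "trev y" "trev x" "trev z"] that by (simp add: mem_trev_image)
  qed (use nonempty_body in auto)
qed

context causal_body
begin

lemma body_bound:
  obtains B where "0 < B" "\<And>x. x \<in> \<Omega> \<Longrightarrow> norm x \<le> B"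
  using bounded_body bounded_pos by metis

lemma upper_bdd: "bdd_above ((\<lambda>x. fst x - dist p (snd x)) ` \<Omega>)"
proof -
  obtain B where B: "\<And>x. x \<in> \<Omega> \<Longrightarrow> norm x \<le> B" using body_bound by metis
  have "fst x - dist p (snd x) \<le> B" if "x \<in> \<Omega>" for x
    using B[OF that] norm_fst_le[of "fst x" "snd x"] zero_le_dist[of p "snd x"]
    by (simp del: zero_le_dist)
  then show ?thesis by (intro bdd_aboveI2)
qed

lemma upper_ge: "x \<in> \<Omega> \<Longrightarrow> fst x - dist p (snd x) \<le> upper \<Omega> p"
  unfolding upper_def by (rule cSUP_upper[OF _ upper_bdd])

lemma upper_le: "(\<And>x. x \<in> \<Omega> \<Longrightarrow> fst x - dist p (snd x) \<le> c) \<Longrightarrow> upper \<Omega> p \<le> c"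
  unfolding upper_def by (rule cSUP_least[OF nonempty_body])

lemma less_upper:
  assumes "c < upper \<Omega> p"
  obtains x where "x \<in> \<Omega>" "c < fst x - dist p (snd x)"
  using assms unfolding upper_def by (subst (asm) less_cSUP_iff[OF nonempty_body upper_bdd]) auto

lemma upper_lipschitz: "upper \<Omega> p \<le> upper \<Omega> q + dist p q"
proof (rule upper_le)
  fix x assume "x \<in> \<Omega>"
  then show "fst x - dist p (snd x) \<le> upper \<Omega> q + dist p q"
    using upper_ge[of x q] dist_triangle[of q "snd x" p] by (simp add: dist_commute)
qed

text \<open>\<open>upper\<close> is the sup-convolution of the body with the cone
  \<open>- norm\<close>, and both are convex sets of points below a graph in effect: near-maximizers
  for \<open>p\<close> and \<open>q\<close> combine to a point of \<open>\<Omega>\<close> by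
  convexity.\<close>

lemma upper_concave:
  assumes "0 \<le> u" "u \<le> 1"
  shows "(1 - u) * upper \<Omega> p + u * upper \<Omega> q \<le> upper \<Omega> ((1 - u) *\<^sub>R p + u *\<^sub>R q)"
proof (rule field_le_epsilon)
  fix e :: real assume e: "0 < e"
  obtain x where x: "x \<in> \<Omega>" "upper \<Omega> p - e < fst x - dist p (snd x)"
    using less_upper[of "upper \<Omega> p - e" p] e by auto
  obtain y where y: "y \<in> \<Omega>" "upper \<Omega> q - e < fst y - dist q (snd y)"
    using less_upper[of "upper \<Omega> q - e" q] e by auto
  let ?z = "(1 - u) *\<^sub>R x + u *\<^sub>R y"
  have z: "?z \<in> \<Omega>" using convex_body x y assms by (simp add: convex_alt)
  have "dist ((1 - u) *\<^sub>R p + u *\<^sub>R q) (snd ?z) \<le> (1 - u) * dist p (snd x) + u * dist q (snd y)"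
  proof -
    have "(1 - u) *\<^sub>R p + u *\<^sub>R q - snd ?z = (1 - u) *\<^sub>R (p - snd x) + u *\<^sub>R (q - snd y)"
      by (simp add: algebra_simps)
    then show ?thesis
      using norm_triangle_ineq[of "(1 - u) *\<^sub>R (p - snd x)" "u *\<^sub>R (q - snd y)"] assms
      by (simp add: dist_norm)
  qed
  then have "(1 - u) * (fst x - dist p (snd x)) + u * (fst y - dist q (snd y))
      \<le> fst ?z - dist ((1 - u) *\<^sub>R p + u *\<^sub>R q) (snd ?z)"
    by (simp add: algebra_simps)
  also have "\<dots> \<le> upper \<Omega> ((1 - u) *\<^sub>R p + u *\<^sub>R q)" by (rule upper_ge[OF z])
  moreover have "(1 - u) * (upper \<Omega> p - e) \<le> (1 - u) * (fst x - dist p (snd x))"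
    "u * (upper \<Omega> q - e) \<le> u * (fst y - dist q (snd y))"
    using x y assms by (auto intro!: mult_left_mono)
  ultimately show "(1 - u) * upper \<Omega> p + u * upper \<Omega> q \<le> upper \<Omega> ((1 - u) *\<^sub>R p + u *\<^sub>R q) + e"
    by (simp add: algebra_simps)
qed

lemma fst_less_upper:
  assumes "x \<in> \<Omega>"
  shows "fst x < upper \<Omega> (snd x)"
proof -
  obtain e where e: "e > 0" "ball x e \<subseteq> \<Omega>" using open_body assms open_contains_ball by blast
  have "(fst x + e / 2, snd x) \<in> ball x e"
    using e by (auto simp: dist_prod_def dist_real_def)
  then show ?thesis using upper_ge[of "(fst x + e / 2, snd x)" "snd x"] e by auto
qed

lemma continuous_upper: "continuous_on S (upper \<Omega>)"
proof (rule continuous_onI)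
  fix p and e :: real assume "0 < e"
  moreover have "dist (upper \<Omega> q) (upper \<Omega> p) \<le> e" if "dist q p < e" for q
    using upper_lipschitz[of p q] upper_lipschitz[of q p] that
    by (auto simp: dist_real_def dist_commute)
  ultimately show "\<exists>d>0. \<forall>q\<in>S. dist q p < d \<longrightarrow> dist (upper \<Omega> q) (upper \<Omega> p) \<le> e" by blast
qed

text \<open>A hyperplane separates the convex strict hypograph from
  \<open>(upper \<Omega> p, p)\<close>. It is not vertical because \<open>upper\<close> is finite
  everywhere, so that the hypograph contains points over \<open>p + \<zeta>\<close> for the spatial
  part \<open>\<zeta>\<close> of the normal.\<close>

lemma supergradient:
  obtains \<xi> where "\<And>q. upper \<Omega> q \<le> upper \<Omega> p + \<xi> \<bullet> (q - p)"
proof -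
  let ?H = "{x. fst x < upper \<Omega> (snd x)}"
  have "convex ?H"
  proof (rule convexI)
    fix x y :: "'n minkowski" and u v :: real
    assume h: "x \<in> ?H" "y \<in> ?H" "0 \<le> u" "0 \<le> v" "u + v = 1"
    have u: "u = 1 - v" using h by simp
    have "fst (u *\<^sub>R x + v *\<^sub>R y) < (1 - v) * upper \<Omega> (snd x) + v * upper \<Omega> (snd y)"
    proof (cases "v = 0")
      case True then show ?thesis using h u by simp
    next
      case False
      then have "v * fst y < v * upper \<Omega> (snd y)" "u * fst x \<le> u * upper \<Omega> (snd x)"
        using h by (auto intro: mult_left_mono)
      then show ?thesis using u by simp
    qed
    also have "\<dots> \<le> upper \<Omega> (snd (u *\<^sub>R x + v *\<^sub>R y))"
      using upper_concave[of v "snd x" "snd y"] h u by simp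
    finally show "u *\<^sub>R x + v *\<^sub>R y \<in> ?H" by simp
  qed
  moreover have "?H \<noteq> {}" using fst_less_upper nonempty_body by auto
  moreover have "?H \<inter> {(upper \<Omega> p, p)} = {}" by auto
  ultimately have "\<exists>a b. a \<noteq> 0 \<and> (\<forall>x\<in>?H. a \<bullet> x \<le> b) \<and> (\<forall>x\<in>{(upper \<Omega> p, p)}. b \<le> a \<bullet> x)"
    by (intro separating_hyperplane_sets) simp_all
  then obtain a b where a: "a \<noteq> 0" "\<And>x. x \<in> ?H \<Longrightarrow> a \<bullet> x \<le> b" "b \<le> a \<bullet> (upper \<Omega> p, p)"
    by blast
  obtain \<alpha> \<zeta> where a': "a = (\<alpha>, \<zeta>)" by (cases a)
  have sep: "\<alpha> * t + \<zeta> \<bullet> q \<le> \<alpha> * upper \<Omega> p + \<zeta> \<bullet> p" if "t < upper \<Omega> q" for t q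
    using a(2)[of "(t, q)"] a(3) that by (simp add: a' inner_prod_def)
  have "\<alpha> \<ge> 0" using sep[of "upper \<Omega> p - 1" p] by (simp add: algebra_simps)
  moreover have "\<alpha> \<noteq> 0"
  proof
    assume "\<alpha> = 0"
    then have "\<zeta> \<bullet> \<zeta> \<le> 0"
      using sep[of "upper \<Omega> (p + \<zeta>) - 1" "p + \<zeta>"] by (simp add: inner_right_distrib)
    then have "\<zeta> = 0" by (metis inner_eq_zero_iff inner_ge_zero order_antisym)
    with \<open>\<alpha> = 0\<close> a a' show False by (simp add: zero_prod_def)
  qed
  ultimately have \<alpha>: "\<alpha> > 0" by simp
  show ?thesis
  proof (rule that[of "- (1 / \<alpha>) *\<^sub>R \<zeta>"])
    fix q
    show "upper \<Omega> q \<le> upper \<Omega> p + (- (1 / \<alpha>) *\<^sub>R \<zeta>) \<bullet> (q - p)"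
    proof (rule dense_le)
      fix t assume "t < upper \<Omega> q"
      from sep[OF this] have "\<alpha> * t \<le> \<alpha> * (upper \<Omega> p + (- (1 / \<alpha>) *\<^sub>R \<zeta>) \<bullet> (q - p))"
        using \<alpha> by (simp add: inner_diff_right algebra_simps)
      then show "t \<le> upper \<Omega> p + (- (1 / \<alpha>) *\<^sub>R \<zeta>) \<bullet> (q - p)" using \<alpha> by simp
    qed
  qed
qed

text \<open>Stepping from \<open>p\<close> by \<open>- s *\<^sub>R \<xi>\<close> lowers
  \<open>upper\<close> by at least \<open>s\<close> times the square of \<open>norm \<xi>\<close>,
  while the Lipschitz bound allows \<open>k * s * norm \<xi>\<close>. A single pair of points is
  involved, so \<open>s\<close> can be as small as the domain of the Lipschitz bound
  requires.\<close>

lemma supergradient_norm_le: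
  assumes "\<And>q. upper \<Omega> q \<le> upper \<Omega> p + \<xi> \<bullet> (q - p)" and "0 < s" "0 \<le> k"
    and lip: "upper \<Omega> p \<le> upper \<Omega> (p - s *\<^sub>R \<xi>) + k * dist p (p - s *\<^sub>R \<xi>)"
  shows "norm \<xi> \<le> k"
proof (cases "\<xi> = 0")
  case False
  have e: "\<xi> \<bullet> (p - s *\<^sub>R \<xi> - p) = - (s * (norm \<xi>)\<^sup>2)" "dist p (p - s *\<^sub>R \<xi>) = s * norm \<xi>"
    using \<open>0 < s\<close> by (simp_all add: dist_norm dot_square_norm)
  have "upper \<Omega> p \<le> upper \<Omega> p - s * (norm \<xi>)\<^sup>2 + k * (s * norm \<xi>)"
    using assms(1)[of "p - s *\<^sub>R \<xi>"] lip unfolding e by linarith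
  then have "(s * norm \<xi>) * norm \<xi> \<le> (s * norm \<xi>) * k"
    by (simp add: power2_eq_square algebra_simps)
  moreover have "0 < s * norm \<xi>" using False \<open>0 < s\<close> by simp
  ultimately show ?thesis by (simp only: mult_le_cancel_left_pos)
qed (use assms in simp)

lemma supergradient_norm_le_1:
  assumes "\<And>q. upper \<Omega> q \<le> upper \<Omega> p + \<xi> \<bullet> (q - p)"
  shows "norm \<xi> \<le> 1"
  by (rule supergradient_norm_le[OF assms, of 1]) (use upper_lipschitz[of p "p - 1 *\<^sub>R \<xi>"] in auto)

interpretation rev: causal_body "trev ` \<Omega>"
  by (rule causal_body_trev) (rule causal_body_axioms)

lemma lower_less:
  assumes "lower \<Omega> p < c"
  obtains x where "x \<in> \<Omega>" "fst x + dist p (snd x) < c"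
proof -
  obtain x where "x \<in> trev ` \<Omega>" "- c < fst x - dist p (snd x)"
    using rev.less_upper[of "- c" p] assms unfolding lower_def by auto
  then show ?thesis using that[of "trev x"] by (simp add: mem_trev_image)
qed

lemma lower_lipschitz: "lower \<Omega> p \<le> lower \<Omega> q + dist p q"
  using rev.upper_lipschitz[of q p] by (simp add: lower_def dist_commute)

lemma lower_convex:
  assumes "0 \<le> u" "u \<le> 1"
  shows "lower \<Omega> ((1 - u) *\<^sub>R p + u *\<^sub>R q) \<le> (1 - u) * lower \<Omega> p + u * lower \<Omega> q"
  using rev.upper_concave[OF assms, of p q] by (simp add: lower_def)

lemma lower_less_fst: "x \<in> \<Omega> \<Longrightarrow> lower \<Omega> (snd x) < fst x"
  using rev.fst_less_upper[of "trev x"] by (simp add: lower_def)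

text \<open>Positive depth yields points of \<open>\<Omega>\<close> in the chronological past and
  future of \<open>x\<close>, and \<open>diamond\<close> fills in what lies between them.\<close>

lemma mem_iff_depth: "x \<in> \<Omega> \<longleftrightarrow> 0 < depth \<Omega> x"
proof
  assume "0 < depth \<Omega> x"
  then have "fst x < upper \<Omega> (snd x)" "lower \<Omega> (snd x) < fst x" by (auto simp: depth_def)
  then obtain y z where "y \<in> \<Omega>" "fst x < fst y - dist (snd x) (snd y)"
      "z \<in> \<Omega>" "fst z + dist (snd x) (snd z) < fst x"
    using less_upper lower_less by metis
  then show "x \<in> \<Omega>" using diamond[of z y x] by auto
qed (auto simp: depth_def fst_less_upper lower_less_fst)

lemma mem_iff: "x \<in> \<Omega> \<longleftrightarrow> lower \<Omega> (snd x) < fst x \<and> fst x < upper \<Omega> (snd x)"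
  by (auto simp: mem_iff_depth depth_def)

lemma projection_eq: "snd ` \<Omega> = {p. lower \<Omega> p < upper \<Omega> p}"
proof (intro set_eqI iffI)
  fix p assume "p \<in> {p. lower \<Omega> p < upper \<Omega> p}"
  then have "((lower \<Omega> p + upper \<Omega> p) / 2, p) \<in> \<Omega>" by (simp add: mem_iff)
  then show "p \<in> snd ` \<Omega>" by force
qed (auto simp: mem_iff)

lemma continuous_lower: "continuous_on S (lower \<Omega>)"
  unfolding lower_def by (intro continuous_on_minus rev.continuous_upper)

lemma depth_concave:
  assumes "0 \<le> u" "u \<le> 1"
  shows "(1 - u) * depth \<Omega> x + u * depth \<Omega> y \<le> depth \<Omega> ((1 - u) *\<^sub>R x + u *\<^sub>R y)"
proof -
  let ?z = "(1 - u) *\<^sub>R x + u *\<^sub>R y"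
  have d: "depth \<Omega> x \<le> upper \<Omega> (snd x) - fst x" "depth \<Omega> x \<le> fst x - lower \<Omega> (snd x)" for x
    by (auto simp: depth_def)
  have "(1 - u) * depth \<Omega> x + u * depth \<Omega> y \<le> upper \<Omega> (snd ?z) - fst ?z"
    using mult_left_mono[OF d(1)[of x], of "1 - u"] mult_left_mono[OF d(1)[of y], of u]
      upper_concave[OF assms, of "snd x" "snd y"] assms by (simp add: algebra_simps)
  moreover have "(1 - u) * depth \<Omega> x + u * depth \<Omega> y \<le> fst ?z - lower \<Omega> (snd ?z)"
    using mult_left_mono[OF d(2)[of x], of "1 - u"] mult_left_mono[OF d(2)[of y], of u]
      lower_convex[OF assms, of "snd x" "snd y"] assms by (simp add: algebra_simps)
  ultimately show ?thesis by (simp add: depth_def)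
qed

lemma depth_lipschitz: "depth \<Omega> x \<le> depth \<Omega> y + (\<bar>fst x - fst y\<bar> + dist (snd x) (snd y))"
  using upper_lipschitz[of "snd x" "snd y"] lower_lipschitz[of "snd y" "snd x"]
  by (auto simp: depth_def dist_commute min_def)

lemma depth_lipschitz_dist: "depth \<Omega> x \<le> depth \<Omega> y + 2 * dist x y"
  using depth_lipschitz[of x y] dist_fst_le[of x y] dist_snd_le[of x y] by (simp add: dist_real_def)

lemma depth_bound:
  obtains B where "0 < B" "\<And>x. x \<in> \<Omega> \<Longrightarrow> depth \<Omega> x \<le> B"
    "\<And>x y. x \<in> \<Omega> \<Longrightarrow> y \<in> \<Omega> \<Longrightarrow> dist x y \<le> B"
proof -
  obtain B where B: "0 < B" "\<And>x. x \<in> \<Omega> \<Longrightarrow> norm x \<le> B" using body_bound by metis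
  obtain x0 where x0: "x0 \<in> \<Omega>" using nonempty_body by blast
  have d: "dist x y \<le> 2 * B" if "x \<in> \<Omega>" "y \<in> \<Omega>" for x y
    using B(2)[OF that(1)] B(2)[OF that(2)] norm_triangle_ineq4[of x y] by (simp add: dist_norm)
  show ?thesis
  proof (rule that[of "4 * B + depth \<Omega> x0"])
    show "0 < 4 * B + depth \<Omega> x0" using B x0 by (simp add: mem_iff_depth)
    show "depth \<Omega> x \<le> 4 * B + depth \<Omega> x0" if "x \<in> \<Omega>" for x
      using depth_lipschitz_dist[of x x0] d[OF that x0] by simp
    show "dist x y \<le> 4 * B + depth \<Omega> x0" if "x \<in> \<Omega>" "y \<in> \<Omega>" for x y
      using d[OF that] B x0 by (simp add: mem_iff_depth)
  qed
qed

text \<open>Along \<open>(\<sigma>, u)\<close> time and space change equally fast, so depth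
  decreases at rate at most 2 and the chord of half-length \<open>depth \<Omega> a / 2\<close> stays
  inside. On its middle half the logarithm is bounded linearly.\<close>

lemma null_path_step:
  assumes a: "a \<in> \<Omega>" and u: "norm u = 1" and \<sigma>: "\<bar>\<sigma>\<bar> = 1" and r: "\<bar>r\<bar> \<le> depth \<Omega> a / 4"
  shows "\<exists>T \<le> 8 * \<bar>r\<bar> / depth \<Omega> a. null_path \<Omega> a (a + r *\<^sub>R (\<sigma>, u)) T"
proof -
  define R where "R = depth \<Omega> a / 2"
  have R: "0 < R" using a by (simp add: mem_iff_depth R_def)
  have \<sigma>2: "\<sigma> * \<sigma> = 1" using \<sigma> by (metis abs_mult_self_eq mult_1)
  have v: "lightlike (\<sigma>, u)"
    using u \<sigma> \<sigma>2 by (auto simp: lightlike_def mink_def zero_prod_def dot_square_norm)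
  have "a + q *\<^sub>R (\<sigma>, u) \<in> \<Omega>" if "- R < q" "q < R" for q
    using depth_lipschitz[of a "a + q *\<^sub>R (\<sigma>, u)"] that u \<sigma>
    by (auto simp: mem_iff_depth dist_norm abs_mult R_def)
  then have "null_path \<Omega> (a + 0 *\<^sub>R (\<sigma>, u)) (a + r *\<^sub>R (\<sigma>, u))
      \<bar>ln (((r - - R) / (R - r)) / ((0 - - R) / (R - 0)))\<bar>"
    using r R by (intro null_path_chord[OF v]) (auto simp: R_def)
  then have "null_path \<Omega> a (a + r *\<^sub>R (\<sigma>, u)) \<bar>ln ((R + r) / (R - r))\<bar>"
    using R by (simp add: add.commute flip: zero_prod_def)
  moreover have "\<bar>ln ((R + r) / (R - r))\<bar> \<le> 8 * \<bar>r\<bar> / depth \<Omega> a"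
  proof -
    have b: "\<bar>r\<bar> \<le> R / 2" using r by (simp add: R_def)
    have p: "0 < R + r" "0 < R - r" using b R by auto
    have "ln ((R + r) / (R - r)) \<le> (R + r) / (R - r) - 1"
      by (rule ln_le_minus_one) (use p in auto)
    also have "\<dots> = 2 * r / (R - r)" using p by (simp add: field_simps)
    also have "\<dots> \<le> 2 * \<bar>r\<bar> / (R / 2)"
      using b R p by (intro frac_le) auto
    finally have 1: "ln ((R + r) / (R - r)) \<le> 4 * \<bar>r\<bar> / R" by simp
    have "ln ((R - r) / (R + r)) \<le> (R - r) / (R + r) - 1"
      by (rule ln_le_minus_one) (use p in auto)
    also have "\<dots> = 2 * (- r) / (R + r)" using p by (simp add: field_simps)
    also have "\<dots> \<le> 2 * \<bar>r\<bar> / (R / 2)"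
      using b R p by (intro frac_le) auto
    finally have 2: "ln ((R - r) / (R + r)) \<le> 4 * \<bar>r\<bar> / R" by simp
    have "ln ((R - r) / (R + r)) = - ln ((R + r) / (R - r))" using p by (simp add: ln_div)
    with 1 2 show ?thesis by (simp add: R_def)
  qed
  ultimately show ?thesis by blast
qed

text \<open>A vector is the sum of two lightlike ones whose spatial parts are parallel to its own.\<close>

lemma null_path_local:
  assumes a: "a \<in> \<Omega>" and d: "dist a b \<le> depth \<Omega> a / 16"
  shows "\<exists>T \<le> 24 * dist a b / depth \<Omega> a. null_path \<Omega> a b T"
proof -
  define D where "D = depth \<Omega> a"
  define \<tau> where "\<tau> = fst b - fst a"
  define \<pi> where "\<pi> = snd b - snd a"
  have D: "0 < D" using a by (simp add: mem_iff_depth D_def)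
  obtain u :: "real ^ 'n" where u: "norm u = 1" "\<pi> = norm \<pi> *\<^sub>R u"
  proof (cases "\<pi> = 0")
    case True
    obtain u :: "real ^ 'n" where "norm u = 1" using vector_choose_size[of 1] by auto
    then show ?thesis using that True by simp
  next
    case False
    show ?thesis by (rule that[of "(1 / norm \<pi>) *\<^sub>R \<pi>"]) (use False in auto)
  qed
  define \<alpha> where "\<alpha> = (norm \<pi> + \<tau>) / 2"
  define \<beta> where "\<beta> = (norm \<pi> - \<tau>) / 2"
  have n: "\<bar>\<tau>\<bar> + norm \<pi> \<le> 2 * dist a b"
    using dist_fst_le[of a b] dist_snd_le[of a b]
    by (simp add: \<tau>_def \<pi>_def dist_real_def dist_norm norm_minus_commute abs_minus_commute)
  have "\<bar>(m + t) / 2\<bar> \<le> D \<and> \<bar>(m - t) / 2\<bar> \<le> D" if "\<bar>t\<bar> + m \<le> 2 * D" "0 \<le> m" for t m D :: real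
    using that by (simp add: abs_le_iff field_simps) linarith
  then have ab: "\<bar>\<alpha>\<bar> \<le> dist a b" "\<bar>\<beta>\<bar> \<le> dist a b"
    using n norm_ge_zero[of \<pi>] unfolding \<alpha>_def \<beta>_def by blast+
  define c where "c = a + \<alpha> *\<^sub>R (1, u)"
  have b: "b = c + \<beta> *\<^sub>R (-1, u)"
  proof (rule prod_eqI)
    show "fst b = fst (c + \<beta> *\<^sub>R (-1, u))" by (simp add: c_def \<alpha>_def \<beta>_def \<tau>_def field_simps)
    have "snd (c + \<beta> *\<^sub>R (-1, u)) = snd a + (\<alpha> + \<beta>) *\<^sub>R u"
      by (simp add: c_def scaleR_add_left)
    also have "\<dots> = snd a + \<pi>" by (subst u(2)) (simp add: \<alpha>_def \<beta>_def field_simps)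
    finally show "snd b = snd (c + \<beta> *\<^sub>R (-1, u))" by (simp add: \<pi>_def)
  qed
  obtain T1 where T1: "T1 \<le> 8 * \<bar>\<alpha>\<bar> / D" "null_path \<Omega> a c T1"
    using null_path_step[OF a u(1), of 1 \<alpha>] ab d D by (auto simp: c_def D_def)
  have c: "c \<in> \<Omega>" using null_path_in T1(2) by blast
  \<comment> \<open>The first leg lowers the depth by at most \<open>D / 8\<close>, so the second
    costs at most \<open>16 * dist a b / D\<close>. Together with 8 for the first leg this is the
    constant 24.\<close>
  have Dc: "D / 2 \<le> depth \<Omega> c"
    using depth_lipschitz[of a c] u ab d by (simp add: c_def D_def dist_norm)
  then have "\<bar>\<beta>\<bar> \<le> depth \<Omega> c / 4" using ab d D by (simp add: D_def)
  then obtain T2 where T2: "T2 \<le> 8 * \<bar>\<beta>\<bar> / depth \<Omega> c" "null_path \<Omega> c b T2"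
    using null_path_step[OF c u(1), of "-1" \<beta>] by (auto simp: b)
  have "T1 \<le> 8 * dist a b / D"
    by (rule order_trans[OF T1(1)]) (use ab D in \<open>auto intro: divide_right_mono\<close>)
  moreover have "T2 \<le> 8 * dist a b / (D / 2)"
    by (rule order_trans[OF T2(1)], rule frac_le) (use ab D Dc in auto)
  ultimately have "T1 + T2 \<le> 24 * dist a b / D" using D by (simp add: field_simps)
  with null_path_trans[OF T1(2) T2(2)] show ?thesis unfolding D_def by blast
qed

text \<open>By concavity the depth is at least \<open>R\<close> on the whole segment, which is cut
  into pieces of length at most \<open>R / 16\<close>, short enough for
  \<open>null_path_local\<close>.\<close>

lemma null_path_segment:
  assumes R: "0 < R" "R \<le> depth \<Omega> x" "R \<le> depth \<Omega> y"
  shows "\<exists>T \<le> 24 * dist x y / R. null_path \<Omega> x y T"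
proof -
  have main: "\<exists>T \<le> 24 * dist x y / R. null_path \<Omega> x y T"
    if "R \<le> depth \<Omega> x" "R \<le> depth \<Omega> y" "dist x y \<le> real (Suc N) * (R / 16)" for N x y
    using that
  proof (induction N arbitrary: x)
    case 0
    have x: "x \<in> \<Omega>" using 0 R by (simp add: mem_iff_depth)
    have "\<exists>T \<le> 24 * dist x y / depth \<Omega> x. null_path \<Omega> x y T"
      by (rule null_path_local[OF x]) (use 0 in simp)
    moreover have "24 * dist x y / depth \<Omega> x \<le> 24 * dist x y / R"
      using 0 R by (intro divide_left_mono) auto
    ultimately show ?case by (meson order_trans)
  next
    case (Suc N)
    \<comment> \<open>The first of \<open>N + 2\<close> equal pieces is split off;
      \<open>N + 1\<close> of them remain for the induction hypothesis.\<close>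
    define \<theta> where "\<theta> = 1 / real (Suc (Suc N))"
    have \<theta>: "0 \<le> \<theta>" "\<theta> \<le> 1" by (auto simp: \<theta>_def)
    define z where "z = (1 - \<theta>) *\<^sub>R x + \<theta> *\<^sub>R y"
    have xz: "dist x z = \<theta> * dist x y"
    proof -
      have "x - z = \<theta> *\<^sub>R (x - y)" by (simp add: z_def algebra_simps)
      then show ?thesis using \<theta> by (simp add: dist_norm)
    qed
    have zy: "dist z y = (1 - \<theta>) * dist x y"
    proof -
      have "z - y = (1 - \<theta>) *\<^sub>R (x - y)" by (simp add: z_def algebra_simps)
      then show ?thesis using \<theta> by (simp add: dist_norm)
    qed
    have "dist x z \<le> \<theta> * (real (Suc (Suc N)) * (R / 16))"
      unfolding xz by (rule mult_left_mono) (use Suc.prems \<theta> in auto)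
    then have xz': "dist x z \<le> R / 16" by (simp add: \<theta>_def)
    have "dist z y \<le> (1 - \<theta>) * (real (Suc (Suc N)) * (R / 16))"
      unfolding zy by (rule mult_left_mono) (use Suc.prems \<theta> in auto)
    also have "(1 - \<theta>) * (real (Suc (Suc N)) * (R / 16)) = real (Suc N) * (R / 16)"
      by (simp add: \<theta>_def field_simps)
    finally have zy': "dist z y \<le> real (Suc N) * (R / 16)" .
    have z: "R \<le> depth \<Omega> z"
    proof -
      have "R = (1 - \<theta>) * R + \<theta> * R" by (simp add: algebra_simps)
      also have "\<dots> \<le> (1 - \<theta>) * depth \<Omega> x + \<theta> * depth \<Omega> y"
        using Suc.prems \<theta> by (intro add_mono mult_left_mono) auto
      also have "\<dots> \<le> depth \<Omega> z" unfolding z_def by (rule depth_concave[OF \<theta>])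
      finally show ?thesis .
    qed
    obtain T2 where T2: "T2 \<le> 24 * dist z y / R" "null_path \<Omega> z y T2"
      using Suc.IH[OF z Suc.prems(2) zy'] by blast
    have x: "x \<in> \<Omega>" using Suc.prems R by (simp add: mem_iff_depth)
    obtain T1 where T1: "T1 \<le> 24 * dist x z / depth \<Omega> x" "null_path \<Omega> x z T1"
      using null_path_local[OF x, of z] xz' Suc.prems(1) by auto
    have "24 * dist x z / depth \<Omega> x \<le> 24 * dist x z / R"
      using Suc.prems R by (intro divide_left_mono) auto
    then have "T1 + T2 \<le> 24 * dist x z / R + 24 * dist z y / R" using T1 T2 by simp
    also have "\<dots> = 24 * dist x y / R" unfolding xz zy by (simp add: algebra_simps flip: add_divide_distrib)
    finally show ?case using null_path_trans[OF T1(2) T2(2)] by blast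
  qed
  obtain N :: nat where "dist x y / (R / 16) \<le> real N" using real_arch_simple by blast
  then have "dist x y \<le> real (Suc N) * (R / 16)" using R by (simp add: field_simps)
  then show ?thesis using main R by blast
qed

lemma null_path_exists:
  assumes "x \<in> \<Omega>" "y \<in> \<Omega>"
  obtains T where "null_path \<Omega> x y T"
  using null_path_segment[of "min (depth \<Omega> x) (depth \<Omega> y)" x y] assms
  by (auto simp: mem_iff_depth)

lemma markowitz_dist_segment_le:
  assumes "0 < R" "R \<le> depth \<Omega> x" "R \<le> depth \<Omega> y"
  shows "markowitz_dist \<Omega> x y \<le> 24 * dist x y / R"
  using null_path_segment[OF assms] markowitz_dist_le by (meson order_trans)

lemma ln_ratio_le_markowitz_dist:
  fixes F :: "'n minkowski \<Rightarrow> real"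
  assumes "x \<in> \<Omega>" "y \<in> \<Omega>" "\<And>x. x \<in> \<Omega> \<Longrightarrow> 0 < F x"
    "\<And>x v. lightlike v \<Longrightarrow> \<exists>\<beta>. \<forall>r. F (x + r *\<^sub>R v) = F x + \<beta> * r"
  shows "ln (F y / F x) \<le> markowitz_dist \<Omega> x y"
  using null_path_exists[OF assms(1,2)] markowitz_dist_ge_ln_ratio assms(3,4) by metis

end

subsection \<open>Geodesics in proper metric spaces\<close>

lemma geodesic_segment_ends:
  assumes "geodesic_segment M d x y S"
  shows "x \<in> S" "y \<in> S" "S \<subseteq> M"
  using assms unfolding geodesic_segment_def by force+

lemma geodesic_segment_sym:
  assumes "geodesic_segment M d x y S"
  shows "geodesic_segment M d y x S"
proof -
  obtain L g where g: "S \<subseteq> M" "0 \<le> L" "g 0 = x" "g L = y" "S = g ` {0..L}"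
      "\<And>s t. s \<in> {0..L} \<Longrightarrow> t \<in> {0..L} \<Longrightarrow> d (g s) (g t) = \<bar>s - t\<bar>"
    using assms unfolding geodesic_segment_def by blast
  have "(\<lambda>s. L - s) ` {0..L} = {0..L}" by (simp add: image_diff_atLeastAtMost)
  then have "S = (\<lambda>s. g (L - s)) ` {0..L}" using g(5) by (metis image_image)
  moreover have "d (g (L - s)) (g (L - t)) = \<bar>s - t\<bar>" if "s \<in> {0..L}" "t \<in> {0..L}" for s t
    using g(6)[of "L - s" "L - t"] that by auto
  ultimately show ?thesis
    unfolding geodesic_segment_def using g(1-4)
    by (intro conjI exI[of _ L] exI[of _ "\<lambda>s. g (L - s)"]) auto
qed

context Metric_space
begin

lemma limitin_dist_le:
  assumes "limitin mtopology \<sigma> l sequentially" "a \<in> M" "\<And>n. \<sigma> n \<in> M"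
    "\<And>n. d a (\<sigma> n) \<le> c n" "c \<longlonglongrightarrow> C"
  shows "d a l \<le> C"
proof (rule field_le_epsilon)
  fix e :: real assume e: "0 < e"
  have l: "l \<in> M" using assms(1) limitin_mspace by blast
  have "\<forall>\<^sub>F n in sequentially. \<sigma> n \<in> M \<and> d (\<sigma> n) l < e / 2"
    using assms(1) half_gt_zero[OF e] unfolding limitin_metric by blast
  moreover have "\<forall>\<^sub>F n in sequentially. c n < C + e / 2"
    using assms(5) e by (intro order_tendstoD) auto
  ultimately have "\<forall>\<^sub>F n in sequentially. d a l \<le> C + e"
  proof eventually_elim
    case (elim n)
    then show ?case using triangle[of a "\<sigma> n" l] assms(2) l assms(4)[of n] by simp
  qed
  then show "d a l \<le> C + e" by simp
qed

lemma compactin_subsequence: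
  fixes \<sigma> :: "nat \<Rightarrow> 'a"
  assumes "compactin mtopology K" "range \<sigma> \<subseteq> K"
  obtains l r where "strict_mono r" "limitin mtopology (\<sigma> \<circ> r) l sequentially" "l \<in> M"
proof -
  have "\<exists>l r. l \<in> K \<and> strict_mono r \<and> limitin mtopology (\<sigma> \<circ> r) l sequentially"
    by (rule compactin_sequentially[THEN iffD1, OF assms(1), THEN conjunct2, rule_format, OF assms(2)])
  then obtain l r where "strict_mono r" "limitin mtopology (\<sigma> \<circ> r) l sequentially" by (elim exE conjE)
  then show ?thesis by (rule that) (rule limitin_mspace, fact)
qed

text \<open>Approximate intermediate points accumulate in a compact ball. The limit satisfies both
  upper bounds, and the triangle inequality turns them into equalities.\<close>

lemma exact_betweenness:
  assumes balls_compact: "\<And>x r. x \<in> M \<Longrightarrow> compactin mtopology (mcball x r)"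
    and approx: "\<And>x y s e. x \<in> M \<Longrightarrow> y \<in> M \<Longrightarrow> 0 \<le> s \<Longrightarrow> s \<le> d x y \<Longrightarrow> 0 < e \<Longrightarrow>
      \<exists>z\<in>M. d x z \<le> s + e \<and> d z y \<le> d x y - s + e"
    and xy: "x \<in> M" "y \<in> M" and s: "0 \<le> s" "s \<le> d x y"
  shows "\<exists>z\<in>M. d x z = s \<and> d z y = d x y - s"
proof -
  have "\<exists>z\<in>M. d x z \<le> s + 1 / real (Suc n) \<and> d z y \<le> d x y - s + 1 / real (Suc n)" for n
    by (rule approx[OF xy s]) simp
  then obtain \<sigma> where \<sigma>: "\<And>n. \<sigma> n \<in> M" "\<And>n. d x (\<sigma> n) \<le> s + 1 / real (Suc n)"
      "\<And>n. d (\<sigma> n) y \<le> d x y - s + 1 / real (Suc n)"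
    by metis
  have "d x (\<sigma> n) \<le> s + 1" for n
    by (rule order_trans[OF \<sigma>(2)]) simp
  then have "range \<sigma> \<subseteq> mcball x (s + 1)" using \<sigma>(1) xy by auto
  then obtain l r where lr: "strict_mono r" "limitin mtopology (\<sigma> \<circ> r) l sequentially" "l \<in> M"
    by (rule compactin_subsequence[OF balls_compact[OF xy(1)]])
  have c: "(\<lambda>n. b + 1 / real (Suc (r n))) \<longlonglongrightarrow> b + 0" for b :: real
    using LIMSEQ_subseq_LIMSEQ[OF LIMSEQ_inverse_real_of_nat lr(1)]
    by (intro tendsto_add tendsto_const) (simp add: o_def inverse_eq_divide)
  have "d x l \<le> s + 0" "d y l \<le> d x y - s + 0"
    by (rule limitin_dist_le[OF lr(2) _ _ _ c]; use xy \<sigma> in \<open>simp add: commute[of y]\<close>)+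
  moreover have "d x y \<le> d x l + d l y" using triangle xy lr(3) by blast
  ultimately show ?thesis using lr(3) commute[of l y] by (intro bexI[of _ l]) auto
qed

text \<open>A geodesic segment from \<open>x\<close> to \<open>y\<close> is a maximal set on which \<open>d\<close> is the difference of the
  distances to \<open>x\<close>.\<close>

lemma geodesic_segment_exists:
  assumes balls_compact: "\<And>x r. x \<in> M \<Longrightarrow> compactin mtopology (mcball x r)"
    and approx: "\<And>x y s e. x \<in> M \<Longrightarrow> y \<in> M \<Longrightarrow> 0 \<le> s \<Longrightarrow> s \<le> d x y \<Longrightarrow> 0 < e \<Longrightarrow>
      \<exists>z\<in>M. d x z \<le> s + e \<and> d z y \<le> d x y - s + e"
    and xy: "x \<in> M" "y \<in> M"
  shows "\<exists>S. geodesic_segment M d x y S"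
proof -
  define L where "L = d x y"
  have L: "0 \<le> L" by (simp add: L_def)
  define al where "al = (\<lambda>S. S \<subseteq> M \<and> x \<in> S \<and> y \<in> S \<and> (\<forall>u\<in>S. d x u \<le> L) \<and>
    (\<forall>u\<in>S. \<forall>v\<in>S. d u v = \<bar>d x u - d x v\<bar>))"
  have al0: "al {x, y}" using xy by (auto simp: al_def L_def commute)
  have "\<exists>S\<in>Collect al. \<forall>S'\<in>Collect al. S \<subseteq> S' \<longrightarrow> S' = S"
  proof (rule subset_Zorn_nonempty)
    fix C assume C: "C \<noteq> {}" "subset.chain (Collect al) C"
    have Cal: "\<And>S. S \<in> C \<Longrightarrow> al S" using C(2) by (auto simp: subset.chain_def)
    have pair: "\<exists>S\<in>C. u \<in> S \<and> v \<in> S" if "u \<in> \<Union>C" "v \<in> \<Union>C" for u v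
    proof -
      from that obtain S S' where S: "S \<in> C" "u \<in> S" "S' \<in> C" "v \<in> S'" by blast
      then have "S \<subseteq> S' \<or> S' \<subseteq> S" using C(2) unfolding subset.chain_def by blast
      then show ?thesis using S by blast
    qed
    show "\<Union>C \<in> Collect al"
      unfolding mem_Collect_eq al_def
    proof (intro conjI ballI)
      show "\<Union>C \<subseteq> M" "x \<in> \<Union>C" "y \<in> \<Union>C" using C(1) Cal unfolding al_def by blast+
      show "d x u \<le> L" if "u \<in> \<Union>C" for u using that Cal unfolding al_def by blast
      show "d u v = \<bar>d x u - d x v\<bar>" if "u \<in> \<Union>C" "v \<in> \<Union>C" for u v
        using pair[OF that] Cal unfolding al_def by blast
    qed
  qed (use al0 in auto)
  then obtain S where S: "al S" and max: "\<And>S'. al S' \<Longrightarrow> S \<subseteq> S' \<Longrightarrow> S' = S" by auto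
  have SM: "S \<subseteq> M" and xS: "x \<in> S" and yS: "y \<in> S" and SL: "\<And>u. u \<in> S \<Longrightarrow> d x u \<le> L"
    and Sdist: "\<And>u v. u \<in> S \<Longrightarrow> v \<in> S \<Longrightarrow> d u v = \<bar>d x u - d x v\<bar>"
    using S unfolding al_def by blast+
  have insert: "m \<in> S" if m: "m \<in> M" "d x m \<le> L" "\<And>u. u \<in> S \<Longrightarrow> d u m = \<bar>d x u - d x m\<bar>" for m
  proof -
    have "d u v = \<bar>d x u - d x v\<bar>" if uv: "u \<in> insert m S" "v \<in> insert m S" for u v
    proof -
      consider "u \<in> S" "v \<in> S" | "u = m" "v = m" | "u = m" "v \<in> S" | "u \<in> S" "v = m"
        using uv by blast
      then show ?thesis
      proof cases
        case 1
        then show ?thesis by (rule Sdist)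
      next
        case 2
        then show ?thesis using m(1) by simp
      next
        case 3
        then show ?thesis using m(3)[of v] by (simp only: commute[of m v] abs_minus_commute[of "d x m"])
      next
        case 4
        then show ?thesis using m(3) by blast
      qed
    qed
    then have "al (insert m S)"
      unfolding al_def using SM xS yS SL m(1,2) by blast
    then show ?thesis using max by blast
  qed
  define P where "P = d x ` S"
  have P: "P \<subseteq> {0..L}" "0 \<in> P" "L \<in> P" using xS yS SL xy by (auto simp: P_def L_def image_iff intro: bexI[of _ x])
  have clP: "closed P"
    \<comment> \<open>A limit of values in \<open>P\<close> is the value at a subsequential limit
      \<open>m\<close> of points of \<open>S\<close>. This \<open>m\<close> satisfies the equations
      of \<open>al\<close>, so it belongs to \<open>S\<close> by maximality.\<close>
    unfolding closed_sequential_limits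
  proof (intro allI impI)
    fix p l assume pl: "(\<forall>n. p n \<in> P) \<and> p \<longlonglongrightarrow> l"
    then have "\<forall>n. \<exists>u. u \<in> S \<and> p n = d x u" by (auto simp: P_def)
    then obtain \<sigma> where \<sigma>: "\<And>n. \<sigma> n \<in> S" "\<And>n. p n = d x (\<sigma> n)" by metis
    have "range \<sigma> \<subseteq> mcball x L" using subsetD[OF SM \<sigma>(1)] SL[OF \<sigma>(1)] xy by auto
    then obtain m r where mr: "strict_mono r" "limitin mtopology (\<sigma> \<circ> r) m sequentially" "m \<in> M"
      by (rule compactin_subsequence[OF balls_compact[OF xy(1)]])
    have lim: "(\<lambda>n. d x (\<sigma> (r n))) \<longlonglongrightarrow> l"
      using LIMSEQ_subseq_LIMSEQ[OF conjunct2[OF pl] mr(1)] \<sigma>(2) by (simp add: o_def)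
    have \<sigma>M: "\<sigma> n \<in> M" for n by (rule subsetD[OF SM \<sigma>(1)])
    have 1: "d u m \<le> \<bar>d x u - l\<bar>" if u: "u \<in> S" for u
    proof (rule limitin_dist_le[OF mr(2)])
      show "(\<lambda>n. \<bar>d x u - d x (\<sigma> (r n))\<bar>) \<longlonglongrightarrow> \<bar>d x u - l\<bar>"
        by (intro tendsto_rabs tendsto_diff tendsto_const lim)
      show "d u ((\<sigma> \<circ> r) n) \<le> \<bar>d x u - d x (\<sigma> (r n))\<bar>" for n
        using Sdist[OF u \<sigma>(1)] by simp
    qed (use u SM \<sigma>M in auto)
    have "l \<in> {0..L}"
      using closed_sequentially[OF closed_atLeastAtMost, of p 0 L l] pl P(1) by blast
    then have "d x m \<le> l" "d y m \<le> L - l" using 1[OF xS] 1[OF yS] xy by (auto simp: L_def)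
    moreover have "L \<le> d x m + d m y" unfolding L_def using triangle xy mr(3) by blast
    ultimately have dm: "d x m = l" using commute[of m y] by simp
    have "m \<in> S"
    proof (rule insert[OF mr(3)])
      show "d x m \<le> L" using dm \<open>l \<in> {0..L}\<close> by simp
      fix u assume u: "u \<in> S"
      have "\<bar>d x u - d x m\<bar> \<le> d u m"
        using triangle[of x u m] triangle[of x m u] xy mr(3) subsetD[OF SM u] commute[of m u] by auto
      then show "d u m = \<bar>d x u - d x m\<bar>" using 1[OF u] dm by simp
    qed
    then show "l \<in> P" using dm by (auto simp: P_def)
  qed
  \<comment> \<open>If \<open>t\<close> is missing, let \<open>a < t < b\<close> be its neighbours
    in \<open>P\<close>. A point at level \<open>t\<close> between the points at levels
    \<open>a\<close> and \<open>b\<close> is aligned with all of \<open>S\<close>, since no element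
    of \<open>S\<close> lies strictly between these levels; this contradicts maximality.\<close>
  have full: "{0..L} \<subseteq> P"
  proof
    fix t assume t: "t \<in> {0..L}"
    show "t \<in> P"
    proof (rule ccontr)
      assume tP: "t \<notin> P"
      define a where "a = Sup (P \<inter> {0..t})"
      define b where "b = Inf (P \<inter> {t..L})"
      have "a \<in> P \<inter> {0..t}"
        unfolding a_def using P t
        by (intro closed_contains_Sup closed_Int clP) (auto intro: bdd_aboveI[of _ t])
      moreover have "b \<in> P \<inter> {t..L}"
        unfolding b_def using P t
        by (intro closed_contains_Inf closed_Int clP) (auto intro: bdd_belowI[of _ t])
      moreover have below: "p \<le> a" if "p \<in> P" "p \<le> t" for p
        unfolding a_def using that P(1) by (intro cSup_upper) (auto intro: bdd_aboveI[of _ t])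
      moreover have above: "b \<le> p" if "p \<in> P" "t \<le> p" for p
        unfolding b_def using that P(1) by (intro cInf_lower) (auto intro: bdd_belowI[of _ t])
      ultimately have ab: "a \<in> P" "b \<in> P" "a < t" "t < b" using tP by (auto simp: less_le)
      obtain u v where uv: "u \<in> S" "v \<in> S" "d x u = a" "d x v = b" using ab by (auto simp: P_def)
      have uvM: "u \<in> M" "v \<in> M" using uv SM by auto
      have duv: "d u v = b - a" using Sdist[OF uv(1,2)] uv ab by simp
      obtain m where m: "m \<in> M" "d u m = t - a" "d m v = d u v - (t - a)"
        using exact_betweenness[OF balls_compact approx uvM, of "t - a"] ab duv by auto
      have dm: "d x m = t"
        using triangle[of x u m] triangle[of x m v] m uv uvM xy duv by auto
      have "m \<in> S"
      proof (rule insert[OF m(1)])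
        show "d x m \<le> L" using dm t by simp
        fix w assume w: "w \<in> S"
        then have wM: "w \<in> M" using SM by auto
        have ge: "\<bar>d x w - d x m\<bar> \<le> d w m"
          using triangle[of x w m] triangle[of x m w] xy m(1) wM commute[of m w] by auto
        have "d w m \<le> \<bar>d x w - d x m\<bar>"
        proof (cases "d x w \<le> t")
          case True
          then have "d x w \<le> a" using below w by (auto simp: P_def)
          then show ?thesis
            using triangle[of w u m] wM uvM m Sdist[OF w uv(1)] uv dm by auto
        next
          case False
          then have "b \<le> d x w" using above w by (auto simp: P_def)
          then show ?thesis
            using triangle[of w v m] wM uvM m Sdist[OF w uv(2)] uv dm duv commute[of v m] by auto
        qed
        then show "d w m = \<bar>d x w - d x m\<bar>" using ge by simp
      qed
      then show False using dm tP by (auto simp: P_def)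
    qed
  qed
  have "\<forall>t\<in>{0..L}. \<exists>u. u \<in> S \<and> d x u = t" using full by (force simp: P_def)
  then obtain g where g: "\<And>t. t \<in> {0..L} \<Longrightarrow> g t \<in> S \<and> d x (g t) = t" by metis
  have inj: "u = v" if "u \<in> S" "v \<in> S" "d x u = d x v" for u v
    using Sdist[OF that(1,2)] that SM zero[of u v] by auto
  have "geodesic_segment M d x y S"
    unfolding geodesic_segment_def
  proof (intro conjI exI)
    show "S \<subseteq> M" by (rule SM)
    show "g 0 = x" "g L = y"
      using inj[of "g 0" x] inj[of "g L" y] g[of 0] g[of L] L xS yS xy by (auto simp: L_def)
    show "S = g ` {0..L}"
    proof (intro set_eqI iffI)
      fix u assume u: "u \<in> S"
      then have "d x u \<in> {0..L}" using SL by auto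
      then show "u \<in> g ` {0..L}" using inj[of u "g (d x u)"] g u by (metis imageI)
    qed (use g in auto)
    show "\<forall>s\<in>{0..L}. \<forall>t\<in>{0..L}. d (g s) (g t) = \<bar>s - t\<bar>" using g Sdist by metis
  qed (rule L)
  then show ?thesis by blast
qed

end

text \<open>A consequence of hyperbolicity in terms of distances between four points, without
  segments. It is therefore visibly invariant under time reversal, and the slack \<open>C\<close>
  admits distances known up to an additive constant.\<close>

definition thin_bigons :: "'a set \<Rightarrow> ('a \<Rightarrow> 'a \<Rightarrow> real) \<Rightarrow> bool" where
  "thin_bigons M d \<longleftrightarrow> (\<exists>r. \<forall>x\<in>M. \<forall>z\<in>M. \<forall>p\<in>M. \<forall>q\<in>M. \<forall>h C. 0 \<le> h \<longrightarrow>
      d x p \<le> h + C \<longrightarrow> d p z \<le> h + C \<longrightarrow> d x q \<le> h + C \<longrightarrow> d q z \<le> h + C \<longrightarrow> 2 * h \<le> d x z \<longrightarrow>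
      d p q \<le> 2 * C + 4 * r)"

text \<open>In a hyperbolic space two almost geodesic paths \<open>x\<close>, \<open>p\<close>, \<open>z\<close> and \<open>x\<close>, \<open>q\<close>, \<open>z\<close> with sides
  of about the same length \<open>h\<close> have nearby corners: both are near the point at distance \<open>h\<close>
  from \<open>x\<close> on a geodesic segment from \<open>x\<close> to \<open>z\<close>.\<close>

lemma gromov_hyperbolic_imp_thin_bigons:
  assumes "gromov_hyperbolic M d"
  shows "thin_bigons M d"
proof -
  from assms[unfolded gromov_hyperbolic_def]
  obtain r where thin0: "\<forall>x y z A B C.
      geodesic_segment M d x y A \<and> geodesic_segment M d y z B \<and> geodesic_segment M d z x C \<longrightarrow>
      A \<subseteq> metric_nbhd M d r (B \<union> C) \<and> B \<subseteq> metric_nbhd M d r (C \<union> A) \<and> C \<subseteq> metric_nbhd M d r (A \<union> B)"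
    and pg: "proper_geodesic_space M d"
    by (elim conjE exE)
  have thin: "C \<subseteq> metric_nbhd M d r (A \<union> B)"
    if "geodesic_segment M d x y A" "geodesic_segment M d y z B" "geodesic_segment M d z x C" for x y z A B C
    using thin0[rule_format, OF conjI[OF that(1) conjI[OF that(2,3)]]] by simp
  interpret Metric_space M d using pg unfolding proper_geodesic_space_def by blast
  have geo: "\<And>x y. x \<in> M \<Longrightarrow> y \<in> M \<Longrightarrow> \<exists>S. geodesic_segment M d x y S"
    using pg unfolding proper_geodesic_space_def by blast
  have on_seg: "d x u + d u y = d x y" if S: "geodesic_segment M d x y S" and u: "u \<in> S" for x y u S
  proof -
    obtain L g where g: "0 \<le> L" "g 0 = x" "g L = y" "S = g ` {0..L}"
        "\<And>s t. s \<in> {0..L} \<Longrightarrow> t \<in> {0..L} \<Longrightarrow> d (g s) (g t) = \<bar>s - t\<bar>"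
      using S unfolding geodesic_segment_def by blast
    obtain s where s: "s \<in> {0..L}" "u = g s" using u g(4) by blast
    show ?thesis using g(5)[of 0 s] g(5)[of s L] g(5)[of 0 L] g(1-3) s by auto
  qed
  have main: "d m p \<le> 2 * r + C"
    if M: "x \<in> M" "z \<in> M" "p \<in> M" and h: "d x p \<le> h + C" "d p z \<le> h + C" "2 * h \<le> d x z"
      and G: "geodesic_segment M d x z G" and m: "m \<in> G" "d x m = h" for x z p h C G m
  proof -
    obtain A B where AB: "geodesic_segment M d x p A" "geodesic_segment M d p z B"
      using geo M by blast
    have mM: "m \<in> M" by (rule subsetD[OF geodesic_segment_ends(3)[OF G] m(1)])
    obtain w where w: "w \<in> A \<union> B" "d m w < r"
      using subsetD[OF thin[OF AB geodesic_segment_sym[OF G]] m(1)] unfolding metric_nbhd_def by blast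
    have wM: "w \<in> M"
      using w(1) geodesic_segment_ends(3)[OF AB(1)] geodesic_segment_ends(3)[OF AB(2)] by blast
    \<comment> \<open>On the side from \<open>x\<close>, \<open>w\<close> is at distance at least
      \<open>h - r\<close> from \<open>x\<close>, which leaves at most \<open>C + r\<close> up to
      \<open>p\<close>. On the other side the same holds with \<open>z\<close>, because
      \<open>2 * h \<le> d x z\<close> puts \<open>m\<close> at distance at least \<open>h\<close>
      from \<open>z\<close>.\<close>
    have "d w p \<le> C + r"
    proof (cases "w \<in> A")
      case True
      then show ?thesis
        using on_seg[OF AB(1) True] triangle[of x w m] w M wM mM m h commute[of w m] by simp
    next
      case False
      then have "w \<in> B" using w by simp
      then show ?thesis
        using on_seg[OF AB(2), of w] triangle[of m w z] on_seg[OF G m(1)] w M wM mM m h commute[of p w]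
        by simp
    qed
    then show ?thesis using triangle[of m w p] w wM mM M by simp
  qed
  have "d p q \<le> 2 * C + 4 * r"
    if M: "x \<in> M" "z \<in> M" "p \<in> M" "q \<in> M" and h: "0 \<le> h" "d x p \<le> h + C" "d p z \<le> h + C"
      "d x q \<le> h + C" "d q z \<le> h + C" "2 * h \<le> d x z" for x z p q h C
  proof -
    obtain G where G: "geodesic_segment M d x z G" using geo M by blast
    obtain L g where g: "0 \<le> L" "g 0 = x" "g L = z" "G = g ` {0..L}"
        "\<And>s t. s \<in> {0..L} \<Longrightarrow> t \<in> {0..L} \<Longrightarrow> d (g s) (g t) = \<bar>s - t\<bar>"
      using G unfolding geodesic_segment_def by blast
    have "L = d x z" using g(5)[of 0 L] g by simp
    then have "h \<in> {0..L}" using h by simp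
    then have m: "g h \<in> G" "d x (g h) = h" using g(5)[of 0 h] g by auto
    have "g h \<in> M" by (rule subsetD[OF geodesic_segment_ends(3)[OF G] m(1)])
    then show ?thesis
      using main[OF M(1,2,3) h(2,3,6) G m] main[OF M(1,2,4) h(4,5,6) G m] triangle[of p "g h" q] M
        commute[of p "g h"] by simp
  qed
  then show ?thesis unfolding thin_bigons_def by blast
qed

subsection \<open>Thin triangles in quasihyperbolic metrics\<close>

lemma first_level:
  fixes f :: "real \<Rightarrow> real"
  assumes "continuous_on {a..b} f" "a \<le> b" "f a \<le> R" "R \<le> f b"
  shows "\<exists>t\<in>{a..b}. f t = R \<and> (\<forall>s\<in>{a..t}. f s \<le> R)"
proof -
  define S where "S = {s \<in> {a..b}. R \<le> f s}"
  have "closed S"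
    unfolding S_def
    using continuous_closed_preimage[OF assms(1), of "{R..}"]
    by (simp add: vimage_def Int_def)
  moreover have "b \<in> S" using assms by (simp add: S_def)
  moreover have bdd: "bdd_below S" by (rule bdd_belowI[of _ a]) (simp add: S_def)
  ultimately have t: "Inf S \<in> S" by (intro closed_contains_Inf) auto
  define t where "t = Inf S"
  have tS: "t \<in> {a..b}" "R \<le> f t" using t by (auto simp: S_def t_def)
  have less: "f s < R" if "s \<in> {a..<t}" for s
  proof (rule ccontr)
    assume "\<not> f s < R"
    then have "s \<in> S" using that tS by (auto simp: S_def)
    then have "t \<le> s" unfolding t_def using bdd by (rule cInf_lower)
    then show False using that by simp
  qed
  obtain s where s: "a \<le> s" "s \<le> t" "f s = R"
    using IVT'[of f a R t] assms tS continuous_on_subset[OF assms(1), of "{a..t}"] by auto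
  then have "s = t" using less[of s] by force
  with s have "f t = R" by simp
  moreover have "f r \<le> R" if "r \<in> {a..t}" for r
    using less[of r] that \<open>f t = R\<close> by (cases "r = t") auto
  ultimately show ?thesis using tS(1) by blast
qed

lemma last_level:
  fixes f :: "real \<Rightarrow> real"
  assumes "continuous_on {a..b} f" "a \<le> b" "f b \<le> R" "R \<le> f a"
  shows "\<exists>t\<in>{a..b}. f t = R \<and> (\<forall>s\<in>{t..b}. f s \<le> R)"
proof -
  have "continuous_on {-b..-a} (\<lambda>s. f (- s))"
    by (rule continuous_on_compose2[OF assms(1)]) (auto intro: continuous_intros)
  from first_level[OF this, of R] obtain t where
    t: "t \<in> {-b..-a}" "f (- t) = R" "\<And>s. s \<in> {-b..t} \<Longrightarrow> f (- s) \<le> R"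
    using assms by auto
  have "f s \<le> R" if "s \<in> {- t..b}" for s using t(3)[of "- s"] that by auto
  then show ?thesis using t by (intro bexI[of _ "- t"]) auto
qed

text \<open>A metric \<open>d\<close> that behaves like the quasihyperbolic metric of a convex domain in which \<open>D\<close>
  is comparable to the distance to the boundary. The square root could be any sublinear
  function.\<close>

locale quasihyperbolic = Metric_space M d for M :: "'a::metric_space set" and d +
  fixes D :: "'a \<Rightarrow> real" and h K C :: real
  assumes const_pos: "0 < h" "0 < K" "0 < C"
    and D_pos: "u \<in> M \<Longrightarrow> 0 < D u"
    and D_ratio: "u \<in> M \<Longrightarrow> v \<in> M \<Longrightarrow> D v \<le> D u * exp (d u v)"
    and dist_le_local: "u \<in> M \<Longrightarrow> v \<in> M \<Longrightarrow> d u v \<le> h \<Longrightarrow> dist u v \<le> K * D u * d u v"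
    and d_le_sqrt: "u \<in> M \<Longrightarrow> v \<in> M \<Longrightarrow> 0 < R \<Longrightarrow> R \<le> D u \<Longrightarrow> R \<le> D v \<Longrightarrow>
      d u v \<le> C * sqrt (dist u v / R)"
begin

text \<open>A unit speed geodesic on an arbitrary parameter interval, so that subarcs keep their
  parameters.\<close>

definition arc :: "(real \<Rightarrow> 'a) \<Rightarrow> real \<Rightarrow> real \<Rightarrow> bool" where
  "arc g a b \<longleftrightarrow> a \<le> b \<and> (\<forall>s\<in>{a..b}. g s \<in> M) \<and> (\<forall>s\<in>{a..b}. \<forall>t\<in>{a..b}. d (g s) (g t) = \<bar>s - t\<bar>)"

lemma arcD:
  assumes "arc g a b"
  shows "a \<le> b" "s \<in> {a..b} \<Longrightarrow> g s \<in> M"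
    "s \<in> {a..b} \<Longrightarrow> t \<in> {a..b} \<Longrightarrow> d (g s) (g t) = \<bar>s - t\<bar>"
  using assms unfolding arc_def by blast+

lemma arc_subset:
  assumes "arc g a b" "a \<le> a'" "a' \<le> b'" "b' \<le> b"
  shows "arc g a' b'"
  using assms unfolding arc_def by auto

lemma arc_reverse:
  assumes "arc g a b"
  shows "arc (\<lambda>s. g (a + b - s)) a b"
  unfolding arc_def
proof (intro conjI ballI)
  fix s t assume st: "s \<in> {a..b}" "t \<in> {a..b}"
  show "d (g (a + b - s)) (g (a + b - t)) = \<bar>s - t\<bar>"
    using arcD(3)[OF assms, of "a + b - s" "a + b - t"] st by auto
qed (use arcD[OF assms] in auto)

lemma arc_continuous:
  assumes "arc g a b"
  shows "continuous_on {a..b} (\<lambda>s. D (g s))"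
proof -
  have "ln (D (g t)) \<le> ln (D (g s)) + \<bar>s - t\<bar>" if "s \<in> {a..b}" "t \<in> {a..b}" for s t
  proof -
    note gM = arcD(2)[OF assms that(1)] arcD(2)[OF assms that(2)]
    have "ln (D (g t)) \<le> ln (D (g s) * exp (d (g s) (g t)))"
      using D_ratio[OF gM] D_pos[OF gM(1)] D_pos[OF gM(2)] by (subst ln_le_cancel_iff) auto
    also have "\<dots> = ln (D (g s)) + \<bar>s - t\<bar>"
      using D_pos[OF gM(1)] arcD(3)[OF assms that] by (simp add: ln_mult)
    finally show ?thesis .
  qed
  then have "\<bar>ln (D (g s)) - ln (D (g t))\<bar> \<le> \<bar>s - t\<bar>" if "s \<in> {a..b}" "t \<in> {a..b}" for s t
    using that by (smt (verit, best) abs_minus_commute)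
  then have "1-lipschitz_on {a..b} (\<lambda>s. ln (D (g s)))"
    by (intro lipschitz_onI) (auto simp: dist_real_def)
  then have "continuous_on {a..b} (\<lambda>s. exp (ln (D (g s))))"
    by (intro continuous_on_exp lipschitz_on_continuous_on)
  then show ?thesis
    by (rule continuous_on_eq) (use D_pos arcD(2)[OF assms] in auto)
qed

text \<open>The comparison of the two metrics is only local; the arc is cut into pieces of length at
  most \<open>h\<close>, and the Euclidean distances add up.\<close>

lemma arc_dist_le_length:
  assumes "arc g a b" "\<And>s. s \<in> {a..b} \<Longrightarrow> D (g s) \<le> R"
  shows "dist (g a) (g b) \<le> K * R * (b - a)"
proof -
  have main: "dist (g a) (g b) \<le> K * R * (b - a)"
    if "arc g a b" "\<And>s. s \<in> {a..b} \<Longrightarrow> D (g s) \<le> R" "b - a \<le> real n * h" for n b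
    using that
  proof (induction n arbitrary: b)
    case 0
    then have "a = b" using arcD(1) by force
    then show ?case by simp
  next
    case (Suc n)
    define c where "c = max a (b - h)"
    have ab: "a \<le> b" using Suc.prems arcD by blast
    have c: "a \<le> c" "c \<le> b" "b - c \<le> h" using ab const_pos by (auto simp: c_def)
    have "c - a \<le> real n * h" using Suc.prems(3) const_pos by (auto simp: c_def algebra_simps)
    then have 1: "dist (g a) (g c) \<le> K * R * (c - a)"
      using Suc.IH[of c] arc_subset[OF Suc.prems(1), of a c] Suc.prems(2) c by auto
    have cb: "c \<in> {a..b}" "b \<in> {a..b}" using c by auto
    have dcb: "d (g c) (g b) = b - c" using arcD(3)[OF Suc.prems(1) cb] c by simp
    have "dist (g c) (g b) \<le> K * D (g c) * d (g c) (g b)"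
      using dist_le_local[OF arcD(2)[OF Suc.prems(1) cb(1)] arcD(2)[OF Suc.prems(1) cb(2)]] dcb c by simp
    also have "\<dots> \<le> K * R * d (g c) (g b)"
      using Suc.prems(2)[OF cb(1)] const_pos by (intro mult_right_mono mult_left_mono) auto
    finally have 2: "dist (g c) (g b) \<le> K * R * (b - c)" using dcb by simp
    show ?case using dist_triangle[of "g a" "g b" "g c"] 1 2 by (simp add: algebra_simps)
  qed
  obtain n :: nat where "(b - a) / h \<le> real n" using real_arch_simple by blast
  then have "b - a \<le> real n * h" using const_pos by (simp add: field_simps)
  then show ?thesis using main assms by blast
qed

lemma d_le_if_dist_le:
  assumes "u \<in> M" "v \<in> M" "0 < R" "R \<le> D u" "R \<le> D v" "dist u v \<le> c * R"
  shows "d u v \<le> C * sqrt c"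
proof -
  have "d u v \<le> C * sqrt (dist u v / R)" by (rule d_le_sqrt[OF assms(1-5)])
  also have "\<dots> \<le> C * sqrt c"
    using assms const_pos by (intro mult_left_mono real_sqrt_le_mono) (auto simp: field_simps)
  finally show ?thesis .
qed

text \<open>The constant obtained by solving \<open>e \<le> K * R * C * sqrt (2 * e / R)\<close> for
  \<open>e / R\<close>.\<close>

definition "C0 = 2 * K\<^sup>2 * C\<^sup>2"

lemma C0_pos: "0 < C0"
  using const_pos by (simp add: C0_def)

text \<open>With \<open>e = dist (g a) (g b)\<close> the length \<open>b - a\<close> is at least \<open>e / (K * R)\<close> and at most
  \<open>C * sqrt (2 * e / R)\<close>.\<close>

lemma arc_dist_le_same_level:
  assumes g: "arc g a b" "\<And>s. s \<in> {a..b} \<Longrightarrow> D (g s) \<le> R"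
    and R: "0 < R" "R / 2 \<le> D (g a)" "R / 2 \<le> D (g b)"
  shows "dist (g a) (g b) \<le> C0 * R"
proof -
  define e where "e = dist (g a) (g b)"
  have ab: "a \<in> {a..b}" "b \<in> {a..b}" using arcD(1)[OF g(1)] by auto
  have "b - a = d (g a) (g b)" using arcD(3)[OF g(1) ab] ab by simp
  also have "\<dots> \<le> C * sqrt (e / (R / 2))"
    unfolding e_def using arcD(2)[OF g(1)] ab R by (intro d_le_sqrt) auto
  finally have "K * R * (b - a) \<le> K * R * (C * sqrt (2 * e / R))"
    using const_pos R by (intro mult_left_mono) (auto simp: mult.commute)
  then have e: "e \<le> K * R * C * sqrt (2 * e / R)"
    using arc_dist_le_length[OF g] unfolding e_def by (simp add: mult_ac)
  have e0: "0 \<le> e" by (simp add: e_def)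
  have "e\<^sup>2 \<le> (K * R * C * sqrt (2 * e / R))\<^sup>2" by (rule power_mono[OF e e0])
  also have "\<dots> = (K * R * C)\<^sup>2 * (2 * e / R)" using e0 R by (simp add: power_mult_distrib)
  also have "\<dots> = C0 * R * e" using R by (simp add: C0_def power2_eq_square field_simps)
  finally have "e * e \<le> (C0 * R) * e" by (simp add: power2_eq_square)
  then have "e \<le> C0 * R"
    using e0 C0_pos R by (cases "e = 0") (auto simp: mult_le_cancel_right)
  then show ?thesis by (simp add: e_def)
qed

text \<open>The pieces between the first points of the levels \<open>D (g b) / 2 ^ n\<close> contribute a geometric
  series.\<close>

lemma arc_dist_le_top:
  assumes "arc g a b" "\<And>s. s \<in> {a..b} \<Longrightarrow> D (g s) \<le> D (g b)"
  shows "dist (g a) (g b) \<le> 2 * C0 * D (g b)"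
proof -
  have main: "dist (g a) (g b) \<le> 2 * C0 * D (g b)"
    if "arc g a b" "\<And>s. s \<in> {a..b} \<Longrightarrow> D (g s) \<le> D (g b)" "D (g b) \<le> 2 ^ n * D (g a)" for n b
    using that
  proof (induction n arbitrary: b)
    case 0
    have R: "0 < D (g b)" using D_pos arcD[OF 0(1)] by simp
    have "dist (g a) (g b) \<le> C0 * D (g b)"
      by (rule arc_dist_le_same_level[OF 0(1,2) R]) (use 0 R in auto)
    moreover have "0 < C0 * D (g b)" using C0_pos R by simp
    ultimately show ?case by simp
  next
    case (Suc n)
    have ab: "a \<le> b" using Suc.prems arcD by blast
    have R: "0 < D (g b)" using D_pos arcD[OF Suc.prems(1)] by simp
    show ?case
    proof (cases "D (g b) / 2 \<le> D (g a)")
      case True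
      have "dist (g a) (g b) \<le> C0 * D (g b)"
        by (rule arc_dist_le_same_level[OF Suc.prems(1,2) R]) (use True R in auto)
      moreover have "0 < C0 * D (g b)" using C0_pos R by simp
      ultimately show ?thesis by simp
    next
      case False
      obtain c where c: "c \<in> {a..b}" "D (g c) = D (g b) / 2" "\<And>s. s \<in> {a..c} \<Longrightarrow> D (g s) \<le> D (g b) / 2"
        using first_level[OF arc_continuous[OF Suc.prems(1)] ab, of "D (g b) / 2"] False R by auto
      have "D (g s) \<le> D (g c)" if "s \<in> {a..c}" for s using c(3)[OF that] c(2) by simp
      then have "dist (g a) (g c) \<le> C0 * D (g b)"
        using Suc.IH[OF arc_subset[OF Suc.prems(1)], of c] c Suc.prems(3) by auto
      moreover have "dist (g c) (g b) \<le> C0 * D (g b)"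
        by (rule arc_dist_le_same_level[OF arc_subset[OF Suc.prems(1)] _ R])
          (use c Suc.prems(2) R in auto)
      ultimately show ?thesis using dist_triangle[of "g a" "g b" "g c"] c(2) by simp
    qed
  qed
  have pos: "0 < D (g a)" using D_pos arcD[OF assms(1)] by simp
  obtain n where "D (g b) / D (g a) < 2 ^ n" using real_arch_pow[of 2] by auto
  then have "D (g b) \<le> 2 ^ n * D (g a)" using pos by (simp add: field_simps)
  then show ?thesis using main assms by blast
qed

definition "A0 = 4 * C0"

text \<open>At a maximum of \<open>D\<close> the arc falls into two arcs with the maximum at an end.
  Each contributes \<open>2 * C0\<close>, hence \<open>A0 = 4 * C0\<close>.\<close>

lemma arc_dist_le_level:
  assumes "arc g a b" "\<And>s. s \<in> {a..b} \<Longrightarrow> D (g s) \<le> R"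
  shows "dist (g a) (g b) \<le> A0 * R"
proof -
  have ab: "a \<le> b" using arcD assms by blast
  obtain m where m: "m \<in> {a..b}" "\<And>s. s \<in> {a..b} \<Longrightarrow> D (g s) \<le> D (g m)"
    using continuous_attains_sup[OF compact_Icc _ arc_continuous[OF assms(1)]] ab by auto
  have "dist (g a) (g m) \<le> 2 * C0 * D (g m)"
    by (rule arc_dist_le_top[OF arc_subset[OF assms(1)]]) (use m in auto)
  moreover have "dist (g b) (g m) \<le> 2 * C0 * D (g m)"
    using arc_dist_le_top[OF arc_reverse[OF arc_subset[OF assms(1), of m b]]] m by auto
  ultimately have "dist (g a) (g b) \<le> A0 * D (g m)"
    using dist_triangle2[of "g a" "g b" "g m"] by (simp add: A0_def)
  also have "\<dots> \<le> A0 * R"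
    using assms(2)[OF m(1)] C0_pos by (simp add: A0_def)
  finally show ?thesis .
qed

definition "B0 = A0 * exp (C * sqrt A0 + 1)"

lemma A0_pos: "0 < A0" and B0_pos: "0 < B0"
  using C0_pos by (simp_all add: A0_def B0_def)

text \<open>If both ends are too far from \<open>g v\<close>, then \<open>D\<close> exceeds
  \<open>R = \<kappa> * D (g v)\<close> on both sides of \<open>v\<close>. The subarc around
  \<open>v\<close> between two points of level \<open>R\<close> stays below this level, so its ends
  are close and its length is at most \<open>C * sqrt A0\<close>. But descending from
  \<open>R\<close> to \<open>D (g v)\<close> takes length at least \<open>ln \<kappa>\<close>, and
  \<open>\<kappa>\<close> is chosen to make this larger by 1.\<close>

lemma arc_double_cone:
  assumes g: "arc g a b" and v: "v \<in> {a..b}"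
  shows "dist (g a) (g v) \<le> B0 * D (g v) \<or> dist (g b) (g v) \<le> B0 * D (g v)"
proof (rule ccontr)
  assume neg: "\<not> ?thesis"
  define \<kappa> where "\<kappa> = exp (C * sqrt A0 + 1)"
  define R where "R = \<kappa> * D (g v)"
  have Dv: "0 < D (g v)" using D_pos arcD[OF g] v by simp
  have \<kappa>: "1 < \<kappa>" using const_pos A0_pos by (simp add: \<kappa>_def add_pos_pos)
  have R: "0 < R" "D (g v) \<le> R" using \<kappa> Dv by (simp_all add: R_def)
  have AR: "A0 * R = B0 * D (g v)" by (simp add: R_def B0_def \<kappa>_def)
  have av: "arc g a v" and vb: "arc g v b" using arc_subset[OF g] v by auto
  obtain s1 where s1: "s1 \<in> {a..v}" "R < D (g s1)"
    using arc_dist_le_level[OF av, of R] neg AR by force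
  obtain s2 where s2: "s2 \<in> {v..b}" "R < D (g s2)"
    using arc_dist_le_level[OF vb, of R] neg AR by (force simp: dist_commute)
  have "\<exists>t\<in>{s1..v}. D (g t) = R \<and> (\<forall>s\<in>{t..v}. D (g s) \<le> R)"
    by (rule last_level[OF arc_continuous[OF arc_subset[OF g]]]) (use s1 v R in auto)
  then obtain t1 where t1: "t1 \<in> {s1..v}" "D (g t1) = R" "\<And>s. s \<in> {t1..v} \<Longrightarrow> D (g s) \<le> R"
    by blast
  have "\<exists>t\<in>{v..s2}. D (g t) = R \<and> (\<forall>s\<in>{v..t}. D (g s) \<le> R)"
    by (rule first_level[OF arc_continuous[OF arc_subset[OF g]]]) (use s2 v R in auto)
  then obtain t2 where t2: "t2 \<in> {v..s2}" "D (g t2) = R" "\<And>s. s \<in> {v..t2} \<Longrightarrow> D (g s) \<le> R"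
    by blast
  have tt: "t1 \<in> {a..b}" "t2 \<in> {a..b}" "t1 \<le> v" "v \<le> t2" using t1 t2 s1 s2 v by auto
  have "D (g s) \<le> R" if "s \<in> {t1..t2}" for s
    using t1(3)[of s] t2(3)[of s] that by (cases "s \<le> v") auto
  then have "dist (g t1) (g t2) \<le> A0 * R"
    using arc_dist_le_level[OF arc_subset[OF g, of t1 t2]] tt by auto
  then have "d (g t1) (g t2) \<le> C * sqrt A0"
    using d_le_if_dist_le[of "g t1" "g t2" R A0] arcD(2)[OF g] tt R t1 t2 by auto
  then have "t2 - t1 \<le> C * sqrt A0" using arcD(3)[OF g tt(1,2)] tt by simp
  moreover have "R \<le> D (g v) * exp (v - t1)"
    using D_ratio[of "g v" "g t1"] arcD(2)[OF g] arcD(3)[OF g v tt(1)] tt v t1(2) by simp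
  then have "\<kappa> \<le> exp (v - t1)" using Dv by (simp add: R_def mult.commute)
  ultimately show False using tt unfolding \<kappa>_def by simp
qed

lemma segment_arc:
  assumes "geodesic_segment M d x y S"
  obtains g L where "arc g 0 L" "g 0 = x" "g L = y" "S = g ` {0..L}"
proof -
  obtain g L where "0 \<le> L" "g 0 = x" "g L = y" "S = g ` {0..L}" "S \<subseteq> M"
    "\<forall>s\<in>{0..L}. \<forall>t\<in>{0..L}. d (g s) (g t) = \<bar>s - t\<bar>"
    using assms unfolding geodesic_segment_def by blast
  then show ?thesis by (intro that[of g L]) (auto simp: arc_def)
qed

section \<open>Thinness of triangles\<close>

lemma segment_reaches_level:
  assumes S: "geodesic_segment M d x y S" and w: "w \<in> S" "R \<le> D w" and R: "0 < R"
  shows "\<exists>w\<in>S. R \<le> D w \<and> dist x w \<le> A0 * R"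
proof (cases "R \<le> D x")
  case True
  then show ?thesis using geodesic_segment_ends(1)[OF S] A0_pos R by (intro bexI[of _ x]) auto
next
  case False
  obtain g L where g: "arc g 0 L" "g 0 = x" "g L = y" "S = g ` {0..L}" using segment_arc[OF S] .
  obtain s where s: "s \<in> {0..L}" "w = g s" using w g(4) by blast
  obtain t where t: "t \<in> {0..s}" "D (g t) = R" "\<And>r. r \<in> {0..t} \<Longrightarrow> D (g r) \<le> R"
    using first_level[OF arc_continuous[OF arc_subset[OF g(1), of 0 s]], of R] s w False g(2) by auto
  have "dist (g 0) (g t) \<le> A0 * R"
    using arc_dist_le_level[OF arc_subset[OF g(1), of 0 t]] t s by auto
  then show ?thesis using t s g by (intro bexI[of _ "g t"]) auto
qed

lemma segment_below_level:
  assumes S: "geodesic_segment M d x y S" and "\<And>w. w \<in> S \<Longrightarrow> D w \<le> R" and w: "w \<in> S"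
  shows "dist x w \<le> A0 * R"
proof -
  obtain g L where g: "arc g 0 L" "g 0 = x" "g L = y" "S = g ` {0..L}" using segment_arc[OF S] .
  obtain s where s: "s \<in> {0..L}" "w = g s" using w g(4) by blast
  have "dist (g 0) (g s) \<le> A0 * R"
    by (rule arc_dist_le_level[OF arc_subset[OF g(1)]]) (use s assms(2) g(4) in auto)
  then show ?thesis using s g by simp
qed

lemma segment_max:
  assumes S: "geodesic_segment M d x y S"
  shows "\<exists>m\<in>S. \<forall>w\<in>S. D w \<le> D m"
proof -
  obtain g L where g: "arc g 0 L" "g 0 = x" "g L = y" "S = g ` {0..L}" using segment_arc[OF S] .
  show ?thesis
    using continuous_attains_sup[OF compact_Icc _ arc_continuous[OF g(1)]] arcD(1)[OF g(1)] g(4) by auto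
qed

text \<open>One term for a side that reaches the level of \<open>v\<close>, two for the case in
  which both other sides stay below it.\<close>

definition "thin_const = C * sqrt (B0 + 2 * A0) + C * sqrt (4 * A0) + C * sqrt (3 * A0)"

lemma thin_const_ge:
  shows "C * sqrt (B0 + 2 * A0) \<le> thin_const" and "C * sqrt (4 * A0) + C * sqrt (3 * A0) \<le> thin_const"
  using const_pos A0_pos B0_pos by (simp_all add: thin_const_def add_nonneg_nonneg)

text \<open>If one of the other sides reaches the level \<open>R\<close> of \<open>v\<close>, it
  does so at Euclidean distance comparable to \<open>R\<close> from \<open>x\<close>, hence from
  \<open>v\<close>. Points of level at least \<open>R\<close> at such a distance are boundedly close
  for \<open>d\<close>.\<close>

lemma thin_near_end:
  assumes S: "geodesic_segment M d x y S" "geodesic_segment M d x z S1" "geodesic_segment M d z y S2"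
    and v: "v \<in> S" "dist x v \<le> B0 * D v"
  shows "\<exists>w\<in>S1 \<union> S2. d v w \<le> thin_const"
proof -
  define R where "R = D v"
  have SM: "S \<subseteq> M" "S1 \<subseteq> M" "S2 \<subseteq> M" using S geodesic_segment_ends(3) by (metis, metis, metis)
  have R: "0 < R" using v SM D_pos by (auto simp: R_def)
  have close: "d v w \<le> thin_const" if "w \<in> M" "R \<le> D w" "dist v w \<le> (B0 + 2 * A0) * R" for w
    using d_le_if_dist_le[of v w R "B0 + 2 * A0"] that v SM R thin_const_ge(1) by (auto simp: R_def)
  consider (1) "\<exists>w\<in>S1. R \<le> D w" | (2) "\<forall>w\<in>S1. D w < R" "\<exists>w\<in>S2. R \<le> D w"
    | (3) "\<forall>w\<in>S1. D w < R" "\<forall>w\<in>S2. D w < R"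
    by fastforce
  then show ?thesis
  proof cases
    case 1
    then obtain w where w: "w \<in> S1" "R \<le> D w" "dist x w \<le> A0 * R"
      using segment_reaches_level[OF S(2) _ _ R] by blast
    have "0 < A0 * R" using A0_pos R by simp
    then have "dist v w \<le> (B0 + 2 * A0) * R"
      using dist_triangle3[of v w x] w v by (simp add: R_def algebra_simps)
    then show ?thesis using close[of w] w SM by blast
  next
    case 2
    then obtain w where w: "w \<in> S2" "R \<le> D w" "dist z w \<le> A0 * R"
      using segment_reaches_level[OF S(3) _ _ R] by blast
    have "dist x z \<le> A0 * R"
      by (rule segment_below_level[OF S(2)]) (use 2 geodesic_segment_ends(2)[OF S(2)] in \<open>auto intro: less_imp_le\<close>)
    then have "dist v w \<le> (B0 + 2 * A0) * R"
      using dist_triangle3[of v w x] dist_triangle[of x w z] w v by (simp add: R_def algebra_simps)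
    then show ?thesis using close[of w] w SM by blast
  next
    case 3
    \<comment> \<open>Now both other sides are shallow, with maximal level \<open>\<mu>\<close> at
      \<open>w\<close>, and the whole configuration of vertices has size comparable to
      \<open>\<mu>\<close>. The side \<open>S\<close> rises above \<open>\<mu>\<close> around
      \<open>v\<close> and returns to it; the two crossing points are close for \<open>d\<close>, so
      \<open>v\<close>, which lies between them on a geodesic, is close to both.\<close>
    obtain m1 where m1: "m1 \<in> S1" "\<And>w. w \<in> S1 \<Longrightarrow> D w \<le> D m1" using segment_max[OF S(2)] by blast
    obtain m2 where m2: "m2 \<in> S2" "\<And>w. w \<in> S2 \<Longrightarrow> D w \<le> D m2" using segment_max[OF S(3)] by blast
    define w where "w = (if D m1 \<le> D m2 then m2 else m1)"
    define \<mu> where "\<mu> = D w"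
    have w: "w \<in> S1 \<union> S2" using m1 m2 by (auto simp: w_def)
    have \<mu>1: "D u \<le> \<mu>" if "u \<in> S1" for u using m1(2)[OF that] by (auto simp: \<mu>_def w_def)
    have \<mu>2: "D u \<le> \<mu>" if "u \<in> S2" for u using m2(2)[OF that] by (auto simp: \<mu>_def w_def)
    have \<mu>: "0 < \<mu>" "\<mu> < R" using w SM D_pos 3 by (auto simp: \<mu>_def)
    have A\<mu>: "0 < A0 * \<mu>" using A0_pos \<mu> by simp
    have d1: "dist x u \<le> A0 * \<mu>" if "u \<in> S1" for u by (rule segment_below_level[OF S(2) \<mu>1 that])
    have d2: "dist z u \<le> A0 * \<mu>" if "u \<in> S2" for u by (rule segment_below_level[OF S(3) \<mu>2 that])
    note ends = geodesic_segment_ends(1,2)[OF S(2)] geodesic_segment_ends(1,2)[OF S(3)]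
    have xw: "dist x w \<le> 2 * A0 * \<mu>"
      using w d1[of w] d2[of w] d1[OF ends(2)] dist_triangle[of x w z] A\<mu> by auto
    have xy: "dist x y \<le> 2 * A0 * \<mu>"
      using d1[OF ends(2)] d2[OF ends(4)] dist_triangle[of x y z] by simp
    obtain g L where g: "arc g 0 L" "g 0 = x" "g L = y" "S = g ` {0..L}" using segment_arc[OF S(1)] .
    obtain s where s: "s \<in> {0..L}" "v = g s" using v g(4) by blast
    have Dv: "\<mu> \<le> D (g s)" using \<mu> s by (simp add: R_def)
    obtain t1 where t1: "t1 \<in> {0..s}" "D (g t1) = \<mu>" "\<And>r. r \<in> {0..t1} \<Longrightarrow> D (g r) \<le> \<mu>"
      using first_level[OF arc_continuous[OF arc_subset[OF g(1), of 0 s]] _ _ Dv] s \<mu>1[OF ends(1)] g(2) by auto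
    obtain t2 where t2: "t2 \<in> {s..L}" "D (g t2) = \<mu>" "\<And>r. r \<in> {t2..L} \<Longrightarrow> D (g r) \<le> \<mu>"
      using last_level[OF arc_continuous[OF arc_subset[OF g(1), of s L]] _ _ Dv] s \<mu>2[OF ends(4)] g(3) by auto
    have x1: "dist x (g t1) \<le> A0 * \<mu>"
      using arc_dist_le_level[OF arc_subset[OF g(1), of 0 t1]] t1 s g(2) by auto
    have y2: "dist y (g t2) \<le> A0 * \<mu>"
      using arc_dist_le_level[OF arc_subset[OF g(1), of t2 L]] t2 s g(3) by (auto simp: dist_commute)
    have gM: "g t1 \<in> M" "g t2 \<in> M" "v \<in> M" "w \<in> M"
      using arcD(2)[OF g(1)] t1 t2 s w SM by auto
    have "dist (g t1) (g t2) \<le> 4 * A0 * \<mu>"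
      using x1 y2 xy dist_triangle3[of "g t1" "g t2" x] dist_triangle[of x "g t2" y] by simp
    then have "d (g t1) (g t2) \<le> C * sqrt (4 * A0)"
      using d_le_if_dist_le[OF gM(1,2) \<mu>(1)] t1 t2 by simp
    moreover have "d v (g t1) \<le> d (g t1) (g t2)"
      using arcD(3)[OF g(1), of s t1] arcD(3)[OF g(1), of t1 t2] t1 t2 s by auto
    moreover have "dist (g t1) w \<le> 3 * A0 * \<mu>"
      using x1 xw dist_triangle3[of "g t1" w x] by simp
    then have "d (g t1) w \<le> C * sqrt (3 * A0)"
      using d_le_if_dist_le[OF gM(1,4) \<mu>(1)] t1 by (simp add: \<mu>_def)
    ultimately have "d v w \<le> thin_const"
      using triangle[OF gM(3,1,4)] thin_const_ge(2) by simp
    then show ?thesis using w by blast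
  qed
qed

lemma thin_side:
  assumes S: "geodesic_segment M d x y S" "geodesic_segment M d x z S1" "geodesic_segment M d z y S2"
  shows "S \<subseteq> metric_nbhd M d (thin_const + 1) (S1 \<union> S2)"
proof
  fix v assume v: "v \<in> S"
  obtain g L where g: "arc g 0 L" "g 0 = x" "g L = y" "S = g ` {0..L}" using segment_arc[OF S(1)] .
  obtain s where s: "s \<in> {0..L}" "v = g s" using v g(4) by blast
  consider "dist x v \<le> B0 * D v" | "dist y v \<le> B0 * D v"
    using arc_double_cone[OF g(1) s(1)] g s by auto
  then have "\<exists>w\<in>S1 \<union> S2. d v w \<le> thin_const"
  proof cases
    case 1
    then show ?thesis by (rule thin_near_end[OF S v])
  next
    case 2
    then show ?thesis
      using thin_near_end[OF geodesic_segment_sym[OF S(1)] geodesic_segment_sym[OF S(3)]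
          geodesic_segment_sym[OF S(2)] v] by (simp add: Un_commute)
  qed
  moreover have "v \<in> M" using v geodesic_segment_ends(3)[OF S(1)] by blast
  ultimately show "v \<in> metric_nbhd M d (thin_const + 1) (S1 \<union> S2)"
    unfolding metric_nbhd_def by force
qed

lemma gromov_hyperbolic:
  assumes "proper_geodesic_space M d"
  shows "gromov_hyperbolic M d"
  unfolding gromov_hyperbolic_def
proof (intro conjI exI allI impI assms)
  show "0 < thin_const + 1"
    using thin_const_ge(1) const_pos A0_pos B0_pos
    by (smt (verit) mult_nonneg_nonneg real_sqrt_ge_zero)
  fix x y z X Y Z
  assume "geodesic_segment M d x y X \<and> geodesic_segment M d y z Y \<and> geodesic_segment M d z x Z"
  then have S: "geodesic_segment M d x y X" "geodesic_segment M d y z Y" "geodesic_segment M d z x Z"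
    by auto
  note S' = S[THEN geodesic_segment_sym]
  show "X \<subseteq> metric_nbhd M d (thin_const + 1) (Y \<union> Z)"
    using thin_side[OF S(1) S'(3) S'(2)] by (simp add: Un_commute)
  show "Y \<subseteq> metric_nbhd M d (thin_const + 1) (Z \<union> X)"
    using thin_side[OF S(2) S'(1) S'(3)] by (simp add: Un_commute)
  show "Z \<subseteq> metric_nbhd M d (thin_const + 1) (X \<union> Y)"
    using thin_side[OF S(3) S'(2) S'(1)] by (simp add: Un_commute)
qed

end

subsection \<open>Bodies with spacelike boundary\<close>

lemma lightlike_trev: "lightlike (trev v) \<longleftrightarrow> lightlike v"
  by (auto simp: lightlike_def mink_def trev_def zero_prod_def prod_eq_iff)

lemma proj_lightlike_geodesic_trev:
  assumes "proj_lightlike_geodesic \<Omega> \<gamma>"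
  shows "proj_lightlike_geodesic (trev ` \<Omega>) (\<lambda>s. trev (\<gamma> s))"
proof -
  obtain x v h where g: "lightlike v" "homography_on {-1<..<1} h"
      "\<And>s. s \<in> {-1<..<1} \<Longrightarrow> \<gamma> s = x + h s *\<^sub>R v"
    and in_dom: "\<gamma> ` {-1<..<1} \<subseteq> \<Omega>"
    using assms unfolding proj_lightlike_geodesic_def by blast
  have "trev (\<gamma> s) = trev x + h s *\<^sub>R trev v" if "s \<in> {-1<..<1}" for s
    using g(3)[OF that] by (simp add: linear_add[OF linear_trev] linear_scale[OF linear_trev])
  then show ?thesis
    unfolding proj_lightlike_geodesic_def using g(1,2) in_dom lightlike_trev by blast
qed

lemma null_path_trev: "null_path \<Omega> x y T \<Longrightarrow> null_path (trev ` \<Omega>) (trev x) (trev y) T"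
proof (induction rule: null_path.induct)
  case (step \<gamma> s t)
  then show ?case using null_path.step[OF proj_lightlike_geodesic_trev] by blast
next
  case (cons \<gamma> s t y T)
  then show ?case using null_path.cons[OF proj_lightlike_geodesic_trev] by blast
qed

lemma markowitz_dist_trev: "markowitz_dist (trev ` \<Omega>) (trev x) (trev y) = markowitz_dist \<Omega> x y"
proof -
  have "null_path (trev ` \<Omega>) (trev x) (trev y) = null_path \<Omega> x y"
    using null_path_trev[of \<Omega> x y] null_path_trev[of "trev ` \<Omega>" "trev x" "trev y"] by (intro ext) auto
  then show ?thesis by (simp add: markowitz_dist_eq mem_trev_image)
qed

lemma lightlike_norm:
  assumes "lightlike v"
  shows "norm (snd v) = \<bar>fst v\<bar>"
proof -
  have "(norm (snd v))\<^sup>2 = (fst v)\<^sup>2"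
    using assms by (simp add: lightlike_def mink_def dot_square_norm power2_eq_square)
  then show ?thesis by (metis abs_norm_cancel real_sqrt_abs)
qed

text \<open>The subgraph of a supergradient contains \<open>\<Omega>\<close>, so that its defect is an affine function
  positive on \<open>\<Omega>\<close>.\<close>

definition supporting :: "'n::finite minkowski set \<Rightarrow> real ^ 'n \<Rightarrow> real ^ 'n \<Rightarrow> 'n minkowski \<Rightarrow> real" where
  "supporting \<Omega> p \<xi> x = upper \<Omega> p + \<xi> \<bullet> (snd x - p) - fst x"

lemma supporting_affine:
  "supporting \<Omega> p \<xi> (x + r *\<^sub>R v) = supporting \<Omega> p \<xi> x + (\<xi> \<bullet> snd v - fst v) * r"
  by (simp add: supporting_def inner_diff_right inner_add_right algebra_simps)

context causal_body
begin

lemma supporting_pos: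
  assumes "\<And>q. upper \<Omega> q \<le> upper \<Omega> p + \<xi> \<bullet> (q - p)" "x \<in> \<Omega>"
  shows "0 < supporting \<Omega> p \<xi> x"
  using fst_less_upper[OF assms(2)] assms(1)[of "snd x"] by (simp add: supporting_def)

section \<open>Metric properties shared by all causally convex bodies\<close>

lemma markowitz_dist_self: "x \<in> \<Omega> \<Longrightarrow> markowitz_dist \<Omega> x x \<le> 0"
  using markowitz_dist_segment_le[of "depth \<Omega> x" x x] by (simp add: mem_iff_depth)

lemma markowitz_dist_commute: "markowitz_dist \<Omega> x y = markowitz_dist \<Omega> y x"
proof -
  have "null_path \<Omega> x y = null_path \<Omega> y x" using null_path_sym by blast
  then show ?thesis by (simp add: markowitz_dist_eq conj_commute)
qed

lemma markowitz_dist_nonneg: "0 \<le> markowitz_dist \<Omega> x y"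
proof (cases "x \<in> \<Omega> \<and> y \<in> \<Omega>")
  case True
  then show ?thesis using null_path_exists[of x y] markowitz_dist_ge null_path_nonneg by metis
qed (auto simp: markowitz_dist_eq)

lemma markowitz_dist_triangle:
  assumes "x \<in> \<Omega>" "y \<in> \<Omega>" "z \<in> \<Omega>"
  shows "markowitz_dist \<Omega> x z \<le> markowitz_dist \<Omega> x y + markowitz_dist \<Omega> y z"
proof (rule field_le_epsilon)
  fix e :: real assume e: "0 < e"
  obtain T0 T0' where "null_path \<Omega> x y T0" "null_path \<Omega> y z T0'"
    using null_path_exists assms by metis
  then obtain T T' where "null_path \<Omega> x y T" "T < markowitz_dist \<Omega> x y + e / 2"
    "null_path \<Omega> y z T'" "T' < markowitz_dist \<Omega> y z + e / 2"
    using markowitz_dist_approx half_gt_zero[OF e] by metis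
  then show "markowitz_dist \<Omega> x z \<le> markowitz_dist \<Omega> x y + markowitz_dist \<Omega> y z + e"
    using markowitz_dist_le[OF null_path_trans[of \<Omega> x y T z T']] by simp
qed

text \<open>The supporting function based at \<open>snd x\<close> equals the gap at \<open>x\<close>
  and dominates the gap at \<open>y\<close>, so its growth bounds that of the gap.\<close>

lemma upper_gap_ratio:
  assumes "x \<in> \<Omega>" "y \<in> \<Omega>"
  shows "upper \<Omega> (snd y) - fst y \<le> (upper \<Omega> (snd x) - fst x) * exp (markowitz_dist \<Omega> x y)"
proof -
  obtain \<xi> where \<xi>: "\<And>q. upper \<Omega> q \<le> upper \<Omega> (snd x) + \<xi> \<bullet> (q - snd x)"
    using supergradient by blast
  define F where "F = supporting \<Omega> (snd x) \<xi>"
  have pos: "0 < F z" if "z \<in> \<Omega>" for z unfolding F_def by (rule supporting_pos[OF \<xi> that])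
  have aff: "\<exists>\<beta>. \<forall>r. F (x + r *\<^sub>R v) = F x + \<beta> * r" for x v
    unfolding F_def using supporting_affine by blast
  have "ln (F y / F x) \<le> markowitz_dist \<Omega> x y"
    by (rule ln_ratio_le_markowitz_dist[OF assms pos aff])
  then have "exp (ln (F y / F x)) \<le> exp (markowitz_dist \<Omega> x y)" by simp
  then have "F y \<le> F x * exp (markowitz_dist \<Omega> x y)"
    using pos[OF assms(1)] pos[OF assms(2)] by (simp add: field_simps)
  moreover have "F x = upper \<Omega> (snd x) - fst x" "upper \<Omega> (snd y) - fst y \<le> F y"
    using \<xi>[of "snd y"] by (simp_all add: F_def supporting_def)
  ultimately show ?thesis by simp
qed

lemma projection_open: "open (snd ` \<Omega>)"
  using open_body by (rule open_image_snd)

text \<open>A lightlike step changes the supporting function based at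
  \<open>snd (\<gamma> s)\<close> by at least \<open>1 - k\<close> times the elapsed time, and the
  ratio bound allows a change of at most \<open>exp (rho_I s t) - 1\<close> times its initial value,
  the gap.\<close>

lemma upper_gap_step:
  assumes k: "0 \<le> k" and lip: "\<And>p q. p \<in> snd ` \<Omega> \<Longrightarrow> q \<in> snd ` \<Omega> \<Longrightarrow> upper \<Omega> p \<le> upper \<Omega> q + k * dist p q"
    and \<gamma>: "proj_lightlike_geodesic \<Omega> \<gamma>" "s \<in> {-1<..<1}" "t \<in> {-1<..<1}"
  shows "(1 - k) * \<bar>fst (\<gamma> t) - fst (\<gamma> s)\<bar>
    \<le> (upper \<Omega> (snd (\<gamma> s)) - fst (\<gamma> s)) * (exp (rho_I s t) - 1)"
proof -
  let ?a = "\<gamma> s" and ?b = "\<gamma> t"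
  obtain x v h where g: "lightlike v" "\<And>s. s \<in> {-1<..<1} \<Longrightarrow> \<gamma> s = x + h s *\<^sub>R v"
    and in_dom: "\<And>s. s \<in> {-1<..<1} \<Longrightarrow> \<gamma> s \<in> \<Omega>"
    using \<gamma>(1) unfolding proj_lightlike_geodesic_def by (auto simp: image_subset_iff)
  define p where "p = snd ?a"
  have p: "p \<in> snd ` \<Omega>" using in_dom[OF \<gamma>(2)] by (simp add: p_def)
  obtain \<xi> where \<xi>: "\<And>q. upper \<Omega> q \<le> upper \<Omega> p + \<xi> \<bullet> (q - p)" using supergradient by blast
  have \<xi>k: "norm \<xi> \<le> k"
  proof -
    obtain e where e: "0 < e" "ball p e \<subseteq> snd ` \<Omega>"
      using projection_open p open_contains_ball by blast
    \<comment> \<open>The Lipschitz bound holds over the projection only, so the test step against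
      \<open>\<xi>\<close> must stay in the ball. The summand 1 avoids a division by zero.\<close>
    define N where "N = norm \<xi> + 1"
    define r where "r = e / 2 / N"
    have n: "0 < N" by (simp add: N_def add_nonneg_pos)
    have r: "0 < r" using e n by (simp add: r_def)
    have "dist p (p - r *\<^sub>R \<xi>) = r * norm \<xi>" using r by (simp add: dist_norm)
    also have "\<dots> \<le> r * N" using r by (simp add: N_def)
    also have "\<dots> = e / 2" using n by (simp add: r_def)
    also have "\<dots> < e" using e(1) by simp
    finally have "p - r *\<^sub>R \<xi> \<in> snd ` \<Omega>" using e by auto
    then show ?thesis
      using supergradient_norm_le[OF \<xi> r k] lip[OF p] by blast
  qed
  define F where "F = supporting \<Omega> p \<xi>"
  have pos: "0 < F z" if "z \<in> \<Omega>" for z unfolding F_def by (rule supporting_pos[OF \<xi> that])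
  have aff: "\<exists>\<beta>. \<forall>r. F (x + r *\<^sub>R v) = F x + \<beta> * r" for x v
    unfolding F_def using supporting_affine by blast
  have ratio: "F ?b \<le> exp (rho_I s t) * F ?a" "F ?a \<le> exp (rho_I s t) * F ?b"
    using lightlike_affine_ratio[OF pos aff \<gamma>] lightlike_affine_ratio[OF pos aff \<gamma>(1,3,2)]
      rho_I_commute[OF \<gamma>(2,3)] by simp_all
  define m where "m = h t - h s"
  have b: "?b = ?a + m *\<^sub>R v" using g(2) \<gamma> by (simp add: m_def scaleR_diff_left)
  have "\<bar>\<xi> \<bullet> snd v\<bar> \<le> norm \<xi> * \<bar>fst v\<bar>"
    using Cauchy_Schwarz_ineq2[of \<xi> "snd v"] lightlike_norm[OF g(1)] by simp
  also have "\<dots> \<le> k * \<bar>fst v\<bar>" by (rule mult_right_mono[OF \<xi>k]) simp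
  finally have "(1 - k) * \<bar>fst v\<bar> \<le> \<bar>\<xi> \<bullet> snd v - fst v\<bar>"
    using abs_triangle_ineq2[of "fst v" "\<xi> \<bullet> snd v"] by (simp add: algebra_simps abs_minus_commute)
  then have "\<bar>m\<bar> * ((1 - k) * \<bar>fst v\<bar>) \<le> \<bar>m\<bar> * \<bar>\<xi> \<bullet> snd v - fst v\<bar>" by (rule mult_left_mono) simp
  then have diff: "(1 - k) * \<bar>fst ?b - fst ?a\<bar> \<le> \<bar>F ?b - F ?a\<bar>"
    unfolding b F_def supporting_affine by (simp add: abs_mult mult_ac)
  have Fa: "F ?a = upper \<Omega> (snd ?a) - fst ?a" by (simp add: F_def supporting_def p_def)
  have "\<bar>F ?b - F ?a\<bar> \<le> F ?a * (exp (rho_I s t) - 1)"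
  proof (cases "F ?a \<le> F ?b")
    case True
    then show ?thesis using ratio(1) by (simp add: algebra_simps)
  next
    case False
    have "F ?b * (exp (rho_I s t) - 1) \<le> F ?a * (exp (rho_I s t) - 1)"
      using False rho_I_nonneg[of s t] by (intro mult_right_mono) auto
    then show ?thesis using ratio(2) False by (simp add: algebra_simps)
  qed
  then show ?thesis using diff Fa by simp
qed

interpretation rev: causal_body "trev ` \<Omega>"
  by (rule causal_body_trev) (rule causal_body_axioms)

lemma depth_ratio:
  assumes "x \<in> \<Omega>" "y \<in> \<Omega>"
  shows "depth \<Omega> y \<le> depth \<Omega> x * exp (markowitz_dist \<Omega> x y)"
proof -
  have "upper \<Omega> (snd y) - fst y \<le> (upper \<Omega> (snd x) - fst x) * exp (markowitz_dist \<Omega> x y)"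
    by (rule upper_gap_ratio[OF assms])
  moreover have "fst y - lower \<Omega> (snd y) \<le> (fst x - lower \<Omega> (snd x)) * exp (markowitz_dist \<Omega> x y)"
    using rev.upper_gap_ratio[of "trev x" "trev y"] assms
    by (simp add: mem_trev_image markowitz_dist_trev upper_trev)
  ultimately show ?thesis by (auto simp: depth_def min_def)
qed

end

text \<open>The bound \<open>k\<close> concerns the projection only; outside it the extensions may
  have slope 1. As the projection is open, supergradients at its points still have norm at most
  \<open>k\<close>.\<close>

locale spacelike_body = causal_body \<Omega> for \<Omega> :: "'n::finite minkowski set" +
  fixes k :: real
  assumes k: "0 \<le> k" "k < 1"
    and upper_lip: "\<And>p q. p \<in> snd ` \<Omega> \<Longrightarrow> q \<in> snd ` \<Omega> \<Longrightarrow> upper \<Omega> p \<le> upper \<Omega> q + k * dist p q"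
    and lower_lip: "\<And>p q. p \<in> snd ` \<Omega> \<Longrightarrow> q \<in> snd ` \<Omega> \<Longrightarrow> lower \<Omega> p \<le> lower \<Omega> q + k * dist p q"
begin

interpretation rev: causal_body "trev ` \<Omega>"
  by (rule causal_body_trev) (rule causal_body_axioms)

text \<open>Rounded up to a natural number for the Bernoulli inequality. The factor 4 is 2 from
  \<open>dist \<le> 2 * m\<close> for a lightlike step of duration \<open>m\<close>, and 2 from the
  Lipschitz constant of \<open>depth\<close>.\<close>

definition slope_const :: nat where
  "slope_const = nat \<lceil>4 / (1 - k)\<rceil>"

lemma slope_const: "4 / (1 - k) \<le> real slope_const" "1 \<le> slope_const"
proof -
  have "0 < 4 / (1 - k)" using k by simp
  then have "0 < \<lceil>4 / (1 - k)\<rceil>" by (simp only: zero_less_ceiling)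
  then have "0 < slope_const" unfolding slope_const_def by (simp only: zero_less_nat_eq)
  then show "1 \<le> slope_const" by linarith
  show "4 / (1 - k) \<le> real slope_const" unfolding slope_const_def by (rule of_nat_ceiling)
qed

lemma dist_step:
  assumes \<gamma>: "proj_lightlike_geodesic \<Omega> \<gamma>" "s \<in> {-1<..<1}" "t \<in> {-1<..<1}"
  shows "2 * dist (\<gamma> s) (\<gamma> t) \<le> real slope_const * depth \<Omega> (\<gamma> s) * (exp (rho_I s t) - 1)"
proof -
  obtain x v h where g: "lightlike v" "\<And>s. s \<in> {-1<..<1} \<Longrightarrow> \<gamma> s = x + h s *\<^sub>R v"
    and in_dom: "\<And>s. s \<in> {-1<..<1} \<Longrightarrow> \<gamma> s \<in> \<Omega>"
    using \<gamma>(1) unfolding proj_lightlike_geodesic_def by (auto simp: image_subset_iff)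
  define m where "m = \<bar>fst (\<gamma> t) - fst (\<gamma> s)\<bar>"
  define E where "E = exp (rho_I s t) - 1"
  have E: "0 \<le> E" using rho_I_nonneg by (simp add: E_def)
  have 1: "(1 - k) * m \<le> (upper \<Omega> (snd (\<gamma> s)) - fst (\<gamma> s)) * E"
    unfolding m_def E_def by (rule upper_gap_step[OF k(1) upper_lip \<gamma>])
  have "(1 - k) * \<bar>fst (trev (\<gamma> t)) - fst (trev (\<gamma> s))\<bar>
    \<le> (upper (trev ` \<Omega>) (snd (trev (\<gamma> s))) - fst (trev (\<gamma> s))) * (exp (rho_I s t) - 1)"
  proof (rule rev.upper_gap_step[OF k(1) _ proj_lightlike_geodesic_trev[OF \<gamma>(1)] \<gamma>(2,3)])
    fix p q assume "p \<in> snd ` trev ` \<Omega>" "q \<in> snd ` trev ` \<Omega>"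
    then show "upper (trev ` \<Omega>) p \<le> upper (trev ` \<Omega>) q + k * dist p q"
      using lower_lip[of q p] by (simp add: image_image upper_trev dist_commute)
  qed
  then have 2: "(1 - k) * m \<le> (fst (\<gamma> s) - lower \<Omega> (snd (\<gamma> s))) * E"
    by (simp add: m_def E_def upper_trev abs_minus_commute)
  from 1 2 have "(1 - k) * m \<le> depth \<Omega> (\<gamma> s) * E" by (auto simp: depth_def min_def)
  then have "m \<le> depth \<Omega> (\<gamma> s) * E / (1 - k)" using k by (simp add: field_simps)
  then have "4 * m \<le> (4 / (1 - k)) * (depth \<Omega> (\<gamma> s) * E)" by simp
  also have "\<dots> \<le> real slope_const * (depth \<Omega> (\<gamma> s) * E)"
    using slope_const(1) in_dom[OF \<gamma>(2)] E by (intro mult_right_mono) (auto simp: mem_iff_depth)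
  finally have 3: "4 * m \<le> real slope_const * depth \<Omega> (\<gamma> s) * E" by (simp add: mult.assoc)
  have b: "\<gamma> s - \<gamma> t = (h s - h t) *\<^sub>R v" using g(2) \<gamma> by (simp add: scaleR_diff_left)
  have "dist (\<gamma> s) (\<gamma> t) \<le> \<bar>h s - h t\<bar> * (norm (fst v) + norm (snd v))"
    unfolding dist_norm b norm_scaleR using norm_Pair_le[of "fst v" "snd v"]
    by (intro mult_left_mono) auto
  also have "\<dots> = 2 * (\<bar>h s - h t\<bar> * \<bar>fst v\<bar>)" using lightlike_norm[OF g(1)] by simp
  also have "\<bar>h s - h t\<bar> * \<bar>fst v\<bar> = m"
  proof -
    have "fst (\<gamma> t) - fst (\<gamma> s) = - ((h s - h t) * fst v)"
      using arg_cong[OF b, of fst] by simp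
    then show ?thesis by (simp add: m_def abs_mult)
  qed
  finally show ?thesis using 3 by (simp add: E_def)
qed

text \<open>The test function is \<open>ln (G y) / slope_const\<close>. Since \<open>depth\<close>
  is 2-Lipschitz, \<open>G\<close> dominates it, so \<open>dist_step\<close> bounds the growth of
  \<open>G\<close> by \<open>G\<close> itself.\<close>

lemma dist_le_exp:
  assumes "x \<in> \<Omega>" "y \<in> \<Omega>"
  shows "2 * dist x y \<le> depth \<Omega> x * (exp (real slope_const * markowitz_dist \<Omega> x y) - 1)"
proof -
  define G where "G = (\<lambda>y. depth \<Omega> x + 2 * dist x y)"
  have dx: "0 < depth \<Omega> x" using assms by (simp add: mem_iff_depth)
  have G: "0 < G y" for y using dx by (simp add: G_def add_pos_nonneg)
  have n: "0 < real slope_const" using slope_const(2) by simp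
  have "ln (G y) / real slope_const - ln (G x) / real slope_const \<le> T" if "null_path \<Omega> x y T" for T
  proof (rule null_path_lower_bound[OF _ that])
    fix \<gamma> and s t :: real
    assume \<gamma>: "proj_lightlike_geodesic \<Omega> \<gamma>" "s \<in> {-1<..<1}" "t \<in> {-1<..<1}"
    let ?E = "exp (rho_I s t) - 1"
    have E: "0 \<le> ?E" using rho_I_nonneg by simp
    have "G (\<gamma> t) \<le> G (\<gamma> s) + 2 * dist (\<gamma> s) (\<gamma> t)"
      using dist_triangle[of x "\<gamma> t" "\<gamma> s"] by (simp add: G_def)
    also have "2 * dist (\<gamma> s) (\<gamma> t) \<le> real slope_const * depth \<Omega> (\<gamma> s) * ?E"
      by (rule dist_step[OF \<gamma>])
    also have "\<dots> \<le> real slope_const * G (\<gamma> s) * ?E"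
      using depth_lipschitz_dist[of "\<gamma> s" x] E n
      by (intro mult_right_mono mult_left_mono) (auto simp: G_def dist_commute)
    finally have "G (\<gamma> t) \<le> G (\<gamma> s) * (1 + real slope_const * ?E)" by (simp add: algebra_simps)
    \<comment> \<open>Bernoulli turns the linear growth factor into a power of
      \<open>1 + ?E = exp (rho_I s t)\<close>, whose logarithm is proportional to
      \<open>rho_I s t\<close>.\<close>
    also have "\<dots> \<le> G (\<gamma> s) * (1 + ?E) ^ slope_const"
      using G[of "\<gamma> s"] Bernoulli_inequality[of ?E slope_const] E by (intro mult_left_mono) auto
    also have "\<dots> = G (\<gamma> s) * exp (real slope_const * rho_I s t)"
      by (simp add: exp_of_nat_mult)
    finally have "ln (G (\<gamma> t)) \<le> ln (G (\<gamma> s) * exp (real slope_const * rho_I s t))"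
      using G by (subst ln_le_cancel_iff) auto
    also have "\<dots> = ln (G (\<gamma> s)) + real slope_const * rho_I s t" using G[of "\<gamma> s"] by (simp add: ln_mult)
    finally show "ln (G (\<gamma> t)) / real slope_const - ln (G (\<gamma> s)) / real slope_const \<le> rho_I s t"
      using n by (simp add: field_simps)
  qed
  then have "ln (G y) / real slope_const - ln (G x) / real slope_const \<le> markowitz_dist \<Omega> x y"
    using null_path_exists[OF assms] markowitz_dist_ge by metis
  then have "ln (G y) \<le> ln (G x) + real slope_const * markowitz_dist \<Omega> x y"
    using n by (simp add: field_simps)
  then have "exp (ln (G y)) \<le> exp (ln (G x) + real slope_const * markowitz_dist \<Omega> x y)" by simp
  then have "G y \<le> G x * exp (real slope_const * markowitz_dist \<Omega> x y)" using G by (simp add: exp_add)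
  then show ?thesis by (simp add: G_def algebra_simps)
qed

text \<open>Points are separated by \<open>dist_le_exp\<close>, where distance 0 forces Euclidean
  distance 0; the other axioms hold for every \<open>causal_body\<close>.\<close>

lemma Metric_space_markowitz: "Metric_space \<Omega> (markowitz_dist \<Omega>)"
proof
  fix x y assume xy: "x \<in> \<Omega>" "y \<in> \<Omega>"
  show "markowitz_dist \<Omega> x y = 0 \<longleftrightarrow> x = y"
    using dist_le_exp[OF xy] markowitz_dist_self[OF xy(1)] markowitz_dist_nonneg[of x x] by auto
qed (use markowitz_dist_nonneg markowitz_dist_commute markowitz_dist_triangle in auto)

text \<open>Both points are first moved towards a centre by a multiple of \<open>sqrt (dist u v * R)\<close>.\<close>

lemma markowitz_dist_le_sqrt:
  "\<exists>C>0. \<forall>u\<in>\<Omega>. \<forall>v\<in>\<Omega>. \<forall>R>0. R \<le> depth \<Omega> u \<longrightarrow> R \<le> depth \<Omega> v \<longrightarrow>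
    markowitz_dist \<Omega> u v \<le> C * sqrt (dist u v / R)"
proof -
  obtain B where B: "0 < B" "\<And>x. x \<in> \<Omega> \<Longrightarrow> depth \<Omega> x \<le> B"
    "\<And>x y. x \<in> \<Omega> \<Longrightarrow> y \<in> \<Omega> \<Longrightarrow> dist x y \<le> B" using depth_bound by metis
  obtain x0 where x0: "x0 \<in> \<Omega>" using nonempty_body by blast
  define c where "c = depth \<Omega> x0 / B"
  have c: "0 < c" "depth \<Omega> x0 = c * B" using x0 B by (auto simp: c_def mem_iff_depth)
  have c1: "c \<le> 1" using B(1) B(2)[OF x0] by (simp add: c_def)
  show ?thesis
  proof (intro exI[of _ "72 / c"] conjI ballI allI impI)
    fix u v R assume uv: "u \<in> \<Omega>" "v \<in> \<Omega>" and R: "(0::real) < R" "R \<le> depth \<Omega> u" "R \<le> depth \<Omega> v"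
    define e where "e = dist u v"
    define q where "q = sqrt (e / R)"
    show "markowitz_dist \<Omega> u v \<le> 72 / c * sqrt (dist u v / R)"
    proof (cases "e = 0")
      case True
      then show ?thesis using markowitz_dist_self uv by (simp add: e_def)
    next
      case False
      then have e: "0 < e" by (simp add: e_def)
      have q: "0 < q" "e = q * q * R" using e R by (auto simp: q_def)
      \<comment> \<open>Moving a point by \<open>q * R\<close> at depth at least
        \<open>c * R\<close> costs a multiple of \<open>q\<close>; crossing at the gained depth
        \<open>c * q * R\<close> costs a multiple of \<open>e / (q * R) = q\<close>. This fraction
        balances the two costs.\<close>
      define \<tau> where "\<tau> = q * R / B"
      have "(q * R)\<^sup>2 = e * R" using q by (simp add: power2_eq_square)
      also have "\<dots> \<le> B * B"
        using B(1) B(3)[OF uv] B(2)[OF uv(1)] R by (intro mult_mono) (simp_all add: e_def)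
      finally have "(q * R)\<^sup>2 \<le> B\<^sup>2" by (simp add: power2_eq_square)
      then have "q * R \<le> B" by (rule power2_le_imp_le) (use B(1) in simp)
      then have \<tau>: "0 < \<tau>" "\<tau> \<le> 1" using q R B(1) by (auto simp: \<tau>_def)
      define sh where "sh = (\<lambda>w. (1 - \<tau>) *\<^sub>R w + \<tau> *\<^sub>R x0)"
      have sh1: "dist w (sh w) \<le> q * R" if "w \<in> \<Omega>" for w
      proof -
        have "w - sh w = \<tau> *\<^sub>R (w - x0)" by (simp add: sh_def algebra_simps)
        then have "dist w (sh w) = \<tau> * dist w x0" using \<tau> by (simp add: dist_norm)
        also have "\<dots> \<le> \<tau> * B" using B(3)[OF that x0] \<tau> by (intro mult_left_mono) auto
        finally show ?thesis using B(1) by (simp add: \<tau>_def)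
      qed
      have shd: "(1 - \<tau>) * R + \<tau> * (c * B) \<le> depth \<Omega> (sh w)" if "R \<le> depth \<Omega> w" for w
        using depth_concave[of \<tau> w x0] mult_left_mono[OF that, of "1 - \<tau>"] \<tau> c(2)
        by (simp add: sh_def)
      have RB: "R \<le> B" using R(2) B(2)[OF uv(1)] by simp
      have cR: "c * R \<le> (1 - \<tau>) * R + \<tau> * (c * B)"
      proof -
        have "(1 - \<tau>) * (c * R) \<le> (1 - \<tau>) * R" "\<tau> * (c * R) \<le> \<tau> * (c * B)"
          using \<tau> c c1 R RB by (auto intro!: mult_left_mono simp: mult_le_cancel_right1)
        then show ?thesis by (simp add: algebra_simps)
      qed
      have cRle: "c * R \<le> R" using c1 R by simp
      have cR0: "0 < c * R" using c R by simp
      have up: "markowitz_dist \<Omega> w (sh w) \<le> 24 / c * q" if "w \<in> \<Omega>" "R \<le> depth \<Omega> w" for w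
      proof -
        have "markowitz_dist \<Omega> w (sh w) \<le> 24 * dist w (sh w) / (c * R)"
          by (rule markowitz_dist_segment_le[OF cR0]) (use that shd[OF that(2)] cR cRle in auto)
        also have "\<dots> \<le> 24 * (q * R) / (c * R)"
          using sh1[OF that(1)] cR0 by (intro divide_right_mono mult_left_mono) auto
        finally show ?thesis using R by simp
      qed
      have inO: "sh w \<in> \<Omega>" if "R \<le> depth \<Omega> w" for w
        using shd[OF that] cR cR0 by (simp add: mem_iff_depth)
      have "markowitz_dist \<Omega> (sh u) (sh v) \<le> 24 * dist (sh u) (sh v) / (\<tau> * (c * B))"
      proof (rule markowitz_dist_segment_le)
        have "0 \<le> (1 - \<tau>) * R" using \<tau> R by simp
        then show "\<tau> * (c * B) \<le> depth \<Omega> (sh u)" "\<tau> * (c * B) \<le> depth \<Omega> (sh v)"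
          using shd[OF R(2)] shd[OF R(3)] by auto
      qed (use \<tau> c B in simp)
      also have "\<dots> \<le> 24 * e / (\<tau> * (c * B))"
      proof -
        have "sh u - sh v = (1 - \<tau>) *\<^sub>R (u - v)" by (simp add: sh_def algebra_simps)
        then have "dist (sh u) (sh v) = (1 - \<tau>) * e" using \<tau> by (simp add: dist_norm e_def)
        also have "\<dots> \<le> 1 * e" using \<tau> e by (intro mult_right_mono) auto
        finally show ?thesis using \<tau> c B by (intro divide_right_mono mult_left_mono) auto
      qed
      also have "\<dots> = 24 / c * q" using q R B c by (simp add: \<tau>_def field_simps)
      finally have across: "markowitz_dist \<Omega> (sh u) (sh v) \<le> 24 / c * q" .
      have "markowitz_dist \<Omega> u v \<le> 24 / c * q + 24 / c * q + 24 / c * q"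
        using markowitz_dist_triangle[OF uv(1) inO[OF R(2)] uv(2)]
          markowitz_dist_triangle[OF inO[OF R(2)] inO[OF R(3)] uv(2)] up[OF uv(1) R(2)] up[OF uv(2) R(3)]
          across markowitz_dist_commute[of v "sh v"] by simp
      then show ?thesis by (simp add: q_def e_def)
    qed
  qed (use c in simp)
qed

text \<open>By \<open>depth_ratio\<close> the depth is at least
  \<open>depth \<Omega> x * exp (- r)\<close> on the ball, so Euclidean limits of its sequences stay
  in \<open>\<Omega>\<close>. At such depths the segment bound turns Euclidean convergence into
  convergence for the distance.\<close>

lemma markowitz_ball_compact:
  assumes x: "x \<in> \<Omega>"
  shows "compactin (Metric_space.mtopology \<Omega> (markowitz_dist \<Omega>))
    (Metric_space.mcball \<Omega> (markowitz_dist \<Omega>) x r)"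
proof -
  interpret Metric_space \<Omega> "markowitz_dist \<Omega>" by (rule Metric_space_markowitz)
  define R where "R = depth \<Omega> x * exp (- r)"
  have R: "0 < R" using x by (simp add: R_def mem_iff_depth)
  have deep: "R \<le> depth \<Omega> y" if "y \<in> \<Omega>" "markowitz_dist \<Omega> x y \<le> r" for y
  proof -
    have "depth \<Omega> x \<le> depth \<Omega> y * exp (markowitz_dist \<Omega> y x)" by (rule depth_ratio[OF that(1) x])
    also have "\<dots> \<le> depth \<Omega> y * exp r"
      using that by (intro mult_left_mono) (auto simp: mem_iff_depth markowitz_dist_commute[of y])
    finally show ?thesis by (simp add: R_def exp_minus field_simps)
  qed
  show ?thesis
    unfolding compactin_sequentially
  proof (intro conjI allI impI)
    fix \<sigma> :: "nat \<Rightarrow> 'n minkowski" assume "range \<sigma> \<subseteq> mcball x r"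
    then have \<sigma>: "\<sigma> n \<in> \<Omega>" "markowitz_dist \<Omega> x (\<sigma> n) \<le> r" for n by (auto simp: image_subset_iff)
    have "bounded (range \<sigma>)" using bounded_body by (rule bounded_subset) (use \<sigma> in auto)
    then obtain l q where q: "strict_mono q" "(\<sigma> \<circ> q) \<longlonglongrightarrow> l"
      using bounded_imp_convergent_subsequence by blast
    have dist0: "(\<lambda>n. dist (\<sigma> (q n)) l) \<longlonglongrightarrow> 0"
      using q(2) by (simp add: o_def tendsto_dist_iff[symmetric])
    have Rl: "R \<le> depth \<Omega> l"
    proof (rule tendsto_lowerbound)
      show "(\<lambda>n. depth \<Omega> l + 2 * dist (\<sigma> (q n)) l) \<longlonglongrightarrow> depth \<Omega> l"
        using tendsto_add[OF tendsto_const tendsto_mult[OF tendsto_const dist0], of "depth \<Omega> l" 2] by simp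
      show "\<forall>\<^sub>F n in sequentially. R \<le> depth \<Omega> l + 2 * dist (\<sigma> (q n)) l"
        using deep[OF \<sigma>] depth_lipschitz_dist order_trans by (intro always_eventually allI) blast
    qed simp
    then have l: "l \<in> \<Omega>" using R by (simp add: mem_iff_depth)
    have bd: "markowitz_dist \<Omega> (\<sigma> (q n)) l \<le> 24 * dist (\<sigma> (q n)) l / R" for n
      by (rule markowitz_dist_segment_le[OF R deep[OF \<sigma>] Rl])
    have lim0: "(\<lambda>n. markowitz_dist \<Omega> (\<sigma> (q n)) l) \<longlonglongrightarrow> 0"
    proof (rule tendsto_sandwich[where f = "\<lambda>_. 0" and h = "\<lambda>n. 24 * dist (\<sigma> (q n)) l / R"])
      show "(\<lambda>n. 24 * dist (\<sigma> (q n)) l / R) \<longlonglongrightarrow> 0"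
        using tendsto_divide[OF tendsto_mult[OF tendsto_const dist0, of 24] tendsto_const, of R] R by simp
      show "(\<lambda>n. 0::real) \<longlonglongrightarrow> 0" by simp
      show "\<forall>\<^sub>F n in sequentially. 0 \<le> markowitz_dist \<Omega> (\<sigma> (q n)) l"
        by (rule always_eventually) (simp add: markowitz_dist_nonneg)
      show "\<forall>\<^sub>F n in sequentially. markowitz_dist \<Omega> (\<sigma> (q n)) l \<le> 24 * dist (\<sigma> (q n)) l / R"
        by (rule always_eventually) (intro allI bd)
    qed
    have lim: "limitin mtopology (\<sigma> \<circ> q) l sequentially"
      unfolding limitin_metric
    proof (intro conjI allI impI l)
      fix e :: real assume "0 < e"
      then show "\<forall>\<^sub>F n in sequentially. (\<sigma> \<circ> q) n \<in> \<Omega> \<and> markowitz_dist \<Omega> ((\<sigma> \<circ> q) n) l < e"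
        using order_tendstoD(2)[OF lim0, of e] \<sigma>(1) by simp
    qed
    have "markowitz_dist \<Omega> x l \<le> r"
      by (rule limitin_dist_le[OF lim x, where c = "\<lambda>_. r"]) (use \<sigma> in auto)
    then show "\<exists>l q. l \<in> mcball x r \<and> strict_mono q \<and> limitin mtopology (\<sigma> \<circ> q) l sequentially"
      using l x q(1) lim by (intro exI[of _ l] exI[of _ q]) simp
  qed auto
qed

lemma markowitz_proper_geodesic: "proper_geodesic_space \<Omega> (markowitz_dist \<Omega>)"
  unfolding proper_geodesic_space_def
proof (intro conjI ballI allI)
  show "Metric_space \<Omega> (markowitz_dist \<Omega>)" by (rule Metric_space_markowitz)
  show "compactin (Metric_space.mtopology \<Omega> (markowitz_dist \<Omega>))
    (Metric_space.mcball \<Omega> (markowitz_dist \<Omega>) x r)" if "x \<in> \<Omega>" for x r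
    by (rule markowitz_ball_compact[OF that])
  show "\<exists>S. geodesic_segment \<Omega> (markowitz_dist \<Omega>) x y S" if xy: "x \<in> \<Omega>" "y \<in> \<Omega>" for x y
  proof (rule Metric_space.geodesic_segment_exists[OF Metric_space_markowitz markowitz_ball_compact _ xy])
    fix x y s and e :: real
    assume xy: "x \<in> \<Omega>" "y \<in> \<Omega>" and s: "0 \<le> s" "s \<le> markowitz_dist \<Omega> x y" and e: "0 < e"
    obtain T0 where "null_path \<Omega> x y T0" using null_path_exists xy by metis
    then obtain T where T: "null_path \<Omega> x y T" "T < markowitz_dist \<Omega> x y + e"
      using markowitz_dist_approx e by metis
    have "s \<le> T" using s(2) markowitz_dist_le[OF T(1)] by simp
    then obtain z where z: "null_path \<Omega> x z s" "null_path \<Omega> z y (T - s)"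
      using null_path_split[OF T(1) s(1)] by blast
    show "\<exists>z\<in>\<Omega>. markowitz_dist \<Omega> x z \<le> s + e \<and> markowitz_dist \<Omega> z y \<le> markowitz_dist \<Omega> x y - s + e"
      using null_path_in(2)[OF z(1)] markowitz_dist_le[OF z(1)] markowitz_dist_le[OF z(2)] T(2) e
      by (intro bexI[of _ z]) auto
  qed
qed

lemma markowitz_gromov_hyperbolic: "gromov_hyperbolic \<Omega> (markowitz_dist \<Omega>)"
proof -
  obtain C where C: "C > 0" "\<And>u v R. u \<in> \<Omega> \<Longrightarrow> v \<in> \<Omega> \<Longrightarrow> 0 < R \<Longrightarrow> R \<le> depth \<Omega> u \<Longrightarrow> R \<le> depth \<Omega> v \<Longrightarrow>
    markowitz_dist \<Omega> u v \<le> C * sqrt (dist u v / R)"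
    using markowitz_dist_le_sqrt by blast
  have n: "0 < real slope_const" using slope_const(2) by simp
  interpret Metric_space \<Omega> "markowitz_dist \<Omega>" by (rule Metric_space_markowitz)
  interpret quasihyperbolic \<Omega> "markowitz_dist \<Omega>" "depth \<Omega>" "1 / real slope_const" "real slope_const" C
  proof
    fix u v assume uv: "u \<in> \<Omega>" "v \<in> \<Omega>" and le: "markowitz_dist \<Omega> u v \<le> 1 / real slope_const"
    define z where "z = real slope_const * markowitz_dist \<Omega> u v"
    have z: "0 \<le> z" "z \<le> 1"
      using le n markowitz_dist_nonneg[of u v] by (auto simp: z_def field_simps)
    \<comment> \<open>For \<open>z \<le> 1\<close> this linearizes \<open>dist_le_exp\<close> as
      \<open>exp z - 1 \<le> 2 * z\<close>, which is why the local scale is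
      \<open>1 / slope_const\<close>.\<close>
    have "exp z \<le> 1 + z + z\<^sup>2" by (rule exp_bound[OF z])
    also have "z\<^sup>2 \<le> z" using z by (simp add: power2_eq_square mult_left_le)
    finally have "exp z - 1 \<le> 2 * z" by simp
    then have "depth \<Omega> u * (exp z - 1) \<le> depth \<Omega> u * (2 * z)"
      using uv by (intro mult_left_mono) (auto simp: mem_iff_depth)
    then show "dist u v \<le> real slope_const * depth \<Omega> u * markowitz_dist \<Omega> u v"
      using dist_le_exp[OF uv] by (simp add: z_def algebra_simps)
  qed (use n C depth_ratio mem_iff_depth in auto)
  show ?thesis by (rule gromov_hyperbolic[OF markowitz_proper_geodesic])
qed

end

subsection \<open>Flat quadrilaterals\<close>

text \<open>For lightlike \<open>v\<close> the quadratic term vanishes: the squared Lorentzian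
  distance from a fixed point is affine along lightlike lines.\<close>

lemma mink_expand:
  "mink (x + r *\<^sub>R v) (x + r *\<^sub>R v) = mink x x + 2 * mink x v * r + r * r * mink v v"
  by (simp add: mink_def inner_add_left inner_add_right inner_commute algebra_simps)

text \<open>Both points are well inside the chord: \<open>a\<close> is at least twice
  \<open>\<alpha>\<close>, and \<open>\<Lambda> * a\<close> is at most half of
  \<open>\<beta>\<close>. Each end of the chord then costs a factor of at most 2 beyond
  \<open>\<Lambda>\<close>.\<close>

lemma chord_cost_le:
  fixes \<alpha> \<beta> a :: real
  assumes "0 \<le> \<alpha>" "2 * \<alpha> \<le> a" "0 < a" "1 \<le> \<Lambda>" "2 * (\<Lambda> * a) \<le> \<beta>"
  shows "\<bar>ln (((\<Lambda> * a - \<alpha>) / (\<beta> - \<Lambda> * a)) / ((a - \<alpha>) / (\<beta> - a)))\<bar> \<le> ln \<Lambda> + ln 4"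
proof -
  define b where "b = \<Lambda> * a"
  have b: "a \<le> b" "2 * b \<le> \<beta>" using assms by (simp_all add: b_def)
  define A B where "A = (b - \<alpha>) / (a - \<alpha>)" and "B = (\<beta> - a) / (\<beta> - b)"
  have pos: "0 < b" "0 < a - \<alpha>" "0 < \<beta> - b" using assms b by auto
  have A: "1 \<le> A" "A \<le> 2 * \<Lambda>"
  proof -
    show "1 \<le> A" using pos b by (simp add: A_def)
    have "A \<le> b / (a / 2)" unfolding A_def using assms b pos by (intro frac_le) auto
    also have "\<dots> = 2 * \<Lambda>" using assms by (simp add: b_def)
    finally show "A \<le> 2 * \<Lambda>" .
  qed
  have B: "1 \<le> B" "B \<le> 2"
  proof -
    show "1 \<le> B" using pos b by (simp add: B_def)
    have "\<beta> - a \<le> 2 * (\<beta> - b)" using b assms(3) by simp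
    then show "B \<le> 2" using pos by (simp add: B_def divide_le_eq)
  qed
  have "((b - \<alpha>) / (\<beta> - b)) / ((a - \<alpha>) / (\<beta> - a)) = A * B" by (simp add: A_def B_def mult.commute)
  moreover have "1 * 1 \<le> A * B" using A B by (intro mult_mono) auto
  moreover have "A * B \<le> (2 * \<Lambda>) * 2" using A B by (intro mult_mono) auto
  ultimately have "1 \<le> ((b - \<alpha>) / (\<beta> - b)) / ((a - \<alpha>) / (\<beta> - a))"
    "((b - \<alpha>) / (\<beta> - b)) / ((a - \<alpha>) / (\<beta> - a)) \<le> \<Lambda> * 4" by simp_all
  then have "0 \<le> ln (((b - \<alpha>) / (\<beta> - b)) / ((a - \<alpha>) / (\<beta> - a)))"
    "ln (((b - \<alpha>) / (\<beta> - b)) / ((a - \<alpha>) / (\<beta> - a))) \<le> ln (\<Lambda> * 4)"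
    by (simp_all only: ln_ge_zero, intro ln_mono) (use assms(4) in auto)
  moreover have "ln (\<Lambda> * 4) = ln \<Lambda> + ln 4" using assms(4) by (intro ln_mult_pos) auto
  ultimately show ?thesis unfolding b_def by linarith
qed

text \<open>By the parallelogram law, displacing the midpoint of a segment lengthens the broken path
  only quadratically.\<close>

lemma sum_norms_le:
  fixes h e :: "'a::real_inner"
  assumes "0 < norm h"
  shows "norm (h + e) + norm (h - e) \<le> 2 * norm h + (norm e)\<^sup>2 / norm h"
proof (rule power2_le_imp_le)
  have "(norm (h + e) + norm (h - e))\<^sup>2 \<le> 2 * ((norm (h + e))\<^sup>2 + (norm (h - e))\<^sup>2)"
    using sum_squares_ge_zero zero_le_power2[of "norm (h + e) - norm (h - e)"]
    by (simp add: power2_eq_square algebra_simps)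
  also have "(norm (h + e))\<^sup>2 + (norm (h - e))\<^sup>2 = 2 * (norm h)\<^sup>2 + 2 * (norm e)\<^sup>2"
    by (simp add: power2_norm_eq_inner inner_add_left inner_add_right inner_diff_left inner_diff_right inner_commute)
  also have "2 * (2 * (norm h)\<^sup>2 + 2 * (norm e)\<^sup>2) \<le> (2 * norm h + (norm e)\<^sup>2 / norm h)\<^sup>2"
  proof -
    have "norm h * ((norm e)\<^sup>2 / norm h) = (norm e)\<^sup>2" using assms by simp
    then show ?thesis using assms by (auto simp: power2_sum)
  qed
  finally show "(norm (h + e) + norm (h - e))\<^sup>2 \<le> (2 * norm h + (norm e)\<^sup>2 / norm h)\<^sup>2" .
qed simp

context causal_body
begin

section \<open>Thickness of the body and its rim\<close>

lemma gap_concave: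
  assumes "0 \<le> u" "u \<le> 1"
  shows "(1 - u) * (upper \<Omega> p - lower \<Omega> p) + u * (upper \<Omega> q - lower \<Omega> q)
    \<le> upper \<Omega> ((1 - u) *\<^sub>R p + u *\<^sub>R q) - lower \<Omega> ((1 - u) *\<^sub>R p + u *\<^sub>R q)"
  using upper_concave[OF assms, of p q] lower_convex[OF assms, of p q] by (simp add: algebra_simps)

text \<open>The extensions open like cones of slope 1 away from the bounded body. This bounds the
  region where \<open>lower\<close> is at most \<open>upper\<close> and makes every ray leave
  it.\<close>

lemma gap_le:
  obtains B where "0 < B" "\<And>p. upper \<Omega> p - lower \<Omega> p \<le> 2 * B - 2 * norm p"
proof -
  obtain B where B: "0 < B" "\<And>x. x \<in> \<Omega> \<Longrightarrow> norm x \<le> B" using body_bound by metis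
  have n: "\<bar>fst x\<bar> \<le> B" "norm (snd x) \<le> B" if "x \<in> \<Omega>" for x
    using B(2)[OF that] norm_fst_le[of "fst x" "snd x"] norm_snd_le[of "snd x" "fst x"] by auto
  have "upper \<Omega> p \<le> 2 * B - norm p" for p
  proof (rule upper_le)
    fix x assume "x \<in> \<Omega>"
    then show "fst x - dist p (snd x) \<le> 2 * B - norm p"
      using n[of x] norm_triangle_ineq2[of p "snd x"] by (simp add: dist_norm)
  qed
  moreover have "norm p - 2 * B \<le> lower \<Omega> p" for p
  proof (rule ccontr)
    assume "\<not> norm p - 2 * B \<le> lower \<Omega> p"
    then obtain x where "x \<in> \<Omega>" "fst x + dist p (snd x) < norm p - 2 * B" using lower_less by (metis not_le)
    then show False using n[of x] norm_triangle_ineq2[of p "snd x"] by (simp add: dist_norm)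
  qed
  ultimately have "upper \<Omega> p - lower \<Omega> p \<le> 2 * (2 * B) - 2 * norm p" for p
    using diff_mono[of "upper \<Omega> p" "2 * B - norm p" "norm p - 2 * B" "lower \<Omega> p"] by simp
  then show ?thesis using that[of "2 * B"] B by simp
qed

text \<open>Near the rim \<open>upper = lower\<close> the past boundary is not lightlike in the directions in which the
  future boundary may be: otherwise \<open>\<Omega>\<close> would be too thin above the midpoint of \<open>b\<close> and \<open>y\<close>,
  as its thickness grows linearly towards an interior point, while the Lipschitz conditions at
  \<open>b\<close> and \<open>y\<close> only leave room for a quadratic one.\<close>

lemma rim_slope:
  obtains \<eta> where "0 < \<eta>" "\<eta> \<le> 1"
    "\<And>b y. upper \<Omega> b = lower \<Omega> b \<Longrightarrow> lower \<Omega> y \<le> upper \<Omega> y \<Longrightarrow>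
      lower \<Omega> y \<le> upper \<Omega> b + (1 - \<eta>) * dist b y"
proof -
  obtain B where B: "0 < B" "\<And>p. upper \<Omega> p - lower \<Omega> p \<le> 2 * B - 2 * norm p" using gap_le by blast
  obtain x0 where x0: "x0 \<in> \<Omega>" using nonempty_body by blast
  define p0 where "p0 = snd x0"
  define \<theta> where "\<theta> = upper \<Omega> p0 - lower \<Omega> p0"
  define \<Delta> where "\<Delta> = 2 * B"
  have \<theta>: "0 < \<theta>" using x0 by (simp add: \<theta>_def p0_def mem_iff)
  have \<theta>\<Delta>: "\<theta> \<le> \<Delta>" using B(2)[of p0] norm_ge_zero[of p0] unfolding \<theta>_def \<Delta>_def by linarith
  have \<Delta>: "0 < \<Delta>" using B by (simp add: \<Delta>_def)
  have nB: "norm p \<le> B" if "lower \<Omega> p \<le> upper \<Omega> p" for p using B(2)[of p] that by simp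
  have dB: "dist p q \<le> \<Delta>" if "lower \<Omega> p \<le> upper \<Omega> p" "lower \<Omega> q \<le> upper \<Omega> q" for p q
    using nB[OF that(1)] nB[OF that(2)] norm_triangle_ineq4[of p q] by (simp add: dist_norm \<Delta>_def)
  define \<eta> where "\<eta> = (\<theta> / \<Delta>)\<^sup>2 / 8"
  have "(\<theta> / \<Delta>)\<^sup>2 \<le> 1" using \<theta> \<theta>\<Delta> \<Delta> by (simp add: power_le_one)
  then have \<eta>: "0 < \<eta>" "\<eta> \<le> 1" using \<theta> \<Delta> by (simp_all add: \<eta>_def)
  show ?thesis
  proof (rule that[OF \<eta>])
    fix b y assume rim: "upper \<Omega> b = lower \<Omega> b" "lower \<Omega> y \<le> upper \<Omega> y"
    define s where "s = dist b y"
    show "lower \<Omega> y \<le> upper \<Omega> b + (1 - \<eta>) * dist b y"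
    proof (cases "s = 0")
      case True
      then show ?thesis using rim by (simp add: s_def)
    next
      case False
      then have s: "0 < s" by (simp add: s_def)
      have s\<Delta>: "s \<le> \<Delta>" unfolding s_def using dB[of b y] rim by simp
      define c where "c = (1 - 1/2) *\<^sub>R b + (1/2) *\<^sub>R y"
      have gc: "0 \<le> upper \<Omega> c - lower \<Omega> c"
        using gap_concave[of "1/2" b y] rim unfolding c_def by simp
      \<comment> \<open>This value maximizes
        \<open>\<tau> * \<theta> - 2 * (\<tau> * \<Delta>)\<^sup>2 / s\<close>, the gain in
        thickness less the loss in length; the maximum is \<open>\<eta> * s\<close>, whence the 8 in
        \<open>\<eta>\<close>.\<close>
      define \<tau> where "\<tau> = \<theta> / (4 * \<Delta>\<^sup>2) * s"
      have "\<tau> = (\<theta> / \<Delta>) * (s / \<Delta>) / 4" by (simp add: \<tau>_def power2_eq_square)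
      also have "(\<theta> / \<Delta>) * (s / \<Delta>) \<le> 1 * 1" using \<theta> s \<theta>\<Delta> s\<Delta> \<Delta> by (intro mult_mono) auto
      finally have \<tau>1: "\<tau> \<le> 1" by simp
      have "0 \<le> \<tau>" using \<theta> s \<Delta> by (simp add: \<tau>_def)
      note \<tau> = this \<tau>1
      define p where "p = (1 - \<tau>) *\<^sub>R c + \<tau> *\<^sub>R p0"
      define e where "e = \<tau> *\<^sub>R (p0 - c)"
      define h where "h = (1/2) *\<^sub>R (y - b)"
      have h: "norm h = s / 2" by (simp add: h_def s_def dist_norm norm_minus_commute)
      have pb: "p - b = h + e" "y - p = h - e"
        by (simp_all add: p_def e_def h_def c_def vec_eq_iff field_simps)
      have ne: "norm e \<le> \<tau> * \<Delta>"
        using dB[of p0 c] gc \<theta> \<tau> by (simp add: e_def dist_norm mult_left_mono \<theta>_def)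
      have "norm (h + e) + norm (h - e) \<le> 2 * norm h + (norm e)\<^sup>2 / norm h"
        by (rule sum_norms_le) (simp only: h, use s in simp)
      also have "\<dots> \<le> 2 * norm h + (\<tau> * \<Delta>)\<^sup>2 / norm h"
        using ne h s by (intro add_left_mono divide_right_mono power_mono) auto
      also have "\<dots> = s + 2 * (\<tau> * \<Delta>)\<^sup>2 / s" by (simp add: h)
      finally have sum: "dist p b + dist y p \<le> s + 2 * (\<tau> * \<Delta>)\<^sup>2 / s" by (simp add: dist_norm pb)
      have "0 \<le> (1 - \<tau>) * (upper \<Omega> c - lower \<Omega> c)" using gc \<tau> by simp
      then have "\<tau> * \<theta> \<le> upper \<Omega> p - lower \<Omega> p"
        using gap_concave[OF \<tau>, of c p0] unfolding p_def \<theta>_def by linarith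
      also have "\<dots> \<le> upper \<Omega> b - lower \<Omega> y + (dist p b + dist y p)"
        using upper_lipschitz[of p b] lower_lipschitz[of y p] by simp
      finally have "lower \<Omega> y \<le> upper \<Omega> b + s + (2 * (\<tau> * \<Delta>)\<^sup>2 / s - \<tau> * \<theta>)" using sum by simp
      also have "2 * (\<tau> * \<Delta>)\<^sup>2 / s - \<tau> * \<theta> = - (\<eta> * s)"
        using s \<Delta> by (simp add: \<tau>_def \<eta>_def power2_eq_square field_simps)
      finally show ?thesis by (simp add: s_def algebra_simps)
    qed
  qed
qed

text \<open>The thickness is positive at \<open>q\<close> and at most 0 at distance
  \<open>norm q + B\<close>, so it vanishes in between.\<close>

lemma rim_on_ray:
  assumes q: "q \<in> snd ` \<Omega>" and u: "norm u = 1"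
  obtains s where "0 < s" "upper \<Omega> (q - s *\<^sub>R u) = lower \<Omega> (q - s *\<^sub>R u)"
proof -
  obtain B where B: "0 < B" "\<And>p. upper \<Omega> p - lower \<Omega> p \<le> 2 * B - 2 * norm p" using gap_le by blast
  define f where "f = (\<lambda>s. upper \<Omega> (q - s *\<^sub>R u) - lower \<Omega> (q - s *\<^sub>R u))"
  have cont: "continuous_on {0..S} f" for S
    unfolding f_def
    by (intro continuous_on_diff continuous_on_compose2[OF continuous_upper[of UNIV]]
        continuous_on_compose2[OF continuous_lower[of UNIV]] continuous_intros) auto
  have f0: "0 < f 0" using q by (simp add: f_def projection_eq)
  define S where "S = norm q + B"
  have "norm (S *\<^sub>R u) = S" using u B by (simp add: S_def add_nonneg_pos)
  then have "B \<le> norm (q - S *\<^sub>R u)"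
    using norm_triangle_ineq2[of "S *\<^sub>R u" q] by (simp add: S_def norm_minus_commute)
  then have fS: "f S \<le> 0" using B(2)[of "q - S *\<^sub>R u"] by (simp add: f_def)
  have "0 \<le> S" using B by (simp add: S_def)
  then obtain s where s: "0 \<le> s" "f s = 0"
    using IVT2'[OF fS less_imp_le[OF f0] _ cont] by auto
  then have "s \<noteq> 0" using f0 by auto
  then show ?thesis using that[of s] s by (simp add: f_def)
qed


text \<open>In the coordinates \<open>z\<close>, \<open>m\<close> on the plane through the rim point \<open>(upper \<Omega> b, b)\<close> the metric is,
  up to a constant, the sum of the metrics \<open>\<bar>d ln z\<bar>\<close> and \<open>\<bar>d ln m\<bar>\<close> on the four points below, the more
  precisely the closer \<open>\<xi>\<close> is to a unit vector.\<close>

lemma flat_quadrilateral: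
  assumes \<eta>: "0 < \<eta>" "\<eta> \<le> 1"
      "\<And>b y. upper \<Omega> b = lower \<Omega> b \<Longrightarrow> lower \<Omega> y \<le> upper \<Omega> y \<Longrightarrow>
        lower \<Omega> y \<le> upper \<Omega> b + (1 - \<eta>) * dist b y"
    and q: "q \<in> snd ` \<Omega>" and \<xi>: "\<And>p. upper \<Omega> p \<le> upper \<Omega> q + \<xi> \<bullet> (p - q)"
    and \<Lambda>: "1 < \<Lambda>" and steep: "1 - \<eta> / (32 * \<Lambda>\<^sup>2) \<le> norm \<xi>"
  shows "\<exists>x\<in>\<Omega>. \<exists>z\<in>\<Omega>. \<exists>p\<in>\<Omega>. \<exists>p'\<in>\<Omega>.
    markowitz_dist \<Omega> x p \<le> ln \<Lambda> + ln 4 \<and> markowitz_dist \<Omega> p z \<le> ln \<Lambda> + ln 4 \<and>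
    markowitz_dist \<Omega> x p' \<le> ln \<Lambda> + ln 4 \<and> markowitz_dist \<Omega> p' z \<le> ln \<Lambda> + ln 4 \<and>
    2 * ln \<Lambda> \<le> markowitz_dist \<Omega> x z \<and> ln \<Lambda> - ln 5 \<le> markowitz_dist \<Omega> p p'"
proof -
  define \<epsilon> where "\<epsilon> = \<eta> / (32 * \<Lambda>\<^sup>2)"
  define \<nu> where "\<nu> = norm \<xi>"
  define u where "u = (1 / \<nu>) *\<^sub>R \<xi>"
  have "1 < \<Lambda>\<^sup>2" using \<Lambda> by simp
  then have \<Lambda>2: "\<eta> < 32 * \<Lambda>\<^sup>2" using \<eta>(2) by linarith
  have \<epsilon>: "0 < \<epsilon>" "\<epsilon> < 1"
    using \<eta>(1,2) \<Lambda> \<Lambda>2 by (simp_all add: \<epsilon>_def divide_less_eq)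
  have \<nu>: "1 - \<epsilon> \<le> \<nu>" "\<nu> \<le> 1"
    using steep supergradient_norm_le_1[OF \<xi>] by (simp_all add: \<epsilon>_def \<nu>_def)
  then have \<nu>0: "0 < \<nu>" using \<epsilon> by simp
  then have \<xi>0: "\<xi> \<noteq> 0" by (auto simp: \<nu>_def)
  have u: "norm u = 1" using \<xi>0 by (simp add: u_def \<nu>_def)
  have \<xi>u: "\<xi> \<bullet> u = \<nu>" using \<xi>0 by (simp add: u_def \<nu>_def dot_square_norm power2_eq_square)
  obtain s where s: "0 < s" and rim: "upper \<Omega> (q - s *\<^sub>R u) = lower \<Omega> (q - s *\<^sub>R u)"
    using rim_on_ray[OF q u] by blast
  define b where "b = q - s *\<^sub>R u"
  define \<beta> where "\<beta> = upper \<Omega> b"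
  have rim: "upper \<Omega> b = lower \<Omega> b" using rim by (simp add: b_def)
  \<comment> \<open>The value of the supporting function at the rim point
    \<open>(\<beta>, b)\<close>. It is small because \<open>upper\<close> rises from
    \<open>b\<close> to \<open>q\<close> at slope at most 1, while the supporting function has slope
    at least \<open>1 - \<epsilon>\<close>.\<close>
  define \<kappa> where "\<kappa> = upper \<Omega> q - s * \<nu> - \<beta>"
  have "0 \<le> \<kappa>" using \<xi>[of b] by (simp add: \<kappa>_def b_def \<beta>_def \<xi>u)
  moreover have "upper \<Omega> q \<le> \<beta> + s" using upper_lipschitz[of q b] u s by (simp add: \<beta>_def b_def dist_norm)
  then have "\<kappa> \<le> s * (1 - \<nu>)" by (simp add: \<kappa>_def algebra_simps)
  moreover have "s * (1 - \<nu>) \<le> s * \<epsilon>" using \<nu> s by (intro mult_left_mono) auto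
  ultimately have \<kappa>: "0 \<le> \<kappa>" "\<kappa> \<le> \<epsilon> * s" by (simp_all add: mult.commute)
  define E where "E = (\<lambda>z m. (\<beta> + z - m, b + (z + m) *\<^sub>R u))"
  \<comment> \<open>The bound \<open>m < \<eta> * z / 2\<close> keeps the point above the past
    boundary by the slope \<open>1 - \<eta>\<close>, and \<open>\<epsilon> * s < m\<close> keeps it
    below the line of slope 1 that ends at \<open>(upper \<Omega> q, q)\<close>, itself below the
    future boundary.\<close>
  have E_mem: "E z m \<in> \<Omega>" if "\<epsilon> * s < m" "m < \<eta> * z / 2" "z + m \<le> s" for z m
  proof -
    have m: "0 < m" using that(1) \<epsilon> s by (metis mult_pos_pos order.strict_trans)
    then have "0 < \<eta> * z" using that(2) by linarith
    then have z: "0 < z" using \<eta>(1) by (simp add: zero_less_mult_iff)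
    define r where "r = z + m"
    have r: "0 < r" "r \<le> s" using m z that by (simp_all add: r_def)
    have "b + r *\<^sub>R u = (1 - r / s) *\<^sub>R b + (r / s) *\<^sub>R q"
      using s by (simp add: b_def algebra_simps)
    then have "lower \<Omega> (b + r *\<^sub>R u) \<le> upper \<Omega> (b + r *\<^sub>R u)"
      using gap_concave[of "r / s" b q] r s q rim
      by (simp add: projection_eq) (smt (verit) divide_nonneg_nonneg mult_nonneg_nonneg)
    then have "lower \<Omega> (b + r *\<^sub>R u) \<le> \<beta> + (1 - \<eta>) * r"
      using \<eta>(3)[OF rim, of "b + r *\<^sub>R u"] r u by (simp add: \<beta>_def dist_norm)
    also have "\<dots> < \<beta> + z - m"
      using that(2) mult_pos_pos[OF \<eta>(1) m] by (simp add: r_def algebra_simps)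
    finally have 1: "lower \<Omega> (b + r *\<^sub>R u) < \<beta> + z - m" .
    have "dist q (b + r *\<^sub>R u) = s - r"
    proof -
      have "q - (b + r *\<^sub>R u) = (s - r) *\<^sub>R u" by (simp add: b_def algebra_simps)
      then show ?thesis using r u by (simp add: dist_norm)
    qed
    then have "upper \<Omega> q - (s - r) \<le> upper \<Omega> (b + r *\<^sub>R u)"
      using upper_lipschitz[of q "b + r *\<^sub>R u"] by simp
    moreover have "\<beta> + s * \<nu> \<le> upper \<Omega> q" using \<kappa> by (simp add: \<kappa>_def)
    moreover have "s * (1 - \<epsilon>) \<le> s * \<nu>" using \<nu> s by (intro mult_left_mono) auto
    ultimately have "\<beta> + z - m < upper \<Omega> (b + r *\<^sub>R u)"
      using that(1) m by (simp add: r_def algebra_simps)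
    with 1 show ?thesis by (simp add: E_def mem_iff r_def)
  qed
  have ll: "lightlike (1, u)" "lightlike (-1, u)"
    using u by (simp_all add: lightlike_def mink_def zero_prod_def dot_square_norm)
  have E_z: "E z m = E 0 m + z *\<^sub>R (1, u)" and E_m: "E z m = E z 0 + m *\<^sub>R (-1, u)" for z m
    by (simp_all add: E_def algebra_simps)
  have z_line: "markowitz_dist \<Omega> (E z m) (E (\<Lambda> * z) m) \<le> ln \<Lambda> + ln 4"
    if "\<epsilon> * s < m" "m \<le> s / 16" "4 * m \<le> \<eta> * z" "\<Lambda> * z \<le> s / 4" for z m
  proof -
    have m: "0 < m" using that(1) \<epsilon> s by (metis mult_pos_pos order.strict_trans)
    then have "0 < \<eta> * z" using that(3) by linarith
    then have z: "0 < z" using \<eta>(1) by (simp add: zero_less_mult_iff)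
    have \<alpha>: "0 \<le> 2 * m / \<eta>" "2 * (2 * m / \<eta>) \<le> z" "2 * m / \<eta> < z" 
      using m \<eta>(1) that(3) by (simp_all add: field_simps)
    have \<Lambda>z: "z < \<Lambda> * z" using z \<Lambda> by simp
    have "null_path \<Omega> (E 0 m + z *\<^sub>R (1, u)) (E 0 m + (\<Lambda> * z) *\<^sub>R (1, u))
      \<bar>ln (((\<Lambda> * z - 2 * m / \<eta>) / (s / 2 - \<Lambda> * z)) / ((z - 2 * m / \<eta>) / (s / 2 - z)))\<bar>"
    proof (rule null_path_chord[OF ll(1)])
      fix r assume r: "2 * m / \<eta> < r" "r < s / 2"
      have "m < \<eta> * r / 2" using r(1) \<eta>(1) by (simp add: field_simps)
      then show "E 0 m + r *\<^sub>R (1, u) \<in> \<Omega>"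
        by (subst E_z[symmetric], intro E_mem) (use that r s in auto)
    qed (use \<alpha> \<Lambda>z that s in linarith)+
    then have "markowitz_dist \<Omega> (E z m) (E (\<Lambda> * z) m)
      \<le> \<bar>ln (((\<Lambda> * z - 2 * m / \<eta>) / (s / 2 - \<Lambda> * z)) / ((z - 2 * m / \<eta>) / (s / 2 - z)))\<bar>"
      unfolding E_z[of z m] E_z[of "\<Lambda> * z" m] by (rule markowitz_dist_le)
    also have "\<dots> \<le> ln \<Lambda> + ln 4"
      by (rule chord_cost_le) (use \<alpha> z \<Lambda> that(4) in auto)
    finally show ?thesis .
  qed
  have m_line: "markowitz_dist \<Omega> (E z m) (E z (\<Lambda> * m)) \<le> ln \<Lambda> + ln 4"
    if "2 * (\<epsilon> * s) \<le> m" "z \<le> s / 4" "4 * (\<Lambda> * m) \<le> \<eta> * z" for z m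
  proof -
    have es: "0 < \<epsilon> * s" using \<epsilon> s by simp
    then have m: "0 < m" using that(1) by linarith
    then have "0 < \<Lambda> * m" using \<Lambda> by simp
    then have "0 < \<eta> * z" using that(3) by linarith
    then have z: "0 < z" using \<eta>(1) by (simp add: zero_less_mult_iff)
    have \<Lambda>m: "m < \<Lambda> * m" using m \<Lambda> by simp
    have \<eta>z: "\<eta> * z \<le> z" using \<eta>(2) z by simp
    have "null_path \<Omega> (E z 0 + m *\<^sub>R (-1, u)) (E z 0 + (\<Lambda> * m) *\<^sub>R (-1, u))
      \<bar>ln (((\<Lambda> * m - \<epsilon> * s) / (\<eta> * z / 2 - \<Lambda> * m)) / ((m - \<epsilon> * s) / (\<eta> * z / 2 - m)))\<bar>"
    proof (rule null_path_chord[OF ll(2)])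
      fix r assume r: "\<epsilon> * s < r" "r < \<eta> * z / 2"
      then show "E z 0 + r *\<^sub>R (-1, u) \<in> \<Omega>"
        by (subst E_m[symmetric], intro E_mem) (use that(2) \<eta>z s in auto)
    qed (use \<Lambda>m that m es in linarith)+
    then have "markowitz_dist \<Omega> (E z m) (E z (\<Lambda> * m))
      \<le> \<bar>ln (((\<Lambda> * m - \<epsilon> * s) / (\<eta> * z / 2 - \<Lambda> * m)) / ((m - \<epsilon> * s) / (\<eta> * z / 2 - m)))\<bar>"
      unfolding E_m[of z m] E_m[of z "\<Lambda> * m"] by (rule markowitz_dist_le)
    also have "\<dots> \<le> ln \<Lambda> + ln 4"
      by (rule chord_cost_le) (use m es \<Lambda> that in auto)
    finally show ?thesis .
  qed
  \<comment> \<open>The larger coordinates are \<open>s / 4\<close> and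
    \<open>\<eta> * z0 / 4\<close>, the smaller ones a factor \<open>\<Lambda>\<close> below. So the
    least \<open>m\<close> is \<open>\<eta> * s / (16 * \<Lambda>\<^sup>2)\<close>; making it equal
    to \<open>2 * (\<epsilon> * s)\<close> is the origin of \<open>32 * \<Lambda>\<^sup>2\<close> in
    the hypothesis on \<open>\<xi>\<close>.\<close>
  define z0 where "z0 = s / 4 / \<Lambda>"
  define m0 where "m0 = \<eta> * z0 / 4 / \<Lambda>"
  have z0: "\<Lambda> * z0 = s / 4" "0 < z0" using \<Lambda> s by (simp_all add: z0_def)
  have m0: "4 * (\<Lambda> * m0) = \<eta> * z0" "0 < m0" using \<Lambda> \<eta>(1) z0 by (simp_all add: m0_def)
  have \<epsilon>m0: "2 * (\<epsilon> * s) = m0"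
    using \<Lambda> by (simp add: \<epsilon>_def m0_def z0_def power2_eq_square)
  have z0s: "z0 \<le> s / 4" "z0 \<le> \<Lambda> * z0" using z0 \<Lambda> by (simp_all flip: z0(1))
  have m0le: "m0 \<le> \<Lambda> * m0" using m0 \<Lambda> by simp
  have \<eta>z0: "\<eta> * z0 \<le> z0" "\<eta> * z0 \<le> \<eta> * (\<Lambda> * z0)" using \<eta>(1,2) z0 z0s by simp_all
  have es: "0 < \<epsilon> * s" using \<epsilon> s by simp
  define X where "X = E z0 m0"
  define P where "P = E (\<Lambda> * z0) m0"
  define Q where "Q = E z0 (\<Lambda> * m0)"
  define Z where "Z = E (\<Lambda> * z0) (\<Lambda> * m0)"
  have mem: "X \<in> \<Omega>" "P \<in> \<Omega>" "Q \<in> \<Omega>" "Z \<in> \<Omega>"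
    unfolding X_def P_def Q_def Z_def
    by (rule E_mem; use \<epsilon>m0 m0 m0le z0 z0s \<eta>z0 es s in linarith)+
  have sides: "markowitz_dist \<Omega> X P \<le> ln \<Lambda> + ln 4" "markowitz_dist \<Omega> P Z \<le> ln \<Lambda> + ln 4"
    "markowitz_dist \<Omega> X Q \<le> ln \<Lambda> + ln 4" "markowitz_dist \<Omega> Q Z \<le> ln \<Lambda> + ln 4"
    unfolding X_def P_def Q_def Z_def
    by ((rule z_line | rule m_line); use \<epsilon>m0 m0 m0le z0 z0s \<eta>z0 es s in linarith)+
  have diag1: "2 * ln \<Lambda> \<le> markowitz_dist \<Omega> X Z"
  proof -
    \<comment> \<open>Positivity: as \<open>upper\<close> and \<open>lower\<close> agree at
      \<open>b\<close>, the Lipschitz bounds place all of \<open>\<Omega>\<close> at spacelike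
      separation from \<open>(\<beta>, b)\<close>. From \<open>X\<close> to \<open>Z\<close> both
      factors of \<open>4 * (z * m)\<close> grow by \<open>\<Lambda>\<close>.\<close>
    define \<Phi> where "\<Phi> = (\<lambda>x. mink (x - (\<beta>, b)) (x - (\<beta>, b)))"
    have "ln (\<Phi> Z / \<Phi> X) \<le> markowitz_dist \<Omega> X Z"
    proof (rule ln_ratio_le_markowitz_dist[OF mem(1,4)])
      fix x assume x: "x \<in> \<Omega>"
      have "\<bar>fst x - \<beta>\<bar> < dist (snd x) b"
        using x upper_lipschitz[of "snd x" b] lower_lipschitz[of b "snd x"] rim
        by (auto simp: mem_iff \<beta>_def dist_commute)
      then have "\<bar>fst x - \<beta>\<bar>\<^sup>2 < (dist (snd x) b)\<^sup>2" by (intro power_strict_mono) auto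
      then show "0 < \<Phi> x" by (simp add: \<Phi>_def mink_def dist_norm dot_square_norm power2_eq_square)
    next
      fix x v :: "'n minkowski" assume "lightlike v"
      then have "\<Phi> (x + r *\<^sub>R v) = \<Phi> x + 2 * mink (x - (\<beta>, b)) v * r" for r
        using mink_expand[of "x - (\<beta>, b)" r v] by (simp add: \<Phi>_def lightlike_def add_diff_eq diff_add_eq)
      then show "\<exists>c. \<forall>r. \<Phi> (x + r *\<^sub>R v) = \<Phi> x + c * r" by blast
    qed
    moreover have \<Phi>E: "\<Phi> (E z m) = 4 * (z * m)" for z m
    proof -
      have "E z m - (\<beta>, b) = (z - m, (z + m) *\<^sub>R u)" "u \<bullet> u = 1"
        using u by (simp_all add: E_def dot_square_norm)
      then have "\<Phi> (E z m) = - ((z - m) * (z - m)) + (z + m) * ((z + m) * 1)"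
        unfolding \<Phi>_def mink_def by (simp only: fst_conv snd_conv inner_scaleR_left inner_scaleR_right)
      then show ?thesis by (simp add: algebra_simps)
    qed
    have "\<Phi> Z / \<Phi> X = \<Lambda> * \<Lambda>" using z0(2) m0(2) by (simp add: X_def Z_def \<Phi>E)
    ultimately show ?thesis using \<Lambda> by (simp add: ln_mult)
  qed
  have diag2: "ln \<Lambda> - ln 5 \<le> markowitz_dist \<Omega> P Q"
  proof -
    \<comment> \<open>Here \<open>F\<close> is about \<open>2 * m\<close> whatever \<open>z\<close>
      is: \<open>\<kappa>\<close> and \<open>z0 * (1 - \<nu>)\<close> are at most
      \<open>\<epsilon> * s = m0 / 2\<close>. The two resulting bounds leave the factor 5.\<close>
    define F where "F = supporting \<Omega> q \<xi>"
    have FE: "F (E z m) = \<kappa> + m * (1 + \<nu>) - z * (1 - \<nu>)" for z m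
      by (simp add: F_def supporting_def E_def b_def \<kappa>_def inner_diff_right inner_add_right \<xi>u algebra_simps)
    have pos: "0 < F x" if "x \<in> \<Omega>" for x unfolding F_def by (rule supporting_pos[OF \<xi> that])
    have aff: "\<exists>c. \<forall>r. F (x + r *\<^sub>R v) = F x + c * r" for x v
      unfolding F_def using supporting_affine by blast
    have ln: "ln (F Q / F P) \<le> markowitz_dist \<Omega> P Q"
      by (rule ln_ratio_le_markowitz_dist[OF mem(2,3) pos aff])
    have "z0 * (1 - \<nu>) \<le> s * \<epsilon>" using z0s s \<nu> \<epsilon> z0 by (intro mult_mono) auto
    moreover have "0 \<le> \<Lambda> * m0 * \<nu>" using \<Lambda> m0 \<nu>0 by simp
    ultimately have FQ: "\<Lambda> * m0 / 2 \<le> F Q"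
      unfolding Q_def FE using \<kappa> \<epsilon>m0 m0le by (simp add: algebra_simps)
    have "m0 * \<nu> \<le> m0" using \<nu> m0 by simp
    moreover have "0 \<le> \<Lambda> * z0 * (1 - \<nu>)" using \<Lambda> z0 \<nu> by simp
    ultimately have FP: "F P \<le> 5 * m0 / 2"
      unfolding P_def FE using \<kappa> \<epsilon>m0 by (simp add: algebra_simps)
    have "\<Lambda> / 5 = (\<Lambda> * m0 / 2) / (5 * m0 / 2)" using m0 by simp
    also have "\<dots> \<le> F Q / F P"
      using FQ FP pos[OF mem(2)] pos[OF mem(3)] by (intro frac_le) linarith+
    finally have "ln (\<Lambda> / 5) \<le> ln (F Q / F P)" using \<Lambda> by (intro ln_mono) auto
    then show ?thesis using ln \<Lambda> by (simp add: ln_div)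
  qed
  from mem sides diag1 diag2 show ?thesis by blast
qed

lemma thin_bigons_imp_upper_lipschitz:
  assumes "thin_bigons \<Omega> (markowitz_dist \<Omega>)"
  shows "\<exists>k. 0 \<le> k \<and> k < 1 \<and> (\<forall>p\<in>snd ` \<Omega>. \<forall>q\<in>snd ` \<Omega>. upper \<Omega> p \<le> upper \<Omega> q + k * dist p q)"
proof -
  obtain r where r: "\<And>x z p q h C. \<lbrakk>x \<in> \<Omega>; z \<in> \<Omega>; p \<in> \<Omega>; q \<in> \<Omega>; 0 \<le> h;
      markowitz_dist \<Omega> x p \<le> h + C; markowitz_dist \<Omega> p z \<le> h + C; markowitz_dist \<Omega> x q \<le> h + C;
      markowitz_dist \<Omega> q z \<le> h + C; 2 * h \<le> markowitz_dist \<Omega> x z\<rbrakk>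
      \<Longrightarrow> markowitz_dist \<Omega> p q \<le> 2 * C + 4 * r"
    using assms unfolding thin_bigons_def by blast
  obtain \<eta> where \<eta>: "0 < \<eta>" "\<eta> \<le> 1"
      "\<And>b y. upper \<Omega> b = lower \<Omega> b \<Longrightarrow> lower \<Omega> y \<le> upper \<Omega> y \<Longrightarrow>
        lower \<Omega> y \<le> upper \<Omega> b + (1 - \<eta>) * dist b y"
    using rim_slope by blast
  \<comment> \<open>With \<open>h = ln \<Lambda>\<close> and \<open>C = ln 4\<close>, thin bigons
    would allow at most \<open>2 * ln 4 + 4 * r\<close> for the diagonal that is at least
    \<open>ln \<Lambda> - ln 5\<close>.\<close>
  define \<Lambda> where "\<Lambda> = exp (\<bar>2 * ln 4 + 4 * r + ln 5\<bar> + 1)"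
  have \<Lambda>: "1 < \<Lambda>" "2 * ln 4 + 4 * r + ln 5 < ln \<Lambda>" by (simp_all add: \<Lambda>_def add_nonneg_pos)
  define k where "k = 1 - \<eta> / (32 * \<Lambda>\<^sup>2)"
  have "1 < \<Lambda>\<^sup>2" using \<Lambda> by simp
  then have "\<eta> < 32 * \<Lambda>\<^sup>2" using \<eta>(2) by linarith
  then have k: "0 \<le> k" "k < 1" using \<eta>(1) \<Lambda>(1) by (simp_all add: k_def divide_le_eq)
  have "upper \<Omega> p \<le> upper \<Omega> q + k * dist p q" if q: "q \<in> snd ` \<Omega>" for p q
  proof -
    obtain \<xi> where \<xi>: "\<And>p. upper \<Omega> p \<le> upper \<Omega> q + \<xi> \<bullet> (p - q)" using supergradient by blast
    have "norm \<xi> \<le> k"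
    proof (rule ccontr)
      assume "\<not> norm \<xi> \<le> k"
      then have steep: "1 - \<eta> / (32 * \<Lambda>\<^sup>2) \<le> norm \<xi>" by (simp add: k_def)
      obtain x z p p' where "x \<in> \<Omega>" "z \<in> \<Omega>" "p \<in> \<Omega>" "p' \<in> \<Omega>"
        "markowitz_dist \<Omega> x p \<le> ln \<Lambda> + ln 4" "markowitz_dist \<Omega> p z \<le> ln \<Lambda> + ln 4"
        "markowitz_dist \<Omega> x p' \<le> ln \<Lambda> + ln 4" "markowitz_dist \<Omega> p' z \<le> ln \<Lambda> + ln 4"
        "2 * ln \<Lambda> \<le> markowitz_dist \<Omega> x z" "ln \<Lambda> - ln 5 \<le> markowitz_dist \<Omega> p p'"
        using flat_quadrilateral[OF \<eta> q \<xi> \<Lambda>(1) steep] by blast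
      then show False
        using r[of x z p p' "ln \<Lambda>" "ln 4"] \<Lambda> by simp
    qed
    have "\<xi> \<bullet> (p - q) \<le> norm \<xi> * dist p q" by (simp add: norm_cauchy_schwarz dist_norm)
    also have "\<dots> \<le> k * dist p q" by (rule mult_right_mono[OF \<open>norm \<xi> \<le> k\<close>]) simp
    finally show ?thesis using \<xi>[of p] by simp
  qed
  then show ?thesis using k by blast
qed

interpretation rev: causal_body "trev ` \<Omega>"
  by (rule causal_body_trev) (rule causal_body_axioms)

lemma thin_bigons_imp_lower_lipschitz:
  assumes "thin_bigons \<Omega> (markowitz_dist \<Omega>)"
  shows "\<exists>k. 0 \<le> k \<and> k < 1 \<and> (\<forall>p\<in>snd ` \<Omega>. \<forall>q\<in>snd ` \<Omega>. lower \<Omega> p \<le> lower \<Omega> q + k * dist p q)"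
proof -
  have "thin_bigons (trev ` \<Omega>) (markowitz_dist (trev ` \<Omega>))"
    using assms unfolding thin_bigons_def by (simp add: markowitz_dist_trev)
  then obtain k where k: "0 \<le> k" "k < 1" and
    lip: "\<And>p q. p \<in> snd ` trev ` \<Omega> \<Longrightarrow> q \<in> snd ` trev ` \<Omega> \<Longrightarrow>
      upper (trev ` \<Omega>) p \<le> upper (trev ` \<Omega>) q + k * dist p q"
    using rev.thin_bigons_imp_upper_lipschitz by blast
  have "lower \<Omega> p \<le> lower \<Omega> q + k * dist p q" if "p \<in> snd ` \<Omega>" "q \<in> snd ` \<Omega>" for p q
    using lip[of q p] that by (simp add: image_image upper_trev dist_commute)
  then show ?thesis using k by blast
qed

end

subsection \<open>Causal curves and the causal boundary\<close>

lemma smooth_curve_on_affine: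
  assumes "\<And>s. s \<in> S \<Longrightarrow> g s = a + s *\<^sub>R v"
  shows "smooth_curve_on S g" and "s \<in> S \<Longrightarrow> (g has_vector_derivative v) (at s within S)"
proof -
  show g: "(g has_vector_derivative v) (at s within S)" if "s \<in> S" for s
  proof (rule has_vector_derivative_transform[OF that])
    show "((\<lambda>s. a + s *\<^sub>R v) has_vector_derivative v) (at s within S)"
      by (auto intro!: derivative_eq_intros)
  qed (use assms in auto)
  show "smooth_curve_on S g"
    unfolding smooth_curve_on_def
  proof (rule exI[of _ "\<lambda>k::nat. if k = 0 then g else (\<lambda>_. if k = 1 then v else 0)"],
      intro conjI allI ballI)
    let ?D = "\<lambda>k::nat. if k = 0 then g else (\<lambda>_. if k = 1 then v else 0)"
    show "?D 0 = g" by simp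
    show "(?D k has_vector_derivative ?D (Suc k) t) (at t within S)" if "t \<in> S" for k :: nat and t
      using g[OF that] by auto
  qed
qed

lemma causal_curve_affine_pieces:
  assumes \<tau>: "\<And>i. i < N \<Longrightarrow> \<tau> i < \<tau> (Suc i)"
    and g: "\<And>i s. i < N \<Longrightarrow> s \<in> {\<tau> i..\<tau> (Suc i)} \<Longrightarrow> g s = a i + s *\<^sub>R v i"
    and cont: "continuous_on {\<tau> 0..\<tau> N} g" and less: "\<tau> 0 < \<tau> N"
    and causal: "(\<forall>i<N. future_causal B (v i)) \<or> (\<forall>i<N. past_causal B (v i))"
  shows "causal_curve B g (\<tau> 0) (\<tau> N)"
proof -
  have vd: "vector_derivative g (at t within {\<tau> i..\<tau> (Suc i)}) = v i"
    if "i < N" "t \<in> {\<tau> i..\<tau> (Suc i)}" for i t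
    using vector_derivative_within_closed_interval[OF \<tau>[OF that(1)] that(2)]
      smooth_curve_on_affine(2)[OF g[OF that(1)] that(2)] by blast
  have "smooth_curve_on {\<tau> i..\<tau> (Suc i)} g" if "i < N" for i
    by (rule smooth_curve_on_affine(1)) (rule g[OF that])
  then show ?thesis
    unfolding causal_curve_def
    using less cont \<tau> causal vd
    by (intro conjI exI[of _ N] exI[of _ \<tau>]) auto
qed

text \<open>The line from \<open>x\<close> to \<open>y\<close> broken at \<open>z\<close> is a
  causal curve, since both of its velocities are future timelike; \<open>z\<close> is placed at
  parameter 0.\<close>

lemma causally_convex_diamond:
  assumes \<Omega>: "causally_convex \<Omega>" and xy: "x \<in> \<Omega>" "y \<in> \<Omega>"
    and z: "dist (snd z) (snd x) < fst z - fst x" "dist (snd z) (snd y) < fst y - fst z"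
  shows "z \<in> \<Omega>"
proof -
  have fut: "future_causal mink v" if "norm (snd v) < fst v" for v :: "'a minkowski"
  proof -
    have "(norm (snd v))\<^sup>2 \<le> (fst v)\<^sup>2" using that by (intro power_mono) auto
    moreover have "0 < fst v" using that norm_ge_zero[of "snd v"] by linarith
    ultimately show ?thesis
      by (auto simp: future_causal_def causal_vec_def mink_def dot_square_norm power2_eq_square zero_prod_def)
  qed
  define g where "g = (\<lambda>s::real. if s \<le> 0 then z + s *\<^sub>R (z - x) else z + s *\<^sub>R (y - z))"
  define \<tau> where "\<tau> = (\<lambda>i::nat. real i - 1)"
  define v where "v = (\<lambda>i::nat. if i = 0 then z - x else y - z)"
  have "causal_curve mink g (\<tau> 0) (\<tau> 2)"
  proof (rule causal_curve_affine_pieces)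
    fix i :: nat and s assume "i < 2" "s \<in> {\<tau> i..\<tau> (Suc i)}"
    then show "g s = z + s *\<^sub>R v i"
      by (cases "i = 0"; cases "s = 0") (auto simp: g_def v_def \<tau>_def)
  next
    have "continuous_on ({..0} \<union> {0..}) g"
      unfolding g_def
      by (rule continuous_on_cases) (auto intro!: continuous_intros)
    then show "continuous_on {\<tau> 0..\<tau> 2} g" by (rule continuous_on_subset) auto
  next
    show "(\<forall>i<2. future_causal mink (v i)) \<or> (\<forall>i<2. past_causal mink (v i))"
      using fut[of "z - x"] fut[of "y - z"] z
      by (auto simp: v_def dist_norm norm_minus_commute less_2_cases_iff)
  qed (auto simp: \<tau>_def)
  then have "causal_curve mink g (-1) 1" by (simp add: \<tau>_def)
  moreover have "g (-1) = x" "g 1 = y" by (simp_all add: g_def)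
  ultimately have "g ` {-1..1} \<subseteq> \<Omega>" using \<Omega> xy unfolding causally_convex_def by blast
  moreover have "g 0 = z" by (simp add: g_def)
  ultimately show ?thesis by force
qed

lemma causally_related_if:
  assumes \<epsilon>: "0 < \<epsilon>" and "x \<noteq> y"
    and le: "norm (snd y - snd x) \<le> (1 + \<epsilon>) * \<bar>fst y - fst x\<bar>"
  shows "causally_related (mink_eps \<epsilon>) x y"
proof -
  define w where "w = y - x"
  have "fst w \<noteq> 0"
  proof
    assume "fst w = 0"
    then show False using le \<open>x \<noteq> y\<close> by (simp add: w_def prod_eq_iff)
  qed
  have "(norm (snd w))\<^sup>2 \<le> ((1 + \<epsilon>) * \<bar>fst w\<bar>)\<^sup>2"
    using le \<epsilon> by (intro power_mono) (auto simp: w_def)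
  then have "causal_vec (mink_eps \<epsilon>) w"
    using \<open>fst w \<noteq> 0\<close>
    by (auto simp: causal_vec_def mink_eps_def dot_square_norm power_mult_distrib power2_eq_square[of "fst w"] zero_prod_def)
  moreover have "mink_eps \<epsilon> w (1, 0) = - ((1 + \<epsilon>)\<^sup>2 * fst w)" by (simp add: mink_eps_def)
  moreover have "0 < (1 + \<epsilon>)\<^sup>2" using \<epsilon> by simp
  ultimately have "future_causal (mink_eps \<epsilon>) w \<or> past_causal (mink_eps \<epsilon>) w"
    using \<open>fst w \<noteq> 0\<close> by (auto simp: future_causal_def past_causal_def zero_less_mult_iff mult_less_0_iff)
  then have "causal_curve (mink_eps \<epsilon>) (\<lambda>s. x + s *\<^sub>R w) (real 0) (real 1)"
    by (intro causal_curve_affine_pieces[where v = "\<lambda>_. w" and a = "\<lambda>_. x"])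
      (auto intro!: continuous_intros)
  then show ?thesis
    unfolding causally_related_def by (intro exI[of _ "\<lambda>s. x + s *\<^sub>R w"] exI[of _ 0] exI[of _ 1]) (simp add: w_def)
qed

text \<open>The cone condition on the velocity integrates along each smooth piece by the mean value
  inequality. The common time direction \<open>\<sigma>\<close> removes the absolute value, so that
  the bounds of the pieces add up.\<close>

lemma causally_relatedD:
  assumes \<epsilon>: "0 < \<epsilon>" and rel: "causally_related (mink_eps \<epsilon>) x y"
  shows "norm (snd y - snd x) \<le> (1 + \<epsilon>) * \<bar>fst y - fst x\<bar>"
proof -
  obtain g a b where c: "causal_curve (mink_eps \<epsilon>) g a b" and ends: "g a = x" "g b = y"
    using rel unfolding causally_related_def by blast
  obtain N \<tau> where \<tau>: "\<tau> 0 = a" "\<tau> N = b"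
    and piece: "\<And>i. i < N \<Longrightarrow> \<tau> i < \<tau> (Suc i) \<and> smooth_curve_on {\<tau> i..\<tau> (Suc i)} g"
    and dir: "(\<forall>i<N. \<forall>t\<in>{\<tau> i..\<tau> (Suc i)}.
            future_causal (mink_eps \<epsilon>) (vector_derivative g (at t within {\<tau> i..\<tau> (Suc i)}))) \<or>
         (\<forall>i<N. \<forall>t\<in>{\<tau> i..\<tau> (Suc i)}.
            past_causal (mink_eps \<epsilon>) (vector_derivative g (at t within {\<tau> i..\<tau> (Suc i)})))"
    using c unfolding causal_curve_def by blast
  have cone: "norm (snd v) \<le> (1 + \<epsilon>) * \<bar>fst v\<bar>" if "causal_vec (mink_eps \<epsilon>) v" for v :: "'a minkowski"
  proof -
    have "(norm (snd v))\<^sup>2 \<le> ((1 + \<epsilon>) * \<bar>fst v\<bar>)\<^sup>2"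
      using that
      by (simp add: causal_vec_def mink_eps_def dot_square_norm power_mult_distrib power2_eq_square[of "fst v"])
    then show ?thesis by (rule power2_le_imp_le) (use \<epsilon> in auto)
  qed
  obtain \<sigma> :: real where \<sigma>: "\<bar>\<sigma>\<bar> = 1"
    and vel: "\<And>i t. i < N \<Longrightarrow> t \<in> {\<tau> i..\<tau> (Suc i)} \<Longrightarrow>
      norm (snd (vector_derivative g (at t within {\<tau> i..\<tau> (Suc i)})))
      \<le> (1 + \<epsilon>) * (\<sigma> * fst (vector_derivative g (at t within {\<tau> i..\<tau> (Suc i)})))"
  proof -
    have e2: "0 < (1 + \<epsilon>)\<^sup>2" using \<epsilon> by simp
    have f: "norm (snd v) \<le> (1 + \<epsilon>) * (1 * fst v)" if "future_causal (mink_eps \<epsilon>) v" for v :: "'a minkowski"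
      using cone[of v] that e2 by (auto simp: future_causal_def mink_eps_def zero_less_mult_iff)
    have p: "norm (snd v) \<le> (1 + \<epsilon>) * (-1 * fst v)" if "past_causal (mink_eps \<epsilon>) v" for v :: "'a minkowski"
      using cone[of v] that e2 by (auto simp: past_causal_def mink_eps_def mult_less_0_iff)
    from dir show ?thesis
    proof
      assume "\<forall>i<N. \<forall>t\<in>{\<tau> i..\<tau> (Suc i)}.
            future_causal (mink_eps \<epsilon>) (vector_derivative g (at t within {\<tau> i..\<tau> (Suc i)}))"
      then show ?thesis using f by (intro that[of 1]) auto
    next
      assume "\<forall>i<N. \<forall>t\<in>{\<tau> i..\<tau> (Suc i)}.
            past_causal (mink_eps \<epsilon>) (vector_derivative g (at t within {\<tau> i..\<tau> (Suc i)}))"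
      then show ?thesis using p by (intro that[of "-1"]) auto
    qed
  qed
  have step: "norm (snd (g (\<tau> (Suc i))) - snd (g (\<tau> i)))
      \<le> (1 + \<epsilon>) * (\<sigma> * fst (g (\<tau> (Suc i)))) - (1 + \<epsilon>) * (\<sigma> * fst (g (\<tau> i)))" if i: "i < N" for i
  proof -
    let ?I = "{\<tau> i..\<tau> (Suc i)}"
    obtain D where D: "D 0 = g"
      "\<And>k t. t \<in> ?I \<Longrightarrow> (D k has_vector_derivative D (Suc k) t) (at t within ?I)"
      using piece[OF i] unfolding smooth_curve_on_def by blast
    have d: "(g has_vector_derivative D 1 t) (at t within ?I)" if "t \<in> ?I" for t
      using D(2)[OF that, of 0] D(1) by simp
    have vd: "vector_derivative g (at t within ?I) = D 1 t" if "t \<in> ?I" for t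
      using vector_derivative_within_closed_interval[OF _ that d[OF that]] piece[OF i] by blast
    have g_cont: "continuous_on ?I g"
      by (rule continuous_on_vector_derivative) (rule d)
    show ?thesis
    proof (rule differentiable_bound_general)
      show "\<tau> i < \<tau> (Suc i)" using piece[OF i] by blast
      show "continuous_on ?I (\<lambda>t. snd (g t))" "continuous_on ?I (\<lambda>t. (1 + \<epsilon>) * (\<sigma> * fst (g t)))"
        using g_cont by (auto intro!: continuous_intros)
      fix t assume t: "\<tau> i < t" "t < \<tau> (Suc i)"
      then have tI: "t \<in> ?I" by simp
      have dt: "(g has_vector_derivative D 1 t) (at t)"
        using d[OF tI] t by (simp add: at_within_Icc_at)
      show "((\<lambda>t. snd (g t)) has_vector_derivative snd (D 1 t)) (at t)"
        by (rule bounded_linear.has_vector_derivative[OF bounded_linear_snd dt])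
      have "((\<lambda>t. fst (g t)) has_vector_derivative fst (D 1 t)) (at t)"
        by (rule bounded_linear.has_vector_derivative[OF bounded_linear_fst dt])
      then show "((\<lambda>t. (1 + \<epsilon>) * (\<sigma> * fst (g t))) has_vector_derivative (1 + \<epsilon>) * (\<sigma> * fst (D 1 t))) (at t)"
        by (auto intro!: derivative_eq_intros)
      show "norm (snd (D 1 t)) \<le> (1 + \<epsilon>) * (\<sigma> * fst (D 1 t))"
        using vel[OF i tI] vd[OF tI] by simp
    qed
  qed
  have "i \<le> N \<Longrightarrow> norm (snd (g (\<tau> i)) - snd (g (\<tau> 0)))
      \<le> (1 + \<epsilon>) * (\<sigma> * fst (g (\<tau> i))) - (1 + \<epsilon>) * (\<sigma> * fst (g (\<tau> 0)))" for i
  proof (induction i)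
    case (Suc i)
    then show ?case
      using step[of i] norm_triangle_ineq[of "snd (g (\<tau> (Suc i))) - snd (g (\<tau> i))" "snd (g (\<tau> i)) - snd (g (\<tau> 0))"]
      by simp
  qed simp
  from this[of N] have "norm (snd y - snd x) \<le> (1 + \<epsilon>) * (\<sigma> * (fst y - fst x))"
    using \<tau> ends by (simp add: algebra_simps)
  also have "\<dots> \<le> (1 + \<epsilon>) * \<bar>fst y - fst x\<bar>"
  proof (rule mult_left_mono)
    have "\<bar>\<sigma> * (fst y - fst x)\<bar> = \<bar>fst y - fst x\<bar>" using \<sigma> by (simp add: abs_mult)
    then show "\<sigma> * (fst y - fst x) \<le> \<bar>fst y - fst x\<bar>" by linarith
  qed (use \<epsilon> in simp)
  finally show ?thesis .
qed

text \<open>Distinct points are causally related for \<open>mink_eps \<epsilon>\<close> exactly when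
  their spatial distance is at most \<open>1 + \<epsilon>\<close> times their time difference, so
  acausality bounds the slopes of the graph by \<open>1 / (1 + \<epsilon>)\<close>.\<close>

lemma stably_acausal_graph_iff:
  fixes f :: "real ^ 'n::finite \<Rightarrow> real"
  shows "stably_acausal ((\<lambda>p. (f p, p)) ` V) \<longleftrightarrow> (\<exists>k<1. k-lipschitz_on V f)"
proof
  assume "stably_acausal ((\<lambda>p. (f p, p)) ` V)"
  then obtain \<epsilon> where \<epsilon>: "0 < \<epsilon>" and ac: "eps_stably_acausal \<epsilon> ((\<lambda>p. (f p, p)) ` V)"
    unfolding stably_acausal_def by blast
  have "(1 / (1 + \<epsilon>))-lipschitz_on V f"
  proof (rule lipschitz_onI)
    fix p q assume pq: "p \<in> V" "q \<in> V"
    show "dist (f p) (f q) \<le> 1 / (1 + \<epsilon>) * dist p q"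
    proof (cases "p = q")
      case False
      then have "\<not> causally_related (mink_eps \<epsilon>) (f p, p) (f q, q)"
        using ac pq unfolding eps_stably_acausal_def by blast
      then have "\<not> norm (q - p) \<le> (1 + \<epsilon>) * \<bar>f q - f p\<bar>"
        using causally_related_if[OF \<epsilon>, of "(f p, p)" "(f q, q)"] False by auto
      then have "(1 + \<epsilon>) * dist (f p) (f q) \<le> dist p q"
        by (simp add: dist_norm norm_minus_commute dist_real_def abs_minus_commute)
      then show ?thesis using \<epsilon> by (simp add: field_simps)
    qed simp
  qed (use \<epsilon> in simp)
  moreover have "1 / (1 + \<epsilon>) < 1" using \<epsilon> by simp
  ultimately show "\<exists>k<1. k-lipschitz_on V f" by blast
next
  assume "\<exists>k<1. k-lipschitz_on V f"
  then obtain k where k: "k < 1" and lip: "k-lipschitz_on V f" by blast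
  have k0: "0 \<le> k" using lip by (rule lipschitz_on_nonneg)
  \<comment> \<open>A simple choice that works since
    \<open>(1 + \<epsilon>) * k = 1 - (1 - k) * (1 - k)\<close>.\<close>
  define \<epsilon> where "\<epsilon> = 1 - k"
  have \<epsilon>: "0 < \<epsilon>" using k by (simp add: \<epsilon>_def)
  have "0 < (1 - k) * (1 - k)" using k by simp
  then have k\<epsilon>: "(1 + \<epsilon>) * k < 1" by (simp add: \<epsilon>_def algebra_simps)
  have "\<not> causally_related (mink_eps \<epsilon>) (f p, p) (f q, q)" if "p \<in> V" "q \<in> V" "p \<noteq> q" for p q
  proof
    assume "causally_related (mink_eps \<epsilon>) (f p, p) (f q, q)"
    from causally_relatedD[OF \<epsilon> this] have "dist p q \<le> (1 + \<epsilon>) * dist (f p) (f q)"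
      by (simp add: dist_norm norm_minus_commute dist_real_def abs_minus_commute)
    also have "\<dots> \<le> (1 + \<epsilon>) * (k * dist p q)"
      using lipschitz_onD[OF lip that(1,2)] \<epsilon> by (intro mult_left_mono) auto
    also have "\<dots> = ((1 + \<epsilon>) * k) * dist p q" by simp
    also have "\<dots> < 1 * dist p q" using k\<epsilon> that(3) by (intro mult_strict_right_mono) auto
    finally show False by simp
  qed
  then have "eps_stably_acausal \<epsilon> ((\<lambda>p. (f p, p)) ` V)" unfolding eps_stably_acausal_def by blast
  then show "stably_acausal ((\<lambda>p. (f p, p)) ` V)" unfolding stably_acausal_def using \<epsilon> by blast
qed

section \<open>The causal boundaries as graphs of \<open>upper\<close> and
  \<open>lower\<close>\<close>

lemma causal_graph_form_trev:
  assumes "causal_graph_form \<Omega> U fm fp"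
  shows "causal_graph_form (trev ` \<Omega>) U (\<lambda>p. - fp p) (\<lambda>p. - fm p)"
proof -
  have neg: "one_lipschitz_on S (\<lambda>p. - f p)" if "one_lipschitz_on S f" for S and f :: "real ^ 'a \<Rightarrow> ereal"
    unfolding one_lipschitz_on_def
  proof (intro ballI)
    fix p q assume "p \<in> S" "q \<in> S"
    then have "f q \<le> f p + ereal (dist p q)" using that unfolding one_lipschitz_on_def by (metis dist_commute)
    then show "- f p \<le> - f q + ereal (dist p q)"
      by (cases "f p"; cases "f q") auto
  qed
  have "trev ` \<Omega> = {(t, p). p \<in> U \<and> - fp p < ereal t \<and> ereal t < - fm p}"
  proof (intro set_eqI)
    fix x :: "'a minkowski"
    have "- fp p < ereal t \<longleftrightarrow> ereal (- t) < fp p" "ereal t < - fm p \<longleftrightarrow> fm p < ereal (- t)" for t p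
      by (metis ereal_less_uminus_reorder ereal_uminus_less_reorder uminus_ereal.simps(1))+
    then show "x \<in> trev ` \<Omega> \<longleftrightarrow> x \<in> {(t, p). p \<in> U \<and> - fp p < ereal t \<and> ereal t < - fm p}"
      using assms unfolding mem_trev_image causal_graph_form_def
      by (cases x) (auto simp: trev_def)
  qed
  then show ?thesis
    using assms neg unfolding causal_graph_form_def by auto
qed

lemma past_causal_boundary_trev:
  "past_causal_boundary \<Omega> = trev ` future_causal_boundary (trev ` \<Omega>)"
proof (intro set_eqI iffI)
  fix x :: "'a minkowski"
  assume "x \<in> past_causal_boundary \<Omega>"
  then obtain U fm fp where "causal_graph_form \<Omega> U fm fp" "snd x \<in> closure U" "fm (snd x) = ereal (fst x)"
    unfolding past_causal_boundary_def by auto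
  then have "causal_graph_form (trev ` \<Omega>) U (\<lambda>p. - fp p) (\<lambda>p. - fm p)" "snd x \<in> closure U"
    "- fm (snd x) = ereal (- fst x)"
    using causal_graph_form_trev by auto
  then show "x \<in> trev ` future_causal_boundary (trev ` \<Omega>)"
    unfolding mem_trev_image future_causal_boundary_def trev_def by auto
next
  fix x :: "'a minkowski"
  assume "x \<in> trev ` future_causal_boundary (trev ` \<Omega>)"
  then obtain U fm fp where f: "causal_graph_form (trev ` \<Omega>) U fm fp" "snd x \<in> closure U"
      "fp (snd x) = ereal (- fst x)"
    unfolding mem_trev_image future_causal_boundary_def trev_def by auto
  then have "causal_graph_form \<Omega> U (\<lambda>p. - fp p) (\<lambda>p. - fm p)" "- fp (snd x) = ereal (fst x)"
    using causal_graph_form_trev[OF f(1)] by auto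
  then show "x \<in> past_causal_boundary \<Omega>"
    unfolding past_causal_boundary_def using f(2) by (cases x) auto
qed

context causal_body
begin

lemma causal_graph_form_upper_lower:
  "causal_graph_form \<Omega> (snd ` \<Omega>) (\<lambda>p. ereal (lower \<Omega> p)) (\<lambda>p. ereal (upper \<Omega> p))"
  unfolding causal_graph_form_def
proof (intro conjI ballI)
  show "open (snd ` \<Omega>)" by (rule projection_open)
  show "one_lipschitz_on (closure (snd ` \<Omega>)) (\<lambda>p. ereal (lower \<Omega> p))"
    "one_lipschitz_on (closure (snd ` \<Omega>)) (\<lambda>p. ereal (upper \<Omega> p))"
    unfolding one_lipschitz_on_def using lower_lipschitz upper_lipschitz by auto
  show "ereal (lower \<Omega> p) < ereal (upper \<Omega> p)" if "p \<in> snd ` \<Omega>" for p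
    using that by (simp add: projection_eq)
  show "ereal (lower \<Omega> p) = ereal (upper \<Omega> p)" if p: "p \<in> frontier (snd ` \<Omega>)" for p
  proof -
    have "closed {p. lower \<Omega> p \<le> upper \<Omega> p}"
      by (intro closed_Collect_le continuous_lower continuous_upper)
    then have "closure (snd ` \<Omega>) \<subseteq> {p. lower \<Omega> p \<le> upper \<Omega> p}"
      by (intro closure_minimal) (auto simp: projection_eq)
    then have "lower \<Omega> p \<le> upper \<Omega> p" using p by (auto simp: frontier_def)
    moreover have "p \<notin> snd ` \<Omega>"
      using p projection_open by (auto simp: frontier_def interior_open)
    ultimately show ?thesis by (simp add: projection_eq)
  qed
  show "\<Omega> = {(t, p). p \<in> snd ` \<Omega> \<and> ereal (lower \<Omega> p) < ereal t \<and> ereal t < ereal (upper \<Omega> p)}"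
    by (auto simp: mem_iff projection_eq)
qed

lemma causal_graph_form_unique:
  assumes form: "causal_graph_form \<Omega> U fm fp"
  shows "U = snd ` \<Omega>" and "p \<in> U \<Longrightarrow> fp p = ereal (upper \<Omega> p)"
proof -
  have mem: "(t, p) \<in> \<Omega> \<longleftrightarrow> p \<in> U \<and> fm p < ereal t \<and> ereal t < fp p" for t p
    using form unfolding causal_graph_form_def by blast
  have lt: "fm p < fp p" if "p \<in> U" for p using form that unfolding causal_graph_form_def by blast
  show U: "U = snd ` \<Omega>"
  proof (intro set_eqI iffI)
    fix p assume p: "p \<in> U"
    obtain t where "fm p < ereal t" "ereal t < fp p" using ereal_dense2[OF lt[OF p]] by blast
    then have "(t, p) \<in> \<Omega>" using mem p by blast
    then show "p \<in> snd ` \<Omega>" by force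
  qed (use mem in force)
  show "fp p = ereal (upper \<Omega> p)" if p: "p \<in> U"
  proof (rule antisym)
    show "fp p \<le> ereal (upper \<Omega> p)"
    proof (rule ccontr)
      assume "\<not> fp p \<le> ereal (upper \<Omega> p)"
      then have "max (fm p) (ereal (upper \<Omega> p)) < fp p" using lt[OF p] by simp
      then obtain t where t: "max (fm p) (ereal (upper \<Omega> p)) < ereal t" "ereal t < fp p"
        using ereal_dense2 by blast
      then have "(t, p) \<in> \<Omega>" using mem p by simp
      then show False using t(1) by (simp add: mem_iff)
    qed
    show "ereal (upper \<Omega> p) \<le> fp p"
    proof (rule ccontr)
      assume "\<not> ereal (upper \<Omega> p) \<le> fp p"
      moreover have "lower \<Omega> p < upper \<Omega> p" using p U projection_eq by blast
      ultimately have "max (fp p) (ereal (lower \<Omega> p)) < ereal (upper \<Omega> p)" by simp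
      then obtain t where t: "max (fp p) (ereal (lower \<Omega> p)) < ereal t" "ereal t < ereal (upper \<Omega> p)"
        using ereal_dense2 by blast
      then have "(t, p) \<in> \<Omega>" by (simp add: mem_iff)
      then show False using t(1) mem by (auto simp: not_less_iff_gr_or_eq dest: order.strict_trans)
    qed
  qed
qed

text \<open>Over the projection every graph form has the value \<open>upper\<close>; at a point of
  the closure the Lipschitz bounds force agreement. Comparison with a nearby \<open>q\<close> in
  \<open>U\<close> avoids limits in \<open>ereal\<close>.\<close>

lemma future_causal_boundary_eq:
  "future_causal_boundary \<Omega> = (\<lambda>p. (upper \<Omega> p, p)) ` closure (snd ` \<Omega>)"
proof (intro set_eqI iffI)
  fix x assume "x \<in> (\<lambda>p. (upper \<Omega> p, p)) ` closure (snd ` \<Omega>)"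
  then show "x \<in> future_causal_boundary \<Omega>"
    using causal_graph_form_upper_lower unfolding future_causal_boundary_def by blast
next
  fix x assume "x \<in> future_causal_boundary \<Omega>"
  then obtain t p U fm fp where x: "x = (t, p)" and form: "causal_graph_form \<Omega> U fm fp"
    and p: "p \<in> closure U" "fp p = ereal t"
    unfolding future_causal_boundary_def by blast
  have "\<bar>t - upper \<Omega> p\<bar> \<le> 0"
  proof (rule field_le_epsilon)
    fix e :: real assume "0 < e"
    then obtain q where q: "q \<in> U" "dist q p < e / 2"
      using p(1) half_gt_zero unfolding closure_approachable by blast
    have lip: "one_lipschitz_on (closure U) fp" using form unfolding causal_graph_form_def by blast
    have qc: "q \<in> closure U" using q(1) closure_subset by blast
    have fq: "fp q = ereal (upper \<Omega> q)" by (rule causal_graph_form_unique(2)[OF form q(1)])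
    have "ereal t \<le> ereal (upper \<Omega> q) + ereal (dist p q)" "ereal (upper \<Omega> q) \<le> ereal t + ereal (dist q p)"
      using lip p(1) qc unfolding one_lipschitz_on_def p(2)[symmetric] fq[symmetric] by blast+
    then show "\<bar>t - upper \<Omega> p\<bar> \<le> 0 + e"
      using q(2) upper_lipschitz[of p q] upper_lipschitz[of q p] by (simp add: dist_commute)
  qed
  then show "x \<in> (\<lambda>p. (upper \<Omega> p, p)) ` closure (snd ` \<Omega>)"
    using x p(1) causal_graph_form_unique(1)[OF form] by auto
qed

interpretation rev: causal_body "trev ` \<Omega>"
  by (rule causal_body_trev) (rule causal_body_axioms)

lemma past_causal_boundary_eq:
  "past_causal_boundary \<Omega> = (\<lambda>p. (lower \<Omega> p, p)) ` closure (snd ` \<Omega>)"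
  unfolding past_causal_boundary_trev rev.future_causal_boundary_eq image_image
  by (simp add: upper_trev) (simp add: trev_def)

text \<open>Lipschitz constants pass to the closure by continuity of \<open>upper\<close>, so the
  criterion can be stated over the open projection.\<close>

lemma stably_acausal_future_iff:
  "stably_acausal (future_causal_boundary \<Omega>) \<longleftrightarrow> (\<exists>k<1. k-lipschitz_on (snd ` \<Omega>) (upper \<Omega>))"
  unfolding future_causal_boundary_eq stably_acausal_graph_iff
  using lipschitz_on_closure[OF _ continuous_upper] lipschitz_on_subset[OF _ closure_subset] by blast

lemma stably_acausal_past_iff:
  "stably_acausal (past_causal_boundary \<Omega>) \<longleftrightarrow> (\<exists>k<1. k-lipschitz_on (snd ` \<Omega>) (lower \<Omega>))"
  unfolding past_causal_boundary_eq stably_acausal_graph_iff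
  using lipschitz_on_closure[OF _ continuous_lower] lipschitz_on_subset[OF _ closure_subset] by blast

lemma lipschitz_onI_one_sided:
  fixes f :: "real ^ 'n \<Rightarrow> real"
  assumes "0 \<le> k" "\<And>p q. p \<in> S \<Longrightarrow> q \<in> S \<Longrightarrow> f p \<le> f q + k * dist p q"
  shows "k-lipschitz_on S f"
proof (rule lipschitz_onI)
  fix p q assume "p \<in> S" "q \<in> S"
  then show "dist (f p) (f q) \<le> k * dist p q"
    using assms(2)[of p q] assms(2)[of q p] by (auto simp: dist_real_def dist_commute)
qed (rule assms)

theorem gromov_hyperbolic_iff:
  "gromov_hyperbolic \<Omega> (markowitz_dist \<Omega>) \<longleftrightarrow>
    (\<exists>k<1. k-lipschitz_on (snd ` \<Omega>) (upper \<Omega>)) \<and> (\<exists>k<1. k-lipschitz_on (snd ` \<Omega>) (lower \<Omega>))"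
proof
  assume "gromov_hyperbolic \<Omega> (markowitz_dist \<Omega>)"
  then have thin: "thin_bigons \<Omega> (markowitz_dist \<Omega>)" by (rule gromov_hyperbolic_imp_thin_bigons)
  show "(\<exists>k<1. k-lipschitz_on (snd ` \<Omega>) (upper \<Omega>)) \<and> (\<exists>k<1. k-lipschitz_on (snd ` \<Omega>) (lower \<Omega>))"
    using thin_bigons_imp_upper_lipschitz[OF thin] thin_bigons_imp_lower_lipschitz[OF thin]
      lipschitz_onI_one_sided by metis
next
  assume "(\<exists>k<1. k-lipschitz_on (snd ` \<Omega>) (upper \<Omega>)) \<and> (\<exists>k<1. k-lipschitz_on (snd ` \<Omega>) (lower \<Omega>))"
  then obtain k k' where k: "k < 1" "k-lipschitz_on (snd ` \<Omega>) (upper \<Omega>)"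
    "k' < 1" "k'-lipschitz_on (snd ` \<Omega>) (lower \<Omega>)" by blast
  have lip: "(max k k')-lipschitz_on (snd ` \<Omega>) (upper \<Omega>)" "(max k k')-lipschitz_on (snd ` \<Omega>) (lower \<Omega>)"
    using k by (auto elim: lipschitz_on_mono)
  interpret spacelike_body \<Omega> "max k k'"
  proof
    show "0 \<le> max k k'" using lip(1) by (rule lipschitz_on_nonneg)
    fix p q assume "p \<in> snd ` \<Omega>" "q \<in> snd ` \<Omega>"
    then show "upper \<Omega> p \<le> upper \<Omega> q + max k k' * dist p q" "lower \<Omega> p \<le> lower \<Omega> q + max k k' * dist p q"
      using lipschitz_onD[OF lip(1)] lipschitz_onD[OF lip(2)] by (fastforce simp: dist_real_def)+
  qed (use k in simp)
  show "gromov_hyperbolic \<Omega> (markowitz_dist \<Omega>)" by (rule markowitz_gromov_hyperbolic)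
qed

end

theorem theoremA:
  fixes \<Omega> :: "'n::finite minkowski set"
  assumes "mink_domain \<Omega>"
    and "bounded \<Omega>"
    and "convex \<Omega>"
    and "causally_convex \<Omega>"
  shows "gromov_hyperbolic \<Omega> (markowitz_dist \<Omega>) \<longleftrightarrow>
    stably_acausal (future_causal_boundary \<Omega>) \<and> stably_acausal (past_causal_boundary \<Omega>)"
proof -
  interpret causal_body \<Omega>
  proof
    show "open \<Omega>" "\<Omega> \<noteq> {}" using assms(1) by (auto simp: mink_domain_def)
    show "bounded \<Omega>" "convex \<Omega>" by (fact assms)+
  qed (rule causally_convex_diamond[OF assms(4)])
  show ?thesis
    by (simp only: gromov_hyperbolic_iff stably_acausal_future_iff stably_acausal_past_iff)
qed

end
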